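(* Let $\mathcal{H}$ be a real Hilbert space, $f:\mathcal{H}\to\mathbb{R}\cup\{+\infty\}$ proper, convex and lower semicontinuous, and $h:\mathcal{H}\to\mathbb{R}$ convex and differentiable with $\nu$-Lipschitz continuous gradient, $\nu>0$. Let $m\ge1$ be an integer and for each $i=1,\dots,m$ let $\mathcal{G}_i$ be a real Hilbert space, $g_i:\mathcal{G}_i\to\mathbb{R}\cup\{+\infty\}$ proper, convex and lower semicontinuous, and $L_i:\mathcal{H}\to\mathcal{G}_i$ a nonzero linear continuous operator. Let $\Psi:\mathcal{H}\to\mathbb{R}$ be convex and differentiable with $\mu^{-1}$-Lipschitz continuous gradient, $\mu>0$, fulfilling $\min\Psi=0$, and let $C=\arg\min\Psi$. Consider the problem $$(P)\qquad\inf_{x\in\arg\min\Psi}\Big\{f(x)+\sum_{i=1}^mg_i(L_ix)+h(x)\Big\}.$$ Let $(\lambda_n)_{n\ge0}$, $(\beta_n)_{n\ge0}$ be sequences of positive real numbers. Let $(x_0,v_{1,0},\dots,v_{m,0})\in\mathcal{H}\times\mathcal{G}_1\times\dots\times\mathcal{G}_m$, $y_{-1}=x_0$, $q_{i,-1}=v_{i,0}$ for $i=1,\dots,m$, and for every $n\ge0$ set $$y_n=\operatorname{prox}_{\lambda_nf}\Big[x_n-\lambda_n\Big(\nabla h(y_{n-1})+\sum_{i=1}^mL_i^*q_{i,n-1}\Big)-\lambda_n\beta_n\nabla\Psi(y_{n-1})\Big],$$ $$q_{i,n}=\operatorname{prox}_{\lambda_ng_i^*}\big[v_{i,n}+\lambda_nL_iy_{n-1}\big],\quad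 i=1,\dots,m,$$ $$x_{n+1}=\lambda_n\beta_n(\nabla\Psi(y_{n-1})-\nabla\Psi(y_n))+\lambda_n(\nabla h(y_{n-1})-\nabla h(y_n))+\lambda_n\sum_{i=1}^mL_i^*(q_{i,n-1}-q_{i,n})+y_n,$$ $$v_{i,n+1}=\lambda_nL_i(y_n-y_{n-1})+q_{i,n},\quad i=1,\dots,m.$$ Let $z_n=\frac1{\tau_n}\sum_{k=0}^n\lambda_kx_k$ with $\tau_n=\sum_{k=0}^n\lambda_k$. Assume that: (i) $\partial f+N_C$ is maximally monotone and $(P)$ has an optimal solution; (ii) for every $p\in\operatorname{ran}(N_C)$, $\sum_{n\ge0}\lambda_n\beta_n\Big[\Psi^*\big(\tfrac p{\beta_n}\big)-\sigma_C\big(\tfrac p{\beta_n}\big)\Big]<+\infty$; (iii) $(\lambda_n)_{n\ge0}\in\ell^2\setminus\ell^1$; (iv) $(0,\dots,0)\in\operatorname{sqri}\Big(\prod_{i=1}^m\operatorname{dom}g_i-\{(L_1x,\dots,L_mx):x\in\operatorname{dom}f\cap C\}\Big)$; and that $\limsup_{n\to+\infty}\Big(\frac{\lambda_n\beta_n}\mu+\lambda_n\beta\Big)<\frac12$, where $\beta=\nu+\sqrt{\sum_{i=1}^m\|L_i\|^2}$. Then $(z_n)_{n\ge0}$ converges weakly to an optimal solution of $(P)$ as $n\to+\infty$. If, additionally, $f$ and $g_i^*$, $i=1,\dots,m$, are strongly convex, then $(x_n)_{n\ge0}$ converges strongly to the unique optimal solution of $(P)$ as $n\to+\infty$.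
   Context: $\operatorname{dom}g=\{x:g(x)<+\infty\}$; $g^*(u)=\sup_x\{\langle u,x\rangle-g(x)\}$ is the Fenchel conjugate; $\partial f$ is the convex subdifferential; $\operatorname{prox}_f(x)$ is the unique minimizer of $y\mapsto f(y)+\frac12\|y-x\|^2$. $L_i^*$ is the adjoint of $L_i$. $N_C$ is the normal cone of the closed convex set $C$: $N_C(x)=\{u:\langle y-x,u\rangle\le0\ \forall y\in C\}$ if $x\in C$, and $\emptyset$ otherwise; $\operatorname{ran}(N_C)$ is its range; $\sigma_C(u)=\sup_{y\in C}\langle y,u\rangle$. For a convex set $S$ in a real Hilbert space, the strong quasi-relative interior $\operatorname{sqri}S$ is the set of $x\in S$ such that $\bigcup_{\lambda>0}\lambda(S-x)$ is a closed linear subspace. *)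

theory Defs
  imports "HOL-Analysis.Analysis"
begin

(* A real Hilbert space is either a type of sort {real_inner, complete_space} or a closed
   linear subspace X of such a type, with the inherited inner product. The notions for
   extended-real-valued functions take the carrier X as their first argument (X = UNIV
   for the whole type) and do not depend on values of the function outside X. A finite family of distinct Hilbert
   spaces is a family of closed subspaces of one type, such as their Hilbert direct sum. *)

definition dom_on :: "'a set \<Rightarrow> ('a \<Rightarrow> ereal) \<Rightarrow> 'a set"
  where "dom_on X g = {x \<in> X. g x < \<infinity>}"

definition proper_on :: "'a set \<Rightarrow> ('a \<Rightarrow> ereal) \<Rightarrow> bool"
  where "proper_on X g \<longleftrightarrow> (\<forall>x\<in>X. g x \<noteq> -\<infinity>) \<and> dom_on X g \<noteq> {}"

(* The inequalities are only used for functions that do not take the value -\<infinity>, so the sums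
   of extended reals below are unambiguous; t = 0 and t = 1 are excluded to avoid 0 * \<infinity>. *)

definition econvex_on :: "'a::real_inner set \<Rightarrow> ('a \<Rightarrow> ereal) \<Rightarrow> bool"
  where "econvex_on X g \<longleftrightarrow>
    (\<forall>x\<in>X. \<forall>y\<in>X. \<forall>t\<in>{0<..<1}.
       g ((1 - t) *\<^sub>R x + t *\<^sub>R y) \<le> ereal (1 - t) * g x + ereal t * g y)"

definition strongly_econvex_on :: "'a::real_inner set \<Rightarrow> ('a \<Rightarrow> ereal) \<Rightarrow> bool"
  where "strongly_econvex_on X g \<longleftrightarrow>
    (\<exists>\<gamma>>0. \<forall>x\<in>X. \<forall>y\<in>X. \<forall>t\<in>{0<..<1}.
       g ((1 - t) *\<^sub>R x + t *\<^sub>R y) + ereal (\<gamma> / 2 * t * (1 - t) * (norm (x - y))\<^sup>2)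
         \<le> ereal (1 - t) * g x + ereal t * g y)"

definition lsc_on :: "'a::topological_space set \<Rightarrow> ('a \<Rightarrow> ereal) \<Rightarrow> bool"
  where "lsc_on X g \<longleftrightarrow> (\<forall>x\<in>X. g x \<le> Liminf (at x within X) g)"

definition fenchel_conj :: "'a::real_inner set \<Rightarrow> ('a \<Rightarrow> ereal) \<Rightarrow> 'a \<Rightarrow> ereal"
  where "fenchel_conj X g u = (SUP x\<in>X. ereal (u \<bullet> x) - g x)"

definition argmin_set :: "('a \<Rightarrow> 'b::ord) \<Rightarrow> 'a set \<Rightarrow> 'a set"
  where "argmin_set F X = {x. is_arg_min F (\<lambda>x. x \<in> X) x}"

definition prox :: "'a::real_inner set \<Rightarrow> ('a \<Rightarrow> ereal) \<Rightarrow> 'a \<Rightarrow> 'a"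
  where "prox X g x = (THE p. p \<in> argmin_set (\<lambda>y. g y + ereal ((norm (y - x))\<^sup>2 / 2)) X)"

definition subdifferential :: "('a::real_inner \<Rightarrow> ereal) \<Rightarrow> 'a \<Rightarrow> 'a set"
  where "subdifferential f x =
    {u. \<bar>f x\<bar> \<noteq> \<infinity> \<and> (\<forall>y. f x + ereal (u \<bullet> (y - x)) \<le> f y)}"

definition normal_cone :: "'a::real_inner set \<Rightarrow> 'a \<Rightarrow> 'a set"
  where "normal_cone C x = {u. x \<in> C \<and> (\<forall>y\<in>C. (y - x) \<bullet> u \<le> 0)}"

definition support_fun :: "'a::real_inner set \<Rightarrow> 'a \<Rightarrow> ereal"
  where "support_fun C u = (SUP y\<in>C. ereal (y \<bullet> u))"

(* Set-valued operators are functions into sets. *)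

definition op_plus :: "('a \<Rightarrow> 'a set) \<Rightarrow> ('a \<Rightarrow> 'a set) \<Rightarrow> 'a \<Rightarrow> 'a::real_inner set"
  where "op_plus A B x = {u + v | u v. u \<in> A x \<and> v \<in> B x}"

definition op_ran :: "('a \<Rightarrow> 'a set) \<Rightarrow> 'a set"
  where "op_ran A = (\<Union>x. A x)"

definition monotone_op :: "('a::real_inner \<Rightarrow> 'a set) \<Rightarrow> bool"
  where "monotone_op A \<longleftrightarrow> (\<forall>x y. \<forall>u\<in>A x. \<forall>v\<in>A y. 0 \<le> (x - y) \<bullet> (u - v))"

definition maximally_monotone :: "('a::real_inner \<Rightarrow> 'a set) \<Rightarrow> bool"
  where "maximally_monotone A \<longleftrightarrow>
    monotone_op A \<and> (\<forall>B. monotone_op B \<and> (\<forall>x. A x \<subseteq> B x) \<longrightarrow> B = A)"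

definition sqri :: "'a::real_inner set \<Rightarrow> 'a set"
  where "sqri S = {x \<in> S. let K = (\<Union>r\<in>{0<..}. (\<lambda>s. r *\<^sub>R (s - x)) ` S)
                          in subspace K \<and> closed K}"

definition weakly_converges :: "(nat \<Rightarrow> 'a::real_inner) \<Rightarrow> 'a \<Rightarrow> bool"
  where "weakly_converges z l \<longleftrightarrow> (\<forall>u. (\<lambda>n. z n \<bullet> u) \<longlonglongrightarrow> l \<bullet> u)"

end

theory Submission
  imports Defs
begin

text \<open>
  In the product space with points \<open>(x, v)\<close>, the scheme reads
  \<open>X (n + 1) = X n - \<lambda>\<^sub>n (A\<^sub>n + D Y\<^sub>n + \<beta>\<^sub>n B Y\<^sub>n)\<close> with \<open>A\<^sub>n\<close> in the maximally monotone part at \<open>Y\<^sub>n\<close>,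
  \<open>D\<close> the gradient of \<open>h\<close> plus the skew part, and \<open>B\<close> the gradient of \<open>\<Psi>\<close>. For \<open>u\<close> in the domain of
  the limit inclusion, convexity of \<open>\<Psi>\<close> and the Fenchel--Young inequality bound the penalty term by
  the summable quantity in (ii), so that \<open>\<parallel>X n - u\<parallel>\<^sup>2 + c \<parallel>X n - Y (n - 1)\<parallel>\<^sup>2\<close> is almost decreasing when
  \<open>u\<close> is a zero, and has telescoping increments in general. Weak cluster points of the averages are
  then monotonically related to the whole graph, hence zeros by maximality, and an Opial--Passty
  argument makes the cluster point unique. Zeros correspond to optimal solutions together with
  multipliers. Multipliers exist by (iv): by Baire's theorem the perturbation function is bounded
  near 0 on the closed subspace generated by the set in (iv), and approximate multipliers,
  obtained by projecting onto an epigraph, form nested bounded closed convex sets.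

  Weak compactness, existence of proximal points, projections and Riesz representation are all drawn
  from one fact: nested bounded closed convex sets in a Hilbert space have a common point.
\<close>

section \<open>Nested convex sets, minimisers and weak cluster points\<close>

text \<open>Each iteration evaluates the single-valued operators only at the past point
  \<open>P n\<close>. The error of a step therefore involves the gap \<open>X n - P n\<close> left
  by the step before, and the distance to a zero alone need not decrease; the gap has to enter the
  decreasing quantity, and the bound 1/2 is what leaves a positive surplus. The proximal step sees
  \<open>f\<close> alone, whereas the limit inclusion contains the normal cone of \<open>C\<close>.
  A graph element carries a normal vector \<open>p\<close> without counterpart in the algorithm:
  hypothesis (i) splits it off, and the penalty pays for it with a summable error. For a graph
  element other than a zero, the descent inequality has a term without fixed sign, so only its
  weighted sums are bounded above. Dividing by the divergent sums of the step sizes yields a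
  monotone relation for the averages, not for the iterates. Under strong monotonicity the extra term
  at a zero is nonnegative, and nonsummable step sizes then force the iterates themselves to
  converge.\<close>

lemma nested_convex_inter_nonempty:
  fixes S :: "nat \<Rightarrow> 'a::{real_inner, complete_space} set"
  assumes "decseq S" and cl: "\<And>n. closed (S n)" and cv: "\<And>n. convex (S n)"
    and ne: "\<And>n. S n \<noteq> {}" and bd: "bounded (S 0)"
  shows "\<exists>p. \<forall>n. p \<in> S n"
proof -
  \<comment> \<open>Squared distances of the sets from the origin: nondecreasing because the sets
    shrink, bounded because \<open>S 0\<close> is, hence Cauchy. Near-minimisers inherit
    this.\<close>
  define d where "d n = (INF w\<in>S n. (norm w)\<^sup>2)" for n
  have sub: "S n \<subseteq> S m" if "m \<le> n" for m n
    using \<open>decseq S\<close> that by (simp add: decseq_def)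
  have bb: "bdd_below ((\<lambda>w. (norm w)\<^sup>2) ` S n)" for n
    by (intro bdd_belowI2[of _ 0]) auto
  have d_le: "d n \<le> (norm w)\<^sup>2" if "w \<in> S n" for n w
    unfolding d_def by (rule cINF_lower[OF bb that])
  have d_mono: "d m \<le> d n" if "m \<le> n" for m n
    unfolding d_def by (rule cINF_superset_mono) (use ne bb sub[OF that] in auto)
  obtain B where B: "\<And>w. w \<in> S 0 \<Longrightarrow> norm w \<le> B"
    using bd unfolding bounded_iff by blast
  have d_bd: "d n \<le> B\<^sup>2" for n
  proof -
    obtain w where w: "w \<in> S n" using ne by blast
    have "norm w \<le> B" using B sub[of 0 n] w by auto
    then have "(norm w)\<^sup>2 \<le> B\<^sup>2" by (intro power_mono) auto
    with d_le[OF w] show ?thesis by linarith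
  qed
  have "convergent d"
  proof (rule Bseq_mono_convergent)
    have "norm (d n) \<le> \<bar>B\<^sup>2\<bar> + \<bar>d 0\<bar>" for n
      using d_mono[of 0 n] d_bd[of n] unfolding real_norm_def by linarith
    then show "Bseq d" by (rule BseqI')
  qed (use d_mono in auto)
  then have "Cauchy d" by (rule convergent_Cauchy)
  have "\<exists>w. w \<in> S n \<and> (norm w)\<^sup>2 < d n + 1 / Suc n" for n
  proof -
    have "(INF w\<in>S n. (norm w)\<^sup>2) < d n + 1 / Suc n"
      unfolding d_def[symmetric] by simp
    then show ?thesis
      using cINF_less_iff[OF ne bb] by blast
  qed
  then obtain w where w: "\<And>n. w n \<in> S n" "\<And>n. (norm (w n))\<^sup>2 < d n + 1 / Suc n"
    by metis
  \<comment> \<open>The midpoint of \<open>w n\<close> and \<open>w m\<close> lies in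
    \<open>S m\<close>, so its squared norm is at least \<open>d m\<close>; the parallelogram
    identity turns this into a bound on the distance.\<close>
  have est: "(dist (w n) (w m))\<^sup>2 \<le> 2 * \<bar>d n - d m\<bar> + 4 * (1 / Suc m)" if "m \<le> n" for m n
  proof -
    have "w n \<in> S m" using w(1)[of n] sub[OF that] by auto
    then have "(1/2) *\<^sub>R w n + (1/2) *\<^sub>R w m \<in> S m"
      using cv[of m] w(1)[of m] by (intro convexD) auto
    then have "d m \<le> (norm ((1/2) *\<^sub>R w n + (1/2) *\<^sub>R w m))\<^sup>2" by (rule d_le)
    moreover have "(norm ((1/2) *\<^sub>R w n + (1/2) *\<^sub>R w m))\<^sup>2
        = (norm (w n))\<^sup>2 / 2 + (norm (w m))\<^sup>2 / 2 - (dist (w n) (w m))\<^sup>2 / 4"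
      by (simp add: power2_norm_eq_inner dist_norm inner_simps inner_commute field_simps)
    moreover have "1 / real (Suc n) \<le> 1 / Suc m" using that by (simp add: frac_le)
    moreover have "D \<le> 2 * \<bar>a - b\<bar> + 4 * s"
      if "b \<le> M" "M = P / 2 + R / 2 - D / 4" "r \<le> s" "P < a + r" "R < b + s"
      for a b r s D M P R :: real
      using that abs_ge_self[of "a - b"] by argo
    ultimately show ?thesis using w(2)[of n] w(2)[of m] by blast
  qed
  have "Cauchy w"
  proof (rule CauchyI')
    fix e :: real assume "e > 0"
    obtain M where M: "\<And>m n. m \<ge> M \<Longrightarrow> n \<ge> M \<Longrightarrow> dist (d m) (d n) < e\<^sup>2 / 4"
      using \<open>Cauchy d\<close> \<open>e > 0\<close> metric_CauchyD[of d "e\<^sup>2 / 4"] by auto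
    obtain K where K: "1 / real (Suc K) < e\<^sup>2 / 8"
      using nat_approx_posE[of "e\<^sup>2 / 8"] \<open>e > 0\<close> by auto
    show "\<exists>M. \<forall>m\<ge>M. \<forall>n>m. dist (w m) (w n) < e"
    proof (rule exI[of _ "max M K"], intro allI impI)
      fix m n assume mn: "max M K \<le> m" "m < n"
      have "1 / real (Suc m) \<le> 1 / Suc K" using mn by (simp add: frac_le)
      moreover have "\<bar>d n - d m\<bar> < e\<^sup>2 / 4" using M[of n m] mn by (simp add: dist_real_def)
      ultimately have "(dist (w n) (w m))\<^sup>2 < e\<^sup>2" using est[OF less_imp_le[OF mn(2)]] K by argo
      then show "dist (w m) (w n) < e"
        using \<open>e > 0\<close> power_less_imp_less_base[of "dist (w n) (w m)" 2 e]
        by (simp add: dist_commute)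
    qed
  qed
  then obtain p where p: "w \<longlonglongrightarrow> p"
    using convergent_eq_Cauchy by blast
  have "p \<in> S n" for n
  proof (rule Lim_in_closed_set[OF cl _ _ p])
    show "\<forall>\<^sub>F k in sequentially. w k \<in> S n"
      using eventually_ge_at_top[of n] by eventually_elim (use sub w in blast)
  qed simp
  then show ?thesis by blast
qed

text \<open>The sublevel sets of \<open>Q\<close> at levels decreasing to the infimum are nested
  closed convex sets, bounded by coercivity; any common point is a minimiser.\<close>

lemma convex_minimizer_exists:
  fixes W :: "'a::{real_inner, complete_space} set" and Q :: "'a \<Rightarrow> real"
  assumes W: "closed W" "convex W" "W \<noteq> {}"
    and Q: "convex_on W Q" "continuous_on W Q"
    and bdd: "bdd_below (Q ` W)" and coercive: "\<And>b. bounded {w\<in>W. Q w \<le> b}"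
  obtains p where "p \<in> W" "\<And>w. w \<in> W \<Longrightarrow> Q p \<le> Q w"
proof -
  define m where "m = (INF w\<in>W. Q w)"
  define S where "S n = {w\<in>W. Q w \<le> m + 1 / Suc n}" for n
  have "\<exists>p. \<forall>n. p \<in> S n"
  proof (rule nested_convex_inter_nonempty)
    show "decseq S"
    proof (rule decseq_SucI)
      fix n
      have "1 / real (Suc (Suc n)) \<le> 1 / real (Suc n)" by (simp add: frac_le)
      then show "S (Suc n) \<subseteq> S n" unfolding S_def by auto
    qed
    fix n
    show "closed (S n)" unfolding S_def
      using continuous_on_closed_Collect_le[OF Q(2) continuous_on_const W(1)] by auto
    show "convex (S n)"
    proof (rule convexI)
      fix a b :: 'a and u v :: real
      assume ab: "a \<in> S n" "b \<in> S n" "0 \<le> u" "0 \<le> v" "u + v = 1"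
      have "Q (u *\<^sub>R a + v *\<^sub>R b) \<le> u * Q a + v * Q b"
        using Q(1) ab unfolding convex_on_def S_def by auto
      also have "\<dots> \<le> u * (m + 1 / Suc n) + v * (m + 1 / Suc n)"
        using ab by (intro add_mono mult_left_mono) (auto simp: S_def)
      also have "\<dots> = m + 1 / Suc n" using ab by (metis distrib_right mult_1)
      finally show "u *\<^sub>R a + v *\<^sub>R b \<in> S n"
        using convexD[OF W(2)] ab unfolding S_def by blast
    qed
    have "m < m + 1 / Suc n" by simp
    then show "S n \<noteq> {}"
      unfolding S_def using cINF_less_iff[OF W(3) bdd] m_def by (metis (mono_tags, lifting) empty_Collect_eq less_imp_le)
    show "bounded (S 0)" unfolding S_def by (rule coercive)
  qed
  then obtain p where p: "p \<in> S n" for n by blast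
  have "Q p \<le> m"
  proof (rule field_le_epsilon)
    fix e :: real assume "e > 0"
    then obtain n where "1 / real (Suc n) < e" using nat_approx_posE by blast
    then show "Q p \<le> m + e" using p[of n] unfolding S_def by auto
  qed
  moreover have "m \<le> Q w" if "w \<in> W" for w unfolding m_def by (rule cINF_lower[OF bdd that])
  ultimately show thesis using that[of p] p[of 0] unfolding S_def by force
qed

text \<open>Source of all first-order conditions below: a minimiser is compared with the point at
  fraction \<theta> of a segment, and dividing by \<theta> and letting it tend to 0 removes the
  second-order term.\<close>

lemma nonneg_of_quadratic_perturbation:
  fixes A B :: real
  assumes "\<And>\<theta>. 0 < \<theta> \<Longrightarrow> \<theta> < 1 \<Longrightarrow> 0 \<le> \<theta> * A + \<theta>\<^sup>2 * B"
  shows "0 \<le> A"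
proof -
  have "((\<lambda>\<theta>. A + \<theta> * B) \<longlongrightarrow> A + 0 * B) (at_right 0)"
    by (intro tendsto_intros)
  moreover have "\<forall>\<^sub>F \<theta> in at_right 0. 0 \<le> A + \<theta> * B"
  proof (rule eventually_at_rightI[of 0 1])
    fix \<theta> :: real assume t: "\<theta> \<in> {0<..<1}"
    then have "0 \<le> \<theta> * (A + \<theta> * B)" using assms[of \<theta>] by (simp add: algebra_simps power2_eq_square)
    then show "0 \<le> A + \<theta> * B" using t zero_le_mult_iff[of \<theta> "A + \<theta> * B"] by auto
  qed simp
  ultimately show ?thesis using tendsto_lowerbound by fastforce
qed

lemma convex_on_norm_sq_diff:
  fixes a :: "'a::real_inner"
  assumes "convex W"
  shows "convex_on W (\<lambda>w. (norm (w - a))\<^sup>2)"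
proof (rule convex_onI)
  fix t :: real and p q assume t: "0 < t" "t < 1"
  have "(1 - t) * (norm (p - a))\<^sup>2 + t * (norm (q - a))\<^sup>2 - (norm ((1 - t) *\<^sub>R p + t *\<^sub>R q - a))\<^sup>2
      = t * (1 - t) * (norm (p - q))\<^sup>2"
    by (simp add: power2_norm_eq_inner inner_simps inner_commute algebra_simps)
  moreover have "0 \<le> t * (1 - t) * (norm (p - q))\<^sup>2" using t by simp
  ultimately show "(norm ((1 - t) *\<^sub>R p + t *\<^sub>R q - a))\<^sup>2
      \<le> (1 - t) * (norm (p - a))\<^sup>2 + t * (norm (q - a))\<^sup>2" by linarith
qed (rule assms)

text \<open>The point \<open>p\<close> minimises the squared distance to \<open>a\<close> over
  \<open>W\<close>; the obtuse-angle inequality is the first-order condition along the segments from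
  \<open>p\<close> into \<open>W\<close>.\<close>

lemma closed_convex_projection:
  fixes W :: "'a::{real_inner, complete_space} set"
  assumes W: "closed W" "convex W" "W \<noteq> {}"
  obtains p where "p \<in> W" "\<And>w. w \<in> W \<Longrightarrow> (a - p) \<bullet> (w - p) \<le> 0"
proof -
  have "bounded {w\<in>W. (norm (w - a))\<^sup>2 \<le> b}" for b
  proof (rule bounded_subset[OF bounded_cball[of a "sqrt b"]], clarsimp simp: dist_norm)
    fix w assume "(norm (w - a))\<^sup>2 \<le> b"
    then show "norm (a - w) \<le> sqrt b" by (simp add: real_le_rsqrt norm_minus_commute)
  qed
  moreover have "continuous_on W (\<lambda>w. (norm (w - a))\<^sup>2)" by (intro continuous_intros)
  moreover have "bdd_below ((\<lambda>w. (norm (w - a))\<^sup>2) ` W)" by (rule bdd_belowI2[of _ 0]) simp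
  ultimately obtain p
    where p: "p \<in> W" "\<And>w. w \<in> W \<Longrightarrow> (norm (p - a))\<^sup>2 \<le> (norm (w - a))\<^sup>2"
    using convex_minimizer_exists[OF W convex_on_norm_sq_diff[OF W(2)], of a] by blast
  have "(a - p) \<bullet> (w - p) \<le> 0" if "w \<in> W" for w
  proof -
    have "0 \<le> 2 * ((p - a) \<bullet> (w - p))"
    proof (rule nonneg_of_quadratic_perturbation)
      fix \<theta> :: real assume t: "0 < \<theta>" "\<theta> < 1"
      have "(1 - \<theta>) *\<^sub>R p + \<theta> *\<^sub>R w \<in> W"
        using W(2) p(1) that t by (intro convexD) auto
      from p(2)[OF this]
      show "0 \<le> \<theta> * (2 * ((p - a) \<bullet> (w - p))) + \<theta>\<^sup>2 * ((w - p) \<bullet> (w - p))"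
        unfolding power2_norm_eq_inner
        by (simp add: inner_simps inner_commute algebra_simps power2_eq_square)
    qed
    then show ?thesis by (simp add: inner_simps inner_commute)
  qed
  with p(1) show thesis using that by blast
qed

text \<open>A substitute for weak sequential compactness. The point \<open>z\<close> lies in the
  closed convex hull of every tail, which is less than being the weak limit of a subsequence, but it
  lies in every closed half-space that contains almost all terms.\<close>

lemma weak_cluster_point_exists:
  fixes Z :: "nat \<Rightarrow> 'a::{real_inner, complete_space}"
  assumes "bounded (range Z)"
  shows "\<exists>z. \<forall>w c. (\<forall>\<^sub>F n in sequentially. w \<bullet> Z n \<le> c) \<longrightarrow> w \<bullet> z \<le> c"
proof -
  define S where "S n = closure (convex hull (Z ` {n..}))" for n
  have "\<exists>z. \<forall>n. z \<in> S n"
  proof (rule nested_convex_inter_nonempty)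
    show "decseq S" unfolding S_def
      by (intro decseq_SucI closure_mono hull_mono) auto
    show "bounded (S 0)" unfolding S_def
      by (intro bounded_closure bounded_convex_hull bounded_subset[OF assms]) auto
  qed (auto simp: S_def convex_closure)
  then obtain z where z: "z \<in> S n" for n by blast
  have "w \<bullet> z \<le> c" if ev: "\<forall>\<^sub>F n in sequentially. w \<bullet> Z n \<le> c" for w c
  proof -
    obtain N where N: "\<And>n. n \<ge> N \<Longrightarrow> w \<bullet> Z n \<le> c"
      using ev unfolding eventually_sequentially by blast
    have "S N \<subseteq> {y. w \<bullet> y \<le> c}" unfolding S_def
      by (intro closure_minimal hull_minimal) (use N in \<open>auto simp: convex_halfspace_le closed_halfspace_le\<close>)
    with z[of N] show ?thesis by blast
  qed
  then show ?thesis by blast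
qed

section \<open>Epigraphs and their subgradients\<close>

definition epi_on :: "'a set \<Rightarrow> ('a \<Rightarrow> ereal) \<Rightarrow> ('a \<times> real) set"
  where "epi_on X g = {(x, r). x \<in> X \<and> g x \<le> ereal r}"

text \<open>Extended-real-valued functions are replaced by their epigraphs, so that subgradient
  inequalities involve only real numbers and lower semicontinuity becomes closedness. On a carrier
  other than the whole space the subdifferential is the one of the function extended by \<open>\<infinity>\<close>.\<close>

definition epi_subgrad :: "('a::real_inner \<times> real) set \<Rightarrow> ('a \<times> 'a) set"
  where "epi_subgrad E = {(x, u). \<exists>s. (x, s) \<in> E \<and> (\<forall>(y, r)\<in>E. s + u \<bullet> (y - x) \<le> r)}"

text \<open>For an epigraph, the last clause says that some value is finite. It supplies a point
  outside the set vertically below a point of the set; projecting that point gives a separating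
  hyperplane that is not vertical.\<close>

definition proper_epi :: "('a::real_inner \<times> real) set \<Rightarrow> bool"
  where "proper_epi E \<longleftrightarrow> closed E \<and> convex E \<and> (\<exists>x s t. t < s \<and> (x, s) \<in> E \<and> (x, t) \<notin> E)"

lemma epi_subgrad_monotone:
  assumes "(x, u) \<in> epi_subgrad E" "(y, v) \<in> epi_subgrad E"
  shows "0 \<le> (u - v) \<bullet> (x - y)"
proof -
  obtain s t where "(x, s) \<in> E" "(y, t) \<in> E" "s + u \<bullet> (y - x) \<le> t" "t + v \<bullet> (x - y) \<le> s"
    using assms unfolding epi_subgrad_def by force
  then show ?thesis by (simp add: inner_simps)
qed

lemma convex_epi_on:
  assumes "convex X" "econvex_on X g"
  shows "convex (epi_on X g)"
proof (rule convexI)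
  fix a b :: "'a \<times> real" and u v :: real
  assume ab: "a \<in> epi_on X g" "b \<in> epi_on X g" and uv: "0 \<le> u" "0 \<le> v" "u + v = 1"
  obtain x r y s where [simp]: "a = (x, r)" "b = (y, s)" by (cases a, cases b)
  have xy: "x \<in> X" "y \<in> X" "g x \<le> ereal r" "g y \<le> ereal s"
    using ab by (auto simp: epi_on_def)
  consider "v = 0" | "v = 1" | "0 < v" "v < 1" using uv by fastforce
  then show "u *\<^sub>R a + v *\<^sub>R b \<in> epi_on X g"
  proof cases
    case 3
    have u: "u = 1 - v" using uv by simp
    have "g ((1 - v) *\<^sub>R x + v *\<^sub>R y) \<le> ereal (1 - v) * g x + ereal v * g y"
      using assms(2) xy 3 unfolding econvex_on_def by auto
    also have "\<dots> \<le> ereal (1 - v) * ereal r + ereal v * ereal s"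
      using 3 xy by (intro add_mono ereal_mult_left_mono) auto
    finally have "g (u *\<^sub>R x + v *\<^sub>R y) \<le> ereal (u * r + v * s)"
      unfolding u by simp
    moreover have "u *\<^sub>R x + v *\<^sub>R y \<in> X" using assms(1) xy uv by (intro convexD)
    ultimately show ?thesis by (simp add: epi_on_def)
  qed (use ab uv in auto)
qed

lemma closed_epi_on:
  fixes X :: "'a::metric_space set"
  assumes "closed X" "lsc_on X g"
  shows "closed (epi_on X g)"
  unfolding closed_sequential_limits
proof (intro allI impI, elim conjE)
  fix w p assume w: "\<forall>n. w n \<in> epi_on X g" and p: "w \<longlonglongrightarrow> p"
  obtain x r where [simp]: "p = (x, r)" by (cases p)
  have wX: "fst (w n) \<in> X" "g (fst (w n)) \<le> ereal (snd (w n))" for n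
    using spec[OF w, of n] by (auto simp: epi_on_def case_prod_beta')
  have lim: "(\<lambda>n. fst (w n)) \<longlonglongrightarrow> x" "(\<lambda>n. snd (w n)) \<longlonglongrightarrow> r"
    using tendsto_fst[OF p] tendsto_snd[OF p] by auto
  have "x \<in> X"
    by (rule Lim_in_closed_set[OF assms(1) _ _ lim(1)]) (auto simp: wX)
  moreover have "g x \<le> ereal r"
  proof (rule ccontr)
    assume "\<not> g x \<le> ereal r"
    then obtain c where c: "ereal r < ereal c" "ereal c < g x"
      using ereal_dense2[of "ereal r" "g x"] by (auto simp: not_le)
    then have "ereal c < Liminf (at x within X) g"
      using assms(2) \<open>x \<in> X\<close> unfolding lsc_on_def by (meson less_le_trans)
    from less_LiminfD[OF this] have "\<forall>\<^sub>F y in at x within X. ereal c < g y" .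
    \<comment> \<open>The filter \<open>at x within X\<close> omits \<open>x\<close> itself. Since
      \<open>c < g x\<close>, the bound extends to full neighbourhoods, as required for sequences
      that may hit \<open>x\<close>.\<close>
    then have "\<forall>\<^sub>F y in nhds x. y \<in> X \<longrightarrow> ereal c < g y"
      unfolding eventually_at_filter by eventually_elim (use c in auto)
    then have "\<forall>\<^sub>F n in sequentially. fst (w n) \<in> X \<longrightarrow> ereal c < g (fst (w n))"
      by (rule eventually_compose_filterlim[OF _ lim(1)])
    moreover have "\<forall>\<^sub>F n in sequentially. snd (w n) < c"
      using order_tendstoD(2)[OF lim(2)] c by simp
    ultimately have "\<forall>\<^sub>F n in sequentially. False"
    proof eventually_elim
      case (elim n)
      then show ?case using wX[of n] by (meson ereal_less_eq(3) leD le_less_trans less_ereal.simps(1) less_imp_le)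
    qed
    then show False by simp
  qed
  ultimately show "p \<in> epi_on X g" by (simp add: epi_on_def)
qed

lemma lsc_on_subset:
  assumes "lsc_on X g" "Y \<subseteq> X"
  shows "lsc_on Y g"
  unfolding lsc_on_def
proof
  fix x assume "x \<in> Y"
  then have "g x \<le> Liminf (at x within X) g" using assms by (auto simp: lsc_on_def)
  also have "\<dots> \<le> Liminf (at x within Y) g"
    unfolding Liminf_def using filter_leD[OF at_le[OF assms(2)]] by (intro SUP_subset_mono) auto
  finally show "g x \<le> Liminf (at x within Y) g" .
qed

lemma proper_epi_epi_on:
  fixes X :: "'a::real_inner set"
  assumes "closed X" "convex X" "\<And>x. x \<in> X \<Longrightarrow> g x \<noteq> -\<infinity>" "econvex_on X g" "lsc_on X g"
    and "x \<in> X" "g x < \<infinity>"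
  shows "proper_epi (epi_on X g)"
proof -
  obtain s where "g x = ereal s" using assms(3)[OF \<open>x \<in> X\<close>] \<open>g x < \<infinity>\<close> by (cases "g x") auto
  then have "(x, s) \<in> epi_on X g" "(x, s - 1) \<notin> epi_on X g" "s - 1 < s"
    using \<open>x \<in> X\<close> by (auto simp: epi_on_def)
  then show ?thesis unfolding proper_epi_def
    using convex_epi_on[OF assms(2,4)] closed_epi_on[OF assms(1,5)] by blast
qed

lemma epi_subgrad_epi_onD:
  assumes "(x, u) \<in> epi_subgrad (epi_on X g)" "\<And>y. y \<in> X \<Longrightarrow> g y \<noteq> -\<infinity>"
  obtains s where "x \<in> X" "g x = ereal s" "\<And>y. y \<in> X \<Longrightarrow> ereal (s + u \<bullet> (y - x)) \<le> g y"
proof -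
  obtain s where s: "x \<in> X" "g x \<le> ereal s"
    and sub: "\<And>y r. y \<in> X \<Longrightarrow> g y \<le> ereal r \<Longrightarrow> s + u \<bullet> (y - x) \<le> r"
    using assms(1) unfolding epi_subgrad_def epi_on_def by auto
  obtain t where t: "g x = ereal t" using s assms(2) by (cases "g x") auto
  \<comment> \<open>The subgradient inequality tested at \<open>x\<close> itself forces the height
    \<open>s\<close> to be the exact value of \<open>g\<close> there.\<close>
  have "s \<le> t" using sub[of x t] s t by simp
  then have "g x = ereal s" using s t by simp
  moreover have "ereal (s + u \<bullet> (y - x)) \<le> g y" if "y \<in> X" for y
    using sub[OF that] assms(2)[OF that] by (cases "g y") auto
  ultimately show thesis using that s by blast
qed

lemma epi_subgrad_epi_onI:
  assumes "x \<in> X" "g x = ereal s" "\<And>y. y \<in> X \<Longrightarrow> ereal (s + u \<bullet> (y - x)) \<le> g y"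
  shows "(x, u) \<in> epi_subgrad (epi_on X g)"
proof -
  have "s + u \<bullet> (y - x) \<le> r" if "(y, r) \<in> epi_on X g" for y r
  proof -
    have "ereal (s + u \<bullet> (y - x)) \<le> g y" "g y \<le> ereal r"
      using that assms(3) by (auto simp: epi_on_def)
    from order_trans[OF this] show ?thesis by simp
  qed
  moreover have "(x, s) \<in> epi_on X g" using assms(1,2) by (simp add: epi_on_def)
  ultimately show ?thesis unfolding epi_subgrad_def by blast
qed

section \<open>Affine minorants, proximal points and conjugates\<close>

lemma proper_epi_affine_minorant:
  fixes E :: "('a::{real_inner, complete_space} \<times> real) set"
  assumes "proper_epi E"
  obtains a b where "\<And>y r. (y, r) \<in> E \<Longrightarrow> a \<bullet> y + b \<le> r"
proof -
  obtain x s t where xst: "t < s" "(x, s) \<in> E" "(x, t) \<notin> E" and E: "closed E" "convex E"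
    using assms unfolding proper_epi_def by blast
  obtain p where p: "p \<in> E" "\<And>w. w \<in> E \<Longrightarrow> ((x, t) - p) \<bullet> (w - p) \<le> 0"
    using closed_convex_projection[OF E, of "(x, t)"] xst(2) by blast
  obtain y0 r0 where [simp]: "p = (y0, r0)" by (cases p)
  have ineq: "(x - y0) \<bullet> (y - y0) + (t - r0) * (r - r0) \<le> 0" if "(y, r) \<in> E" for y r
    using p(2)[OF that] by simp
  \<comment> \<open>The hyperplane is not vertical: if the projection had height at most
    \<open>t\<close>, the inequality at \<open>(x, s)\<close> would make both its terms vanish and
    identify the projection with \<open>(x, t)\<close>, which is outside \<open>E\<close>.\<close>
  have pos: "t < r0"
  proof (rule ccontr)
    assume "\<not> t < r0"
    then have "0 \<le> (t - r0) * (s - r0)" using xst(1) by (intro mult_nonneg_nonneg) auto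
    with ineq[OF xst(2)] have "(x - y0) \<bullet> (x - y0) = 0 \<and> (t - r0) * (s - r0) = 0"
      using inner_ge_zero[of "x - y0"] by argo
    then have "x = y0" "t = r0 \<or> s = r0" by auto
    with xst(1,3) p(1) \<open>\<not> t < r0\<close> show False by auto
  qed
  show thesis
  proof (rule that)
    fix y r assume "(y, r) \<in> E"
    from ineq[OF this] have "(x - y0) \<bullet> (y - y0) \<le> (r0 - t) * (r - r0)" by (simp add: algebra_simps)
    then have "((x - y0) \<bullet> (y - y0)) / (r0 - t) \<le> r - r0"
      using pos by (simp add: divide_le_eq mult.commute)
    moreover have "((x - y0) /\<^sub>R (r0 - t)) \<bullet> y + (r0 - ((x - y0) \<bullet> y0) / (r0 - t))
        = r0 + ((x - y0) \<bullet> (y - y0)) / (r0 - t)"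
      by (simp add: inner_diff_right[of "x - y0"] divide_inverse algebra_simps)
    ultimately show "((x - y0) /\<^sub>R (r0 - t)) \<bullet> y + (r0 - ((x - y0) \<bullet> y0) / (r0 - t)) \<le> r"
      by linarith
  qed
qed

text \<open>\<open>p\<close> is the proximal point of \<open>x\<close> with parameter
  \<open>t\<close>, recorded by its optimality condition. It minimises height plus squared distance
  over \<open>2 * t\<close> on \<open>E\<close>; the affine minorant makes this objective
  coercive.\<close>

lemma prox_point_exists:
  fixes E :: "('a::{real_inner, complete_space} \<times> real) set"
  assumes "proper_epi E" "t > 0"
  obtains p where "(p, (x - p) /\<^sub>R t) \<in> epi_subgrad E"
proof -
  have E: "closed E" "convex E" "E \<noteq> {}" using assms(1) unfolding proper_epi_def by auto
  obtain a b where ab: "\<And>y r. (y, r) \<in> E \<Longrightarrow> a \<bullet> y + b \<le> r"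
    using proper_epi_affine_minorant[OF assms(1)] by blast
  define c where "c = 1 / (2 * t)"
  have "c > 0" using assms(2) by (simp add: c_def)
  define Q where "Q w = snd w + c * (norm (fst w - x))\<^sup>2" for w :: "'a \<times> real"
  have conv: "convex_on E Q"
  proof (rule convex_onI[OF _ E(2)])
    fix \<theta> :: real and p q :: "'a \<times> real" assume th: "0 < \<theta>" "\<theta> < 1"
    have "(norm ((1 - \<theta>) *\<^sub>R fst p + \<theta> *\<^sub>R fst q - x))\<^sup>2
        \<le> (1 - \<theta>) * (norm (fst p - x))\<^sup>2 + \<theta> * (norm (fst q - x))\<^sup>2"
      using convex_on_norm_sq_diff[of UNIV x] th unfolding convex_on_def
      by (metis UNIV_I add.commute convex_onD convex_on_norm_sq_diff convex_UNIV less_imp_le)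
    then have "c * (norm ((1 - \<theta>) *\<^sub>R fst p + \<theta> *\<^sub>R fst q - x))\<^sup>2
        \<le> c * ((1 - \<theta>) * (norm (fst p - x))\<^sup>2 + \<theta> * (norm (fst q - x))\<^sup>2)"
      using \<open>c > 0\<close> by (intro mult_left_mono) auto
    then show "Q ((1 - \<theta>) *\<^sub>R p + \<theta> *\<^sub>R q) \<le> (1 - \<theta>) * Q p + \<theta> * Q q"
      unfolding Q_def by (simp add: algebra_simps)
  qed
  \<comment> \<open>Completing the square: half of the quadratic term absorbs the linear part of the
    minorant, and the other half is kept for coercivity.\<close>
  have low: "a \<bullet> x + b - t * (norm a)\<^sup>2 \<le> Q w - (1 / (4 * t)) * (norm (fst w - x))\<^sup>2"
    if "w \<in> E" for w
  proof -
    have "0 \<le> (1 / (4 * t)) * (norm ((fst w - x) + (2 * t) *\<^sub>R a))\<^sup>2" using assms(2) by simp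
    also have "\<dots> = (1 / (4 * t)) * (norm (fst w - x))\<^sup>2 + a \<bullet> (fst w - x) + t * (norm a)\<^sup>2"
      using assms(2) by (simp add: power2_norm_eq_inner inner_simps inner_commute field_simps)
    finally show ?thesis using ab[of "fst w" "snd w"] that unfolding Q_def c_def
      by (simp add: inner_simps field_simps)
  qed
  have low': "a \<bullet> x + b - t * (norm a)\<^sup>2 \<le> Q w" if "w \<in> E" for w
  proof -
    have "0 \<le> (1 / (4 * t)) * (norm (fst w - x))\<^sup>2" using assms(2) by simp
    with low[OF that] show ?thesis by linarith
  qed
  have "bounded {w\<in>E. Q w \<le> k}" for k
  proof -
    define R where "R = sqrt (4 * t * (k - (a \<bullet> x + b - t * (norm a)\<^sup>2)))"
    have "{w\<in>E. Q w \<le> k} \<subseteq> cball x R \<times> {- (norm a * (norm x + R)) + b .. k}"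
    proof (clarsimp, intro conjI)
      fix y r assume w: "(y, r) \<in> E" "Q (y, r) \<le> k"
      have "(1 / (4 * t)) * (norm (y - x))\<^sup>2 \<le> k - (a \<bullet> x + b - t * (norm a)\<^sup>2)"
        using low[OF w(1)] w(2) by simp
      then have "(norm (y - x))\<^sup>2 \<le> 4 * t * (k - (a \<bullet> x + b - t * (norm a)\<^sup>2))"
        using assms(2) by (simp add: field_simps)
      then have yR: "norm (y - x) \<le> R" unfolding R_def by (rule real_le_rsqrt)
      then show "dist x y \<le> R" by (simp add: dist_norm norm_minus_commute)
      have "norm y \<le> norm x + R" using norm_triangle_ineq[of x "y - x"] yR by simp
      then have "norm a * norm y \<le> norm a * (norm x + R)" by (intro mult_left_mono) auto
      then show "b - norm a * (norm x + R) \<le> r"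
        using ab[OF w(1)] Cauchy_Schwarz_ineq2[of a y] by linarith
      have "0 \<le> c * (norm (y - x))\<^sup>2" using \<open>c > 0\<close> by simp
      then show "r \<le> k" using w(2) unfolding Q_def by simp
    qed
    then show ?thesis
      by (rule bounded_subset[rotated]) (intro bounded_Times bounded_cball bounded_closed_interval)
  qed
  moreover have "continuous_on E Q" unfolding Q_def by (intro continuous_intros)
  moreover have "bdd_below (Q ` E)" using low' by (intro bdd_belowI2)
  ultimately obtain p where p: "p \<in> E" "\<And>w. w \<in> E \<Longrightarrow> Q p \<le> Q w"
    using convex_minimizer_exists[OF E conv] by blast
  obtain y s where [simp]: "p = (y, s)" by (cases p)
  have "s + ((x - y) /\<^sub>R t) \<bullet> (z - y) \<le> r" if zr: "(z, r) \<in> E" for z r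
  proof -
    have "0 \<le> r - s - ((x - y) \<bullet> (z - y)) / t"
    proof (rule nonneg_of_quadratic_perturbation)
      fix \<theta> :: real assume th: "0 < \<theta>" "\<theta> < 1"
      have "(1 - \<theta>) *\<^sub>R p + \<theta> *\<^sub>R (z, r) \<in> E"
        using E(2) p(1) zr th by (intro convexD) auto
      from p(2)[OF this]
      have "s + c * (norm (y - x))\<^sup>2 \<le> (1 - \<theta>) * s + \<theta> * r
          + c * (norm ((1 - \<theta>) *\<^sub>R y + \<theta> *\<^sub>R z - x))\<^sup>2"
        unfolding Q_def by simp
      also have "(norm ((1 - \<theta>) *\<^sub>R y + \<theta> *\<^sub>R z - x))\<^sup>2
          = (norm (y - x))\<^sup>2 - 2 * \<theta> * ((x - y) \<bullet> (z - y)) + \<theta>\<^sup>2 * (norm (z - y))\<^sup>2"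
        unfolding power2_norm_eq_inner
        by (simp add: inner_simps inner_commute algebra_simps power2_eq_square)
      finally have "0 \<le> \<theta> * (r - s) + c * (- 2 * \<theta> * ((x - y) \<bullet> (z - y)) + \<theta>\<^sup>2 * (norm (z - y))\<^sup>2)"
        by (simp add: algebra_simps)
      also have "\<dots> = \<theta> * (r - s - ((x - y) \<bullet> (z - y)) / t) + \<theta>\<^sup>2 * ((norm (z - y))\<^sup>2 / (2 * t))"
        using assms(2) unfolding c_def by (simp add: field_simps)
      finally show "0 \<le> \<theta> * (r - s - ((x - y) \<bullet> (z - y)) / t)
          + \<theta>\<^sup>2 * ((norm (z - y))\<^sup>2 / (2 * t))" .
    qed
    then show ?thesis by (simp add: divide_inverse mult.commute)
  qed
  then have "(y, (x - y) /\<^sub>R t) \<in> epi_subgrad E"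
    unfolding epi_subgrad_def using p(1) by auto
  then show thesis by (rule that)
qed

text \<open>Completing the square turns the subgradient inequality into growth by half the squared
  distance from \<open>p\<close>, so \<open>p\<close> is the only minimiser, as the definite
  description in \<open>prox\<close> demands.\<close>

lemma prox_eqI:
  assumes p: "p \<in> X" "k p = ereal s" "\<And>y. y \<in> X \<Longrightarrow> ereal (s + ((x - p) /\<^sub>R t) \<bullet> (y - p)) \<le> k y"
    and "t > 0"
  shows "prox X (\<lambda>w. ereal t * k w) x = p"
proof -
  let ?F = "\<lambda>w. ereal t * k w + ereal ((norm (w - x))\<^sup>2 / 2)"
  have Fp: "?F p = ereal (t * s + (norm (p - x))\<^sup>2 / 2)" using p(2) by simp
  have F: "ereal (t * s + (norm (p - x))\<^sup>2 / 2 + (norm (y - p))\<^sup>2 / 2) \<le> ?F y" if "y \<in> X" for y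
  proof -
    have "ereal t * ereal (s + ((x - p) /\<^sub>R t) \<bullet> (y - p)) \<le> ereal t * k y"
      using p(3)[OF that] \<open>t > 0\<close> by (intro ereal_mult_left_mono) auto
    moreover have "t * (s + ((x - p) /\<^sub>R t) \<bullet> (y - p)) = t * s + (x - p) \<bullet> (y - p)"
      using \<open>t > 0\<close> by (simp add: distrib_left mult.assoc[symmetric])
    ultimately have "ereal (t * s + (x - p) \<bullet> (y - p)) + ereal ((norm (y - x))\<^sup>2 / 2) \<le> ?F y"
      by (intro add_right_mono) (simp only: times_ereal.simps)
    moreover have "(x - p) \<bullet> (y - p) + (norm (y - x))\<^sup>2 / 2 = (norm (p - x))\<^sup>2 / 2 + (norm (y - p))\<^sup>2 / 2"
      unfolding power2_norm_eq_inner by (simp add: inner_simps inner_commute field_simps)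
    ultimately show ?thesis by (simp add: add.assoc)
  qed
  have "q = p" if "is_arg_min ?F (\<lambda>y. y \<in> X) q" for q
  proof (rule ccontr)
    assume "q \<noteq> p"
    then have "?F p < ereal (t * s + (norm (p - x))\<^sup>2 / 2 + (norm (q - p))\<^sup>2 / 2)" unfolding Fp by simp
    also have "\<dots> \<le> ?F q" using F that by (simp add: is_arg_min_def)
    finally show False using that p(1) by (auto simp: is_arg_min_def)
  qed
  moreover have "is_arg_min ?F (\<lambda>y. y \<in> X) p"
  proof -
    have "?F p \<le> ?F y" if "y \<in> X" for y
    proof -
      have "?F p \<le> ereal (t * s + (norm (p - x))\<^sup>2 / 2 + (norm (y - p))\<^sup>2 / 2)" unfolding Fp by simp
      with F[OF that] show ?thesis by (rule order_trans[rotated])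
    qed
    then show ?thesis using p(1) by (auto simp: is_arg_min_def not_less)
  qed
  ultimately show ?thesis unfolding prox_def argmin_set_def mem_Collect_eq
    by (rule the_equality[rotated])
qed

text \<open>Equality holds in the Fenchel--Young inequality at a subgradient, so the conjugate at
  \<open>w\<close> is \<open>w \<bullet> a - g a\<close>, and \<open>a\<close> is a subgradient of
  the conjugate at \<open>w\<close>.\<close>

lemma epi_subgrad_fenchel_conj:
  assumes "(a, w) \<in> epi_subgrad (epi_on X g)" "\<And>y. y \<in> X \<Longrightarrow> g y \<noteq> -\<infinity>"
  obtains s where "fenchel_conj X g w = ereal s" "\<And>u. ereal (s + a \<bullet> (u - w)) \<le> fenchel_conj X g u"
proof -
  obtain r where r: "a \<in> X" "g a = ereal r" "\<And>y. y \<in> X \<Longrightarrow> ereal (r + w \<bullet> (y - a)) \<le> g y"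
    using epi_subgrad_epi_onD[OF assms] by blast
  have ge: "ereal (u \<bullet> a - r) \<le> fenchel_conj X g u" for u
    unfolding fenchel_conj_def by (rule SUP_upper2[OF r(1)]) (simp add: r(2))
  have "fenchel_conj X g w \<le> ereal (w \<bullet> a - r)"
    unfolding fenchel_conj_def
  proof (rule SUP_least)
    fix y assume "y \<in> X"
    from r(3)[OF this] assms(2)[OF this] show "ereal (w \<bullet> y) - g y \<le> ereal (w \<bullet> a - r)"
      by (cases "g y") (auto simp: inner_simps)
  qed
  with ge[of w] have "fenchel_conj X g w = ereal (w \<bullet> a - r)" by (rule antisym[rotated])
  then show thesis using that ge by (simp add: inner_simps inner_commute)
qed

lemma prox_epi_subgrad:
  assumes "(p, (x - p) /\<^sub>R t) \<in> epi_subgrad (epi_on X g)" "\<And>y. y \<in> X \<Longrightarrow> g y \<noteq> -\<infinity>" "t > 0"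
  shows "prox X (\<lambda>w. ereal t * g w) x = p"
proof -
  obtain s where "p \<in> X" "g p = ereal s"
    "\<And>y. y \<in> X \<Longrightarrow> ereal (s + ((x - p) /\<^sub>R t) \<bullet> (y - p)) \<le> g y"
    using epi_subgrad_epi_onD[OF assms(1,2)] by blast
  then show ?thesis by (rule prox_eqI[OF _ _ _ assms(3)])
qed

text \<open>Moreau's decomposition: writing \<open>x = w + t *\<^sub>R a\<close> with
  \<open>w\<close> a subgradient of \<open>g\<close> at \<open>a\<close> identifies the proximal
  point of the conjugate, so proximal points of \<open>g\<close> suffice.\<close>

lemma prox_fenchel_conj:
  assumes "(a, w) \<in> epi_subgrad (epi_on X g)" "\<And>y. y \<in> X \<Longrightarrow> g y \<noteq> -\<infinity>" "t > 0"
    and "w \<in> X" "x = w + t *\<^sub>R a"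
  shows "prox X (\<lambda>u. ereal t * fenchel_conj X g u) x = w"
proof -
  obtain s where "fenchel_conj X g w = ereal s" "\<And>u. ereal (s + a \<bullet> (u - w)) \<le> fenchel_conj X g u"
    using epi_subgrad_fenchel_conj[OF assms(1,2)] by blast
  moreover have "(x - w) /\<^sub>R t = a" using assms(3,5) by simp
  ultimately show ?thesis by (intro prox_eqI[OF \<open>w \<in> X\<close> _ _ \<open>t > 0\<close>]) auto
qed

section \<open>Riesz representation and adjoints\<close>

lemma riesz_representation:
  fixes l :: "'a::{real_inner, complete_space} \<Rightarrow> real"
  assumes "bounded_linear l"
  obtains p where "\<And>y. l y = p \<bullet> y"
proof -
  interpret bounded_linear l by (rule assms)
  \<comment> \<open>The minimiser of \<open>- l y + (norm y)\<^sup>2 / 2\<close> represents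
    \<open>l\<close>; it is the proximal point at 0 of \<open>- l\<close>, whose epigraph is
    \<open>E\<close>.\<close>
  define E where "E = {(y, r). - l y \<le> r}"
  have "closed E" unfolding E_def case_prod_beta'
    by (intro closed_Collect_le continuous_intros bounded_linear.continuous_on[OF assms])
  moreover have "convex E"
  proof (rule convexI)
    fix a b :: "'a \<times> real" and u v :: real
    assume ab: "a \<in> E" "b \<in> E" and uv: "0 \<le> u" "0 \<le> v"
    then have "- l (fst a) \<le> snd a" "- l (fst b) \<le> snd b" by (auto simp: E_def)
    then have "u * - l (fst a) \<le> u * snd a" "v * - l (fst b) \<le> v * snd b"
      using uv mult_left_mono by blast+
    then show "u *\<^sub>R a + v *\<^sub>R b \<in> E" by (simp add: E_def case_prod_beta' add scaleR)
  qed
  moreover have "(0, 0) \<in> E" "(0, -1) \<notin> E" by (auto simp: E_def zero)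
  ultimately have "proper_epi E" unfolding proper_epi_def
    by (metis neg_less_0_iff_less zero_less_one)
  then obtain p where "(p, (0 - p) /\<^sub>R 1) \<in> epi_subgrad E"
    using prox_point_exists[of E 1 0] by auto
  then obtain s where s: "- l p \<le> s" "\<And>y r. - l y \<le> r \<Longrightarrow> s - p \<bullet> (y - p) \<le> r"
    unfolding epi_subgrad_def E_def by auto
  have le: "l d \<le> p \<bullet> d" for d
    using s(1) s(2)[OF order_refl, of "p + d"] by (simp add: add)
  have "l d = p \<bullet> d" for d using le[of d] le[of "- d"] by (simp add: linear_neg[OF bounded_linear.linear[OF assms]])
  then show thesis by (rule that)
qed

text \<open>\<open>adjoint\<close> is a choice among all maps with this property, so the property
  becomes available only once Riesz representation provides such a map.\<close>

lemma adjoint_inner: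
  fixes T :: "'a::{real_inner, complete_space} \<Rightarrow> 'b::real_inner"
  assumes "bounded_linear T"
  shows "x \<bullet> adjoint T y = T x \<bullet> y"
proof -
  have "\<exists>p. \<forall>x. T x \<bullet> y = x \<bullet> p" for y
  proof -
    obtain p where "\<And>x. T x \<bullet> y = p \<bullet> x"
      using riesz_representation[OF bounded_linear_compose[OF bounded_linear_inner_left assms], of y] by blast
    then show ?thesis by (auto simp: inner_commute)
  qed
  then obtain T' where "\<forall>x y. T x \<bullet> y = x \<bullet> T' y" by metis
  then have "\<forall>x y. T x \<bullet> y = x \<bullet> adjoint T y"
    unfolding adjoint_def
    by (rule someI[where P = "\<lambda>T'. \<forall>x y. T x \<bullet> y = x \<bullet> T' y"])
  then show ?thesis by simp
qed

lemma norm_adjoint_le: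
  fixes T :: "'a::{real_inner, complete_space} \<Rightarrow> 'b::real_inner"
  assumes "bounded_linear T"
  shows "norm (adjoint T y) \<le> onorm T * norm y"
proof (cases "adjoint T y = 0")
  case False
  have "norm (adjoint T y) * norm (adjoint T y) = T (adjoint T y) \<bullet> y"
    using adjoint_inner[OF assms, of "adjoint T y" y] by (simp add: power2_eq_square flip: power2_norm_eq_inner)
  also have "\<dots> \<le> norm (T (adjoint T y)) * norm y" by (rule norm_cauchy_schwarz)
  also have "\<dots> \<le> onorm T * norm (adjoint T y) * norm y"
    by (intro mult_right_mono onorm[OF assms]) auto
  finally show ?thesis using False by (simp add: mult.assoc mult.left_commute mult_le_cancel_left)
qed (simp add: onorm_pos_le[OF assms])

section \<open>Lagrange multipliers under a strong quasi-relative interior condition\<close>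

text \<open>The points of \<open>W\<close> mapped into shrinking balls around a limit of images form
  nested bounded closed convex sets; a common point is a preimage of the limit.\<close>

lemma closed_linear_image_of_bounded_convex:
  fixes T :: "'a::{real_inner, complete_space} \<Rightarrow> 'b::real_normed_vector"
  assumes W: "closed W" "convex W" "bounded W" and T: "bounded_linear T"
  shows "closed (T ` W)"
  unfolding closed_sequential_limits
proof (intro allI impI, elim conjE)
  fix y l assume y: "\<forall>n. y n \<in> T ` W" and l: "y \<longlonglongrightarrow> l"
  define S where "S n = W \<inter> T -` cball l (1 / Suc n)" for n
  have "\<exists>p. \<forall>n. p \<in> S n"
  proof (rule nested_convex_inter_nonempty)
    show "decseq S"
    proof (rule decseq_SucI)
      fix n
      have "1 / real (Suc (Suc n)) \<le> 1 / real (Suc n)" by (simp add: frac_le)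
      then have "cball l (1 / real (Suc (Suc n))) \<subseteq> cball l (1 / real (Suc n))"
        by (rule subset_cball)
      then show "S (Suc n) \<subseteq> S n" unfolding S_def by auto
    qed
    fix n
    show "closed (S n)" unfolding S_def
      by (intro closed_Int W closed_vimage closed_cball bounded_linear.continuous_on[OF T] continuous_intros)
    show "convex (S n)" unfolding S_def
      by (intro convex_Int W convex_linear_vimage bounded_linear.linear[OF T] convex_cball)
    have "\<forall>\<^sub>F k in sequentially. dist (y k) l < 1 / Suc n" using l by (rule tendstoD) simp
    then obtain k where "dist (y k) l < 1 / Suc n"
      using eventually_happens'[OF sequentially_bot] by blast
    moreover obtain w where "w \<in> W" "y k = T w" using y by blast
    ultimately have "w \<in> S n" unfolding S_def by (simp add: dist_commute)
    then show "S n \<noteq> {}" by blast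
    show "bounded (S 0)" unfolding S_def by (rule bounded_subset[OF W(3)]) auto
  qed
  then obtain p where p: "p \<in> S n" for n by blast
  have "dist l (T p) \<le> 0"
  proof (rule field_le_epsilon)
    fix e :: real assume "e > 0"
    then obtain n where "1 / real (Suc n) < e" using nat_approx_posE by blast
    moreover have "dist l (T p) \<le> 1 / Suc n" using p[of n] unfolding S_def by simp
    ultimately show "dist l (T p) \<le> 0 + e" by simp
  qed
  then have "l = T p" by simp
  then show "l \<in> T ` W" using p[of 0] by (simp add: S_def)
qed

text \<open>An open mapping statement of Robinson--Ursescu type for the restriction of
  \<open>T\<close> to a convex set, relative to the closed subspace \<open>K\<close>.\<close>

lemma cone_subspace_bounded_preimages:
  fixes W :: "'a::{real_inner, complete_space} set"
    and T :: "'a \<Rightarrow> 'b::{real_inner, complete_space}"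
  assumes W: "closed W" "convex W" and T: "bounded_linear T"
    and K: "K = (\<Union>r\<in>{0<..}. (\<lambda>w. r *\<^sub>R T w) ` W)" "subspace K" "closed K"
  obtains \<rho> M where "\<rho> > 0"
    "\<And>e. e \<in> K \<Longrightarrow> norm e \<le> \<rho> \<Longrightarrow> \<exists>w\<in>W. T w = e \<and> norm w \<le> M"
proof -
  interpret T: bounded_linear T by (rule T)
  have TK: "T w \<in> K" if "w \<in> W" for w
    unfolding K(1) using that by (intro UN_I[of 1] image_eqI[of _ _ w]) auto
  have "0 \<in> K" by (rule subspace_0[OF K(2)])
  then obtain w0 where w0: "w0 \<in> W" "T w0 = 0" unfolding K(1) by auto
  define \<Gamma> where "\<Gamma> n = (\<lambda>w. real (Suc n) *\<^sub>R T w) ` (W \<inter> cball 0 (Suc n))" for n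
  have \<Gamma>_closed: "closed (\<Gamma> n)" for n
    unfolding \<Gamma>_def
    by (intro closed_linear_image_of_bounded_convex closed_Int W convex_Int convex_cball closed_cball
        bounded_Int bounded_cball bounded_linear_const_scaleR disjI2 T)
  have \<Gamma>_sub: "\<Gamma> n \<subseteq> K" for n
    unfolding \<Gamma>_def using TK subspace_scale[OF K(2)] by auto
  have "K \<subseteq> (\<Union>n. \<Gamma> n)"
  proof
    fix e assume "e \<in> K"
    then obtain r w where rw: "r > 0" "w \<in> W" "e = r *\<^sub>R T w" unfolding K(1) by auto
    obtain n where n: "max r (max (norm w) (norm w0)) \<le> real n" using real_arch_simple by blast
    \<comment> \<open>Shrinking \<open>w\<close> towards \<open>w0\<close>, where \<open>T\<close>
      vanishes, keeps the direction of the image, so a single index serves both as scale and as norm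
      bound.\<close>
    define \<theta> where "\<theta> = r / Suc n"
    have th: "0 \<le> \<theta>" "\<theta> \<le> 1" "real (Suc n) * \<theta> = r" using rw n by (auto simp: \<theta>_def field_simps)
    have "(1 - \<theta>) *\<^sub>R w0 + \<theta> *\<^sub>R w \<in> W \<inter> cball 0 (Suc n)"
      using w0 rw n th by (intro convexD convex_Int W convex_cball) auto
    moreover have "e = real (Suc n) *\<^sub>R T ((1 - \<theta>) *\<^sub>R w0 + \<theta> *\<^sub>R w)"
      using w0 rw th by (simp add: T.add T.scaleR del: of_nat_Suc)
    ultimately show "e \<in> (\<Union>n. \<Gamma> n)" unfolding \<Gamma>_def by blast
  qed
  then have un: "(\<Union>n. \<Gamma> n) = K" using \<Gamma>_sub by blast
  have "\<exists>n. (top_of_set K) interior_of \<Gamma> n \<noteq> {}"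
  proof (rule ccontr)
    assume "\<not> ?thesis"
    moreover have "closedin (top_of_set K) (\<Gamma> n)" for n
      by (rule closed_subset[OF \<Gamma>_sub \<Gamma>_closed])
    ultimately have "(top_of_set K) interior_of \<Union>(range \<Gamma>) = {}"
      using K(3)
      by (intro Baire_category_alt disjI1 completely_metrizable_space_closedin[OF completely_metrizable_space_euclidean])
        auto
    moreover have "(top_of_set K) interior_of K = K"
      using interior_of_topspace[of "top_of_set K"] by simp
    ultimately show False using un \<open>0 \<in> K\<close> by auto
  qed
  then obtain n k0 where "k0 \<in> (top_of_set K) interior_of \<Gamma> n" by blast
  then obtain U where U: "open U" "k0 \<in> U \<inter> K" "U \<inter> K \<subseteq> \<Gamma> n"
    unfolding interior_of_def openin_open by blast
  obtain \<epsilon> where \<epsilon>: "\<epsilon> > 0" "ball k0 \<epsilon> \<subseteq> U" using U openE by blast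
  let ?N = "real (Suc n)"
  \<comment> \<open>The set supplied by Baire's theorem is centred at \<open>k0\<close>, not at 0. A
    preimage along \<open>- k0\<close> exists because \<open>K\<close> is a subspace, and mixing it
    in moves the ball to the origin.\<close>
  have "- k0 \<in> K" using subspace_neg[OF K(2)] U(2) by blast
  then obtain r w1 where rw1: "r > 0" "w1 \<in> W" "- k0 = r *\<^sub>R T w1" unfolding K(1) by auto
  define s where "s = r / ?N"
  have s: "s > 0" using rw1(1) by (simp add: s_def)
  have sT: "s *\<^sub>R T w1 = - (k0 /\<^sub>R ?N)"
    using arg_cong[OF rw1(3), of "\<lambda>z. z /\<^sub>R ?N"] by (simp add: s_def divide_inverse mult.commute)
  \<comment> \<open>Scaling chosen so that
    \<open>T w + s *\<^sub>R T w1 = (1 + s) *\<^sub>R e\<close>; dividing by \<open>1 + s\<close>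
    makes the left side the image of a convex combination.\<close>
  define C where "C = ?N * (1 + s)"
  have "C > 0" using s by (simp add: C_def)
  have "\<exists>w\<in>W. T w = e \<and> norm w \<le> max ?N (norm w1)"
    if e: "e \<in> K" "norm e \<le> \<epsilon> / (2 * C)" for e
  proof -
    have "norm (C *\<^sub>R e) \<le> \<epsilon> / 2"
      using e(2) \<open>C > 0\<close> by (simp add: field_simps)
    then have "k0 + C *\<^sub>R e \<in> U \<inter> K"
      using \<epsilon> U(2) e(1) subspace_add[OF K(2)] subspace_scale[OF K(2)] by (auto simp: dist_norm)
    then have "k0 + C *\<^sub>R e \<in> \<Gamma> n" using U(3) by blast
    then obtain w where w: "w \<in> W" "norm w \<le> ?N" "k0 + C *\<^sub>R e = ?N *\<^sub>R T w"
      unfolding \<Gamma>_def by auto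
    have "inverse ?N * C = 1 + s" by (simp add: C_def)
    then have Tw: "T w = k0 /\<^sub>R ?N + (1 + s) *\<^sub>R e"
      using arg_cong[OF w(3), of "\<lambda>z. z /\<^sub>R ?N"] by (simp add: scaleR_add_right del: of_nat_Suc)
    define w' where "w' = (1 / (1 + s)) *\<^sub>R w + (s / (1 + s)) *\<^sub>R w1"
    have sum1: "1 / (1 + s) + s / (1 + s) = 1" using s by (simp add: field_simps)
    have "w' \<in> W \<inter> cball 0 (max ?N (norm w1))"
      unfolding w'_def using w rw1 s sum1 by (intro convexD convex_Int W convex_cball) auto
    moreover have "T w' = e"
    proof -
      have "T w' = (1 / (1 + s)) *\<^sub>R (T w + s *\<^sub>R T w1)"
        by (simp add: w'_def T.add T.scaleR scaleR_add_right)
      also have "\<dots> = e" unfolding sT Tw using s by simp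
      finally show ?thesis .
    qed
    ultimately show ?thesis by auto
  qed
  moreover have "\<epsilon> / (2 * C) > 0" using \<epsilon>(1) \<open>C > 0\<close> by simp
  ultimately show thesis using that by blast
qed

text \<open>Cost and constraint are linear, so all nonlinearity sits in the convex set
  \<open>W\<close>, a product of epigraphs in the application. The conclusion
  \<open>v \<in> K\<close> later places the multipliers in their carriers.\<close>

theorem lagrange_multiplier_exists:
  fixes W :: "'a::{real_inner, complete_space} set"
    and T :: "'a \<Rightarrow> 'b::{real_inner, complete_space}"
    and c :: "'a \<Rightarrow> real"
  assumes W: "closed W" "convex W" and T: "bounded_linear T" and c: "bounded_linear c"
    and K: "K = (\<Union>r\<in>{0<..}. (\<lambda>w. r *\<^sub>R T w) ` W)" "subspace K" "closed K"
    and min: "\<And>w. w \<in> W \<Longrightarrow> T w = 0 \<Longrightarrow> m \<le> c w"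
  obtains v where "v \<in> K" "\<And>w. w \<in> W \<Longrightarrow> m + v \<bullet> T w \<le> c w"
proof -
  interpret T: bounded_linear T by (rule T)
  interpret c: bounded_linear c by (rule c)
  have TK: "T w \<in> K" if "w \<in> W" for w
    unfolding K(1) using that by (intro UN_I[of 1] image_eqI[of _ _ w]) auto
  obtain \<rho> M where \<rho>: "\<rho> > 0" and pre: "\<And>e. e \<in> K \<Longrightarrow> norm e \<le> \<rho> \<Longrightarrow> \<exists>w\<in>W. T w = e \<and> norm w \<le> M"
    using cone_subspace_bounded_preimages[OF W T K] by blast
  define R where "R = onorm c * M"
  have pre_c: "\<exists>w\<in>W. T w = e \<and> c w \<le> R" if e: "e \<in> K" "norm e \<le> \<rho>" for e
  proof -
    obtain w where w: "w \<in> W" "T w = e" "norm w \<le> M" using pre[OF e] by blast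
    have "c w \<le> onorm c * norm w" using onorm[OF c, of w] by simp
    also have "\<dots> \<le> R" unfolding R_def by (intro mult_left_mono w onorm_pos_le c)
    finally show ?thesis using w by blast
  qed
  have "0 \<in> K" by (rule subspace_0[OF K(2)])
  then obtain w0 where w0: "w0 \<in> W" "T w0 = 0" "c w0 \<le> R" using pre_c[of 0] \<rho> by auto
  \<comment> \<open>Slope of a lower bound for the perturbation function: a point over
    \<open>T w\<close> is balanced by one of cost at most \<open>R\<close> over the opposite vector
    of norm \<open>\<rho>\<close>, and the combination over 0 costs at least
    \<open>m\<close>.\<close>
  define \<kappa> where "\<kappa> = (R - m) / \<rho>"
  have lower: "m - \<kappa> * norm (T w) \<le> c w" if w: "w \<in> W" for w
  proof (cases "T w = 0")
    case False
    define n where "n = norm (T w)"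
    have n: "n > 0" using False by (simp add: n_def)
    have "norm (- (\<rho> / n) *\<^sub>R T w) \<le> \<rho>" using n \<rho> by (simp add: n_def)
    then obtain w' where w': "w' \<in> W" "T w' = - (\<rho> / n) *\<^sub>R T w" "c w' \<le> R"
      using pre_c[of "- (\<rho> / n) *\<^sub>R T w"] TK[OF w] subspace_scale[OF K(2)] by blast
    define w'' where "w'' = (\<rho> / (\<rho> + n)) *\<^sub>R w + (n / (\<rho> + n)) *\<^sub>R w'"
    have "w'' \<in> W" unfolding w''_def
      using n \<rho> w w'(1) by (intro convexD[OF W(2)]) (auto simp flip: add_divide_distrib)
    moreover have "T w'' = 0"
      using n \<rho> by (simp add: w''_def T.add T.scaleR w'(2))
    ultimately have "m \<le> c w''" by (rule min)
    also have "\<dots> = (\<rho> * c w + n * c w') / (\<rho> + n)"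
      by (simp add: w''_def c.add c.scaleR add_divide_distrib)
    also have "\<dots> \<le> (\<rho> * c w + n * R) / (\<rho> + n)"
      using n \<rho> w'(3) by (intro divide_right_mono add_left_mono mult_left_mono) auto
    finally have "m * (\<rho> + n) \<le> \<rho> * c w + n * R" using n \<rho> by (simp add: pos_le_divide_eq)
    then show ?thesis unfolding \<kappa>_def n_def[symmetric] using \<rho> by (simp add: field_simps)
  qed (use min[OF w] in simp)
  define E where "E = (\<lambda>w. (T w, c w)) ` W"
  have E_bl: "bounded_linear (\<lambda>w. (T w, c w))" by (rule bounded_linear_Pair[OF T c])
  have E_conv: "convex (closure E)"
    unfolding E_def by (intro convex_closure convex_linear_image bounded_linear.linear[OF E_bl] W)
  have E_sub: "closure E \<subseteq> {p. m - \<kappa> * norm (fst p) \<le> snd p} \<inter> fst -` K"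
  proof (rule closure_minimal)
    show "E \<subseteq> {p. m - \<kappa> * norm (fst p) \<le> snd p} \<inter> fst -` K"
      using lower TK by (auto simp: E_def)
    show "closed ({p. m - \<kappa> * norm (fst p) \<le> snd p} \<inter> fst -` K)"
      by (intro closed_Int closed_Collect_le continuous_intros closed_vimage K(3))
  qed
  \<comment> \<open>The slack \<delta> is needed because \<open>(0, m)\<close> may belong to the
    closure of \<open>E\<close>; \<open>(0, m - \<delta>)\<close> stays outside, since the lower
    bound \<open>E_sub\<close> passes to the closure.\<close>
  have approx: "\<exists>v\<in>K. \<forall>w\<in>W. m - \<delta> + v \<bullet> T w \<le> c w" if \<delta>: "\<delta> > 0" for \<delta>
  proof -
    have E_ne: "closure E \<noteq> {}" using w0 closure_subset unfolding E_def by blast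
    obtain p where p: "p \<in> closure E" "\<And>w. w \<in> closure E \<Longrightarrow> ((0, m - \<delta>) - p) \<bullet> (w - p) \<le> 0"
      using closed_convex_projection[OF closed_closure E_conv E_ne] by blast
    define a b where ab: "a = - fst p" "b = m - \<delta> - snd p"
    have "p \<noteq> (0, m - \<delta>)" using E_sub p(1) \<delta> by auto
    then have "a \<noteq> 0 \<or> b \<noteq> 0" unfolding ab by (cases p) auto
    then have pos: "0 < a \<bullet> a + b * b"
      by (metis add_nonneg_pos add_pos_nonneg inner_ge_zero inner_gt_zero_iff not_real_square_gt_zero zero_le_square)
    have neg: "a \<bullet> T w + b * (c w - (m - \<delta>)) < 0" if "w \<in> W" for w
    proof -
      have "(T w, c w) \<in> E" using that by (simp add: E_def)
      then have "(T w, c w) \<in> closure E" by (rule subsetD[OF closure_subset])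
      from p(2)[OF this] have "a \<bullet> (T w + a) + b * (c w - (m - \<delta>) + b) \<le> 0"
        unfolding ab by (cases p) (simp add: algebra_simps)
      with pos show ?thesis by (simp add: inner_simps algebra_simps)
    qed
    \<comment> \<open>Testing at \<open>w0\<close>, which satisfies the constraint and costs at
      least \<open>m\<close>, excludes a nonnegative vertical component; dividing by
      \<open>- b\<close> then normalises the hyperplane.\<close>
    have b: "b < 0"
    proof (rule ccontr)
      assume "\<not> b < 0"
      then have "0 \<le> b * (c w0 - (m - \<delta>))" using min[OF w0(1,2)] \<delta> by simp
      with neg[OF w0(1)] show False by (simp add: w0)
    qed
    show ?thesis
    proof (intro bexI ballI)
      show "a /\<^sub>R (- b) \<in> K"
        using E_sub p(1) subspace_neg[OF K(2)] subspace_scale[OF K(2)] unfolding ab by blast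
      fix w assume "w \<in> W"
      from neg[OF this] b show "m - \<delta> + (a /\<^sub>R (- b)) \<bullet> T w \<le> c w" by (simp add: field_simps)
    qed
  qed
  define S where "S n = K \<inter> (\<Inter>w\<in>W. {v. T w \<bullet> v \<le> c w - m + 1 / Suc n})" for n
  have "\<exists>p. \<forall>n. p \<in> S n"
  proof (rule nested_convex_inter_nonempty)
    show "decseq S"
    proof (rule decseq_SucI)
      fix n
      have "1 / real (Suc (Suc n)) \<le> 1 / real (Suc n)" by (simp add: frac_le)
      then show "S (Suc n) \<subseteq> S n" unfolding S_def by fastforce
    qed
    fix n
    show "closed (S n)" unfolding S_def by (intro closed_Int K(3) closed_INT ballI closed_halfspace_le)
    show "convex (S n)" unfolding S_def
      by (intro convex_Int subspace_imp_convex K(2) convex_INT convex_halfspace_le)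
    show "S n \<noteq> {}" using approx[of "1 / Suc n"] unfolding S_def
      by (fastforce simp: inner_commute algebra_simps)
    \<comment> \<open>Testing with a preimage, of cost at most \<open>R\<close>, of the vector of
      norm \<open>\<rho>\<close> in the direction of \<open>v\<close>. The summand 1 is the slack of
      \<open>S 0\<close>.\<close>
    have "norm v \<le> (R - m + 1) / \<rho>" if v: "v \<in> S 0" for v
    proof (cases "v = 0")
      case False
      have "norm ((\<rho> / norm v) *\<^sub>R v) \<le> \<rho>" using False \<rho> by simp
      then obtain w where w: "w \<in> W" "T w = (\<rho> / norm v) *\<^sub>R v" "c w \<le> R"
        using pre_c[of "(\<rho> / norm v) *\<^sub>R v"] v subspace_scale[OF K(2)] unfolding S_def by blast
      have "T w \<bullet> v \<le> c w - m + 1" using v w(1) unfolding S_def by auto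
      moreover have "T w \<bullet> v = \<rho> * norm v"
        using False by (simp add: w(2) power2_eq_square flip: power2_norm_eq_inner)
      ultimately show ?thesis using w(3) \<rho> by (simp add: field_simps)
    next
      case True
      have "m \<le> R" using min[OF w0(1,2)] w0(3) by simp
      then show ?thesis using True \<rho> by simp
    qed
    then show "bounded (S 0)" unfolding bounded_iff by blast
  qed
  then obtain v where v: "v \<in> S n" for n by blast
  have "m + v \<bullet> T w \<le> c w" if w: "w \<in> W" for w
  proof (rule field_le_epsilon)
    fix e :: real assume "e > 0"
    then obtain n where "1 / real (Suc n) < e" using nat_approx_posE by blast
    moreover have "T w \<bullet> v \<le> c w - m + 1 / Suc n" using v[of n] w unfolding S_def by blast
    ultimately show "m + v \<bullet> T w \<le> c w + e" by (simp add: inner_commute)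
  qed
  then show thesis using that v[of 0] unfolding S_def by blast
qed

section \<open>Convergence of perturbed extragradient sequences\<close>

lemma almost_decreasing_convergent:
  fixes a s d :: "nat \<Rightarrow> real"
  assumes a: "\<And>n. 0 \<le> a n" and s: "\<And>n. 0 \<le> s n" and d: "summable d"
    and dec: "\<forall>\<^sub>F n in sequentially. a (Suc n) + s n \<le> a n + d n"
  shows "convergent a" "summable s"
proof -
  obtain N where N: "\<And>n. n \<ge> N \<Longrightarrow> a (Suc n) + s n \<le> a n + d n"
    using dec unfolding eventually_sequentially by blast
  define D where "D n = (\<Sum>k<n. d (k + N))" for n
  define S where "S n = (\<Sum>k<n. s (k + N))" for n
  \<comment> \<open>Adding the partial sums of \<open>s\<close> and removing those of
    \<open>d\<close>, which may have either sign, produces a sequence that truly decreases and is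
    bounded below.\<close>
  define b where "b n = a (n + N) + S n - D n" for n
  have "summable (\<lambda>k. d (k + N))" using d by (simp add: summable_iff_shift)
  then have conv_D: "convergent D" unfolding D_def by (rule summable_iff_convergent[THEN iffD1])
  then obtain M where M: "\<And>n. \<bar>D n\<bar> \<le> M"
    using convergent_imp_Bseq[of D] unfolding Bseq_def by auto
  have S_nonneg: "0 \<le> S n" for n unfolding S_def using s by (intro sum_nonneg) auto
  have b_dec: "decseq b"
    by (rule decseq_SucI) (use N in \<open>simp add: b_def S_def D_def algebra_simps\<close>)
  have b_low: "- M \<le> b n" for n
    using M[of n] S_nonneg[of n] a[of "n + N"] unfolding b_def by linarith
  obtain L where "b \<longlonglongrightarrow> L" using decseq_convergent[OF b_dec, of "- M"] b_low by blast
  then have conv_b: "convergent b" by (auto simp: convergent_def)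
  have "summable (\<lambda>k. s (k + N))"
  proof (rule summableI_nonneg_bounded)
    fix n
    have "b n \<le> b 0" using b_dec by (simp add: decseq_def)
    then show "(\<Sum>k<n. s (k + N)) \<le> b 0 + M"
      using M[of n] a[of "n + N"] unfolding b_def S_def[symmetric] by linarith
  qed (rule s)
  then show "summable s" by (simp add: summable_iff_shift)
  then have "summable (\<lambda>k. s (k + N))" by (simp add: summable_iff_shift)
  then have conv_S: "convergent S" unfolding S_def by (rule summable_iff_convergent[THEN iffD1])
  have "(\<lambda>n. a (n + N)) = (\<lambda>n. b n - S n + D n)" by (simp add: b_def)
  then have "convergent (\<lambda>n. a (n + N))"
    using convergent_add[OF convergent_diff[OF conv_b conv_S] conv_D] by simp
  then show "convergent a" using convergent_ignore_initial_segment[of a N] by simp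
qed

lemma telescoping_sum_bounded:
  fixes t b d :: "nat \<Rightarrow> real"
  assumes b: "\<And>n. 0 \<le> b n" and d: "summable d"
    and t: "\<forall>\<^sub>F n in sequentially. t n \<le> b n - b (Suc n) + d n"
  shows "\<exists>c. \<forall>\<^sub>F n in sequentially. (\<Sum>k<n. t k) \<le> c"
proof -
  obtain N where N: "\<And>n. n \<ge> N \<Longrightarrow> t n \<le> b n - b (Suc n) + d n"
    using t unfolding eventually_sequentially by blast
  have "convergent (\<lambda>n. \<Sum>k<n. d k)" using d by (simp add: summable_iff_convergent)
  then have "Bseq (\<lambda>n. \<Sum>k<n. d k)" by (rule convergent_imp_Bseq)
  then obtain M where M: "\<And>n. \<bar>\<Sum>k<n. d k\<bar> \<le> M" unfolding Bseq_def real_norm_def by blast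
  have "(\<Sum>k<n. t k) \<le> (\<Sum>k<N. t k) + b N - b n + (\<Sum>k<n. d k) - (\<Sum>k<N. d k)" if "n \<ge> N" for n
    using that
  proof (induction n rule: dec_induct)
    case (step n)
    then show ?case using N[of n] by simp
  qed simp
  then have "(\<Sum>k<n. t k) \<le> (\<Sum>k<N. t k) + b N + 2 * M" if "n \<ge> N" for n
    using that b[of n] M[of n] M[of N] by (smt (verit))
  then show ?thesis unfolding eventually_sequentially by blast
qed

lemma filterlim_partial_sums_at_top:
  fixes lam :: "nat \<Rightarrow> real"
  assumes "\<And>n. 0 \<le> lam n" "\<not> summable lam"
  shows "filterlim (\<lambda>n. \<Sum>k\<le>n. lam k) at_top sequentially"
  unfolding filterlim_at_top
proof
  fix B :: real
  have "\<not> (\<forall>n. (\<Sum>k<n. lam k) \<le> B)"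
    using summableI_nonneg_bounded[of lam B] assms by blast
  then obtain n where n: "B < (\<Sum>k<n. lam k)" by (auto simp: not_le)
  show "\<forall>\<^sub>F n in sequentially. B \<le> (\<Sum>k\<le>n. lam k)"
    using eventually_ge_at_top[of n]
  proof eventually_elim
    case (elim m)
    then have "(\<Sum>k<n. lam k) \<le> (\<Sum>k\<le>m. lam k)" by (intro sum_mono2) (auto intro: assms)
    with n show ?case by simp
  qed
qed

text \<open>As for Cesaro means: the head of the sum is the fixed number \<open>A\<close>,
  negligible against the divergent weights, and the tail deviates by less than \<open>e / 2\<close>
  per unit of weight.\<close>

lemma weighted_average_tendsto:
  fixes lam a :: "nat \<Rightarrow> real"
  assumes lam: "\<And>n. 0 < lam n" "\<not> summable lam" and a: "a \<longlonglongrightarrow> l"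
  shows "(\<lambda>n. (\<Sum>k\<le>n. lam k * a k) / (\<Sum>k\<le>n. lam k)) \<longlonglongrightarrow> l"
proof (rule LIMSEQ_I)
  fix e :: real assume "e > 0"
  define \<tau> where "\<tau> n = (\<Sum>k\<le>n. lam k)" for n
  have \<tau>_pos: "\<tau> n > 0" for n unfolding \<tau>_def by (intro sum_pos lam) auto
  obtain N where N: "\<And>k. k \<ge> N \<Longrightarrow> \<bar>a k - l\<bar> < e / 2"
    using LIMSEQ_D[OF a, of "e / 2"] \<open>e > 0\<close> by auto
  define A where "A = (\<Sum>k<N. lam k * \<bar>a k - l\<bar>)"
  have "\<forall>\<^sub>F n in sequentially. 2 * A / e + 1 \<le> \<tau> n"
    using filterlim_partial_sums_at_top[of lam] lam unfolding \<tau>_def filterlim_at_top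
    by (meson less_imp_le)
  then obtain M where M: "\<And>n. n \<ge> M \<Longrightarrow> 2 * A / e + 1 \<le> \<tau> n"
    unfolding eventually_sequentially by blast
  show "\<exists>M. \<forall>n\<ge>M. norm ((\<Sum>k\<le>n. lam k * a k) / (\<Sum>k\<le>n. lam k) - l) < e"
  proof (rule exI[of _ "max M N"], intro allI impI)
    fix n assume n: "max M N \<le> n"
    have "2 * A / e < \<tau> n" using M[of n] n by simp
    then have A: "A < (e / 2) * \<tau> n" using \<open>e > 0\<close> by (simp add: field_simps)
    have "{..n} = {..<N} \<union> {N..n}" using n by auto
    then have split: "(\<Sum>k\<le>n. lam k * \<bar>a k - l\<bar>) = A + (\<Sum>k=N..n. lam k * \<bar>a k - l\<bar>)"
      unfolding A_def by (simp add: sum.union_disjoint ivl_disj_int)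
    have "(\<Sum>k=N..n. lam k * \<bar>a k - l\<bar>) \<le> (\<Sum>k=N..n. lam k * (e / 2))"
      using lam(1) N by (intro sum_mono mult_left_mono) (auto simp: less_imp_le)
    also have "\<dots> \<le> (\<Sum>k\<le>n. lam k * (e / 2))"
      using lam(1) \<open>e > 0\<close> by (intro sum_mono2) (auto simp: less_imp_le)
    also have "\<dots> = (e / 2) * \<tau> n" by (simp add: \<tau>_def sum_distrib_left mult.commute)
    finally have tail: "(\<Sum>k\<le>n. lam k * \<bar>a k - l\<bar>) < e * \<tau> n" using split A by simp
    have "\<bar>(\<Sum>k\<le>n. lam k * a k) - l * \<tau> n\<bar> = \<bar>\<Sum>k\<le>n. lam k * (a k - l)\<bar>"
      by (simp add: \<tau>_def sum_distrib_left algebra_simps sum_subtractf)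
    also have "\<dots> \<le> (\<Sum>k\<le>n. \<bar>lam k * (a k - l)\<bar>)" by (rule sum_abs)
    also have "\<dots> = (\<Sum>k\<le>n. lam k * \<bar>a k - l\<bar>)" using lam(1) by (simp add: abs_mult less_imp_le)
    also note tail
    finally have "\<bar>(\<Sum>k\<le>n. lam k * a k) - l * \<tau> n\<bar> / \<tau> n < e"
      using \<tau>_pos[of n] by (simp add: divide_less_eq)
    moreover have "(\<Sum>k\<le>n. lam k * a k) / \<tau> n - l = ((\<Sum>k\<le>n. lam k * a k) - l * \<tau> n) / \<tau> n"
      using \<tau>_pos[of n] by (simp add: diff_divide_distrib)
    ultimately show "norm ((\<Sum>k\<le>n. lam k * a k) / (\<Sum>k\<le>n. lam k) - l) < e"
      using \<tau>_pos[of n] unfolding \<tau>_def[symmetric] by simp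
  qed
qed

text \<open>An Opial--Passty lemma. The inner products with differences of points of \<open>F\<close> converge,
  so that any two weak cluster points of the averages, both in \<open>F\<close>, coincide.\<close>

lemma ergodic_weak_convergence:
  fixes X Z :: "nat \<Rightarrow> 'a::{real_inner, complete_space}" and lam :: "nat \<Rightarrow> real"
  assumes lam: "\<And>n. 0 < lam n" "\<not> summable lam"
    and Z: "\<And>n. Z n = (1 / (\<Sum>k\<le>n. lam k)) *\<^sub>R (\<Sum>k\<le>n. lam k *\<^sub>R X k)"
    and F: "F \<noteq> {}" "\<And>u. u \<in> F \<Longrightarrow> convergent (\<lambda>n. norm (X n - u))"
    and Gr: "\<And>u w. (u, w) \<in> Gr \<Longrightarrow> \<exists>c. \<forall>\<^sub>F n in sequentially. (\<Sum>k<n. lam k * (w \<bullet> (X k - u))) \<le> c"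
    and maximal: "\<And>z. (\<And>u w. (u, w) \<in> Gr \<Longrightarrow> w \<bullet> (z - u) \<le> 0) \<Longrightarrow> z \<in> F"
  shows "\<exists>z\<in>F. weakly_converges Z z"
proof -
  define \<tau> where "\<tau> n = (\<Sum>k\<le>n. lam k)" for n
  have \<tau>_pos: "\<tau> n > 0" for n unfolding \<tau>_def by (intro sum_pos lam) auto
  have \<tau>_lim: "filterlim \<tau> at_top sequentially"
    unfolding \<tau>_def by (intro filterlim_partial_sums_at_top lam less_imp_le)
  have inner_Z: "w \<bullet> Z n = (\<Sum>k\<le>n. lam k * (w \<bullet> X k)) / (\<Sum>k\<le>n. lam k)" for w n
    by (simp add: Z inner_sum_right)
  obtain u0 where "u0 \<in> F" using F(1) by blast
  then have "Bseq (\<lambda>n. norm (X n - u0))" by (intro convergent_imp_Bseq F)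
  then obtain B where B: "\<And>n. norm (X n - u0) \<le> B" unfolding Bseq_def by auto
  have X_bd: "norm (X n) \<le> B + norm u0" for n
    using norm_triangle_ineq[of "X n - u0" u0] B[of n] by simp
  have "norm (Z n) \<le> B + norm u0" for n
  proof -
    have "norm (\<Sum>k\<le>n. lam k *\<^sub>R X k) \<le> (\<Sum>k\<le>n. lam k * (B + norm u0))"
      using lam(1) X_bd by (intro sum_norm_le) (simp add: less_imp_le mult_left_mono)
    also have "\<dots> = \<tau> n * (B + norm u0)" by (simp add: \<tau>_def sum_distrib_right)
    finally show ?thesis unfolding Z \<tau>_def[symmetric] using \<tau>_pos[of n] by (simp add: field_simps)
  qed
  then have Z_bd: "bounded (range Z)" unfolding bounded_iff by blast

  \<comment> \<open>The bound in \<open>Gr\<close> is a constant for the unnormalised sums; divided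
    by \<open>\<tau> n\<close> it tends to 0, leaving the inequality demanded by
    \<open>maximal\<close>.\<close>
  have cluster_in_F: "z \<in> F"
    if r: "strict_mono r" and z: "\<And>w c. \<forall>\<^sub>F n in sequentially. w \<bullet> Z (r n) \<le> c \<Longrightarrow> w \<bullet> z \<le> c"
    for r :: "nat \<Rightarrow> nat" and z
  proof (rule maximal)
    fix u w assume "(u, w) \<in> Gr"
    from Gr[OF this] obtain c
      where c: "\<forall>\<^sub>F n in sequentially. (\<Sum>k<n. lam k * (w \<bullet> (X k - u))) \<le> c" by blast
    have "w \<bullet> z \<le> w \<bullet> u"
    proof (rule field_le_epsilon)
      fix e :: real assume "e > 0"
      have "\<forall>\<^sub>F n in sequentially. c / e \<le> \<tau> n" using \<tau>_lim by (simp add: filterlim_at_top)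
      moreover have "\<forall>\<^sub>F n in sequentially. (\<Sum>k<Suc n. lam k * (w \<bullet> (X k - u))) \<le> c"
        by (rule iffD2[OF eventually_sequentially_Suc[of "\<lambda>n. (\<Sum>k<n. lam k * (w \<bullet> (X k - u))) \<le> c"] c])
      ultimately have "\<forall>\<^sub>F n in sequentially. w \<bullet> Z n \<le> w \<bullet> u + e"
      proof eventually_elim
        case (elim n)
        have "(\<Sum>k\<le>n. lam k * (w \<bullet> X k)) - \<tau> n * (w \<bullet> u) \<le> c"
          using elim(2) by (simp add: lessThan_Suc_atMost inner_diff_right right_diff_distrib sum_subtractf
              \<tau>_def sum_distrib_right)
        also have "c \<le> e * \<tau> n" using elim(1) \<open>e > 0\<close> by (simp add: field_simps)
        finally show ?case unfolding inner_Z \<tau>_def[symmetric] using \<tau>_pos[of n] by (simp add: field_simps)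
      qed
      from eventually_subseq[OF r this] show "w \<bullet> z \<le> w \<bullet> u + e" by (rule z)
    qed
    then show "w \<bullet> (z - u) \<le> 0" by (simp add: inner_diff_right)
  qed
  \<comment> \<open>By polarisation these inner products are combinations of squared distances to
    \<open>u1\<close> and \<open>u2\<close>, which converge; weighted averaging keeps the
    limit.\<close>
  have diff_conv: "convergent (\<lambda>n. (u1 - u2) \<bullet> Z n)" if u: "u1 \<in> F" "u2 \<in> F" for u1 u2
  proof -
    have "convergent (\<lambda>n. (1/2) * (norm (X n - u2) * norm (X n - u2)
        - norm (X n - u1) * norm (X n - u1) + (norm u1)\<^sup>2 - (norm u2)\<^sup>2))"
      by (intro F(2) u convergent_mult convergent_add convergent_diff convergent_const)
    moreover have "(1/2) * (norm (X n - u2) * norm (X n - u2)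
        - norm (X n - u1) * norm (X n - u1) + (norm u1)\<^sup>2 - (norm u2)\<^sup>2) = (u1 - u2) \<bullet> X n" for n
      unfolding power2_eq_square[symmetric] power2_norm_eq_inner
      by (simp add: inner_simps inner_commute field_simps)
    ultimately have "convergent (\<lambda>n. (u1 - u2) \<bullet> X n)" by simp
    then obtain l where "(\<lambda>n. (u1 - u2) \<bullet> X n) \<longlonglongrightarrow> l" by (auto simp: convergent_def)
    then have "(\<lambda>n. (u1 - u2) \<bullet> Z n) \<longlonglongrightarrow> l" unfolding inner_Z by (rule weighted_average_tendsto[OF lam])
    then show ?thesis by (auto simp: convergent_def)
  qed
  have cluster_ex: "\<exists>z. z \<in> F \<and> (\<forall>w c. (\<forall>\<^sub>F n in sequentially. w \<bullet> Z (r n) \<le> c) \<longrightarrow> w \<bullet> z \<le> c)"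
    if r: "strict_mono r" for r :: "nat \<Rightarrow> nat"
  proof -
    have "bounded (range (Z \<circ> r))" by (rule bounded_subset[OF Z_bd]) auto
    then show ?thesis using weak_cluster_point_exists[of "Z \<circ> r"] cluster_in_F[OF r] by auto
  qed
  \<comment> \<open>A cluster point only inherits upper bounds, so equality comes from exchanging
    \<open>u1\<close> and \<open>u2\<close>.\<close>
  have cluster_lim: "(u1 - u2) \<bullet> z = lim (\<lambda>n. (u1 - u2) \<bullet> Z n)"
    if u: "u1 \<in> F" "u2 \<in> F" and r: "strict_mono r"
      and z: "\<forall>w c. (\<forall>\<^sub>F n in sequentially. w \<bullet> Z (r n) \<le> c) \<longrightarrow> w \<bullet> z \<le> c"
    for u1 u2 z and r :: "nat \<Rightarrow> nat"
  proof -
    have le: "(u1 - u2) \<bullet> z \<le> lim (\<lambda>n. (u1 - u2) \<bullet> Z n)" if u: "u1 \<in> F" "u2 \<in> F" for u1 u2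
    proof (rule field_le_epsilon)
      fix e :: real assume "e > 0"
      have "(\<lambda>n. (u1 - u2) \<bullet> Z n) \<longlonglongrightarrow> lim (\<lambda>n. (u1 - u2) \<bullet> Z n)"
        using diff_conv[OF u] by (simp add: convergent_LIMSEQ_iff)
      then have "\<forall>\<^sub>F n in sequentially. (u1 - u2) \<bullet> Z n < lim (\<lambda>n. (u1 - u2) \<bullet> Z n) + e"
        using \<open>e > 0\<close> by (intro order_tendstoD) auto
      then have "\<forall>\<^sub>F n in sequentially. (u1 - u2) \<bullet> Z n \<le> lim (\<lambda>n. (u1 - u2) \<bullet> Z n) + e"
        by eventually_elim simp
      from eventually_subseq[OF r this] show "(u1 - u2) \<bullet> z \<le> lim (\<lambda>n. (u1 - u2) \<bullet> Z n) + e"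
        using z by blast
    qed
    have lim_neg: "lim (\<lambda>n. (u2 - u1) \<bullet> Z n) = - lim (\<lambda>n. (u1 - u2) \<bullet> Z n)"
    proof (rule limI)
      have "(\<lambda>n. (u1 - u2) \<bullet> Z n) \<longlonglongrightarrow> lim (\<lambda>n. (u1 - u2) \<bullet> Z n)"
        using diff_conv[OF u] by (simp add: convergent_LIMSEQ_iff)
      then have "(\<lambda>n. - ((u1 - u2) \<bullet> Z n)) \<longlonglongrightarrow> - lim (\<lambda>n. (u1 - u2) \<bullet> Z n)" by (rule tendsto_minus)
      then show "(\<lambda>n. (u2 - u1) \<bullet> Z n) \<longlonglongrightarrow> - lim (\<lambda>n. (u1 - u2) \<bullet> Z n)"
        by (simp add: inner_diff_left)
    qed
    show ?thesis using le[OF u] le[OF u(2,1)] lim_neg by (simp add: inner_diff_left)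
  qed
  obtain z where z: "z \<in> F" "\<forall>w c. (\<forall>\<^sub>F n in sequentially. w \<bullet> Z (id n) \<le> c) \<longrightarrow> w \<bullet> z \<le> c"
    using cluster_ex[of id] by (auto simp: strict_mono_def)
  have unique: "z' = z" if z': "z' \<in> F" and r: "strict_mono r"
    and cl: "\<forall>w c. (\<forall>\<^sub>F n in sequentially. w \<bullet> Z (r n) \<le> c) \<longrightarrow> w \<bullet> z' \<le> c" for z' and r :: "nat \<Rightarrow> nat"
  proof -
    have "(z' - z) \<bullet> z' = (z' - z) \<bullet> z"
      using cluster_lim[OF z' z(1) r cl] cluster_lim[OF z' z(1) _ z(2)] by (simp add: strict_mono_def)
    then have "(z' - z) \<bullet> (z' - z) = 0" by (simp add: inner_diff_right)
    then show ?thesis by simp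
  qed
  \<comment> \<open>A subsequence violating the bound would have its own cluster point, which must
    be \<open>z\<close> again, although it stays on the wrong side of the half-space.\<close>
  have upper: "\<forall>\<^sub>F n in sequentially. w \<bullet> Z n < c" if c: "w \<bullet> z < c" for w c
  proof (rule ccontr)
    assume "\<not> ?thesis"
    then obtain r :: "nat \<Rightarrow> nat" where r: "strict_mono r" "\<And>n. \<not> w \<bullet> Z (r n) < c"
      using not_eventually_sequentiallyD by blast
    obtain z' where z': "z' \<in> F" "\<forall>w c. (\<forall>\<^sub>F n in sequentially. w \<bullet> Z (r n) \<le> c) \<longrightarrow> w \<bullet> z' \<le> c"
      using cluster_ex[OF r(1)] by blast
    have "\<forall>\<^sub>F n in sequentially. (- w) \<bullet> Z (r n) \<le> - c" using r(2) by (simp add: not_less)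
    then have "(- w) \<bullet> z' \<le> - c" using z'(2) by blast
    with unique[OF z'(1) r(1) z'(2)] c show False by simp
  qed
  have "(\<lambda>n. Z n \<bullet> w) \<longlonglongrightarrow> z \<bullet> w" for w
  proof (rule order_tendstoI)
    fix c assume "z \<bullet> w < c"
    then show "\<forall>\<^sub>F n in sequentially. Z n \<bullet> w < c" using upper[of w c] by (simp add: inner_commute)
  next
    fix c assume "c < z \<bullet> w"
    then show "\<forall>\<^sub>F n in sequentially. c < Z n \<bullet> w"
      using upper[of "- w" "- c"] by (simp add: inner_commute)
  qed
  then show ?thesis using z(1) unfolding weakly_converges_def by blast
qed

text \<open>Popov's form of the extragradient method: step \<open>n\<close> produces
  \<open>P (Suc n)\<close> with operators evaluated at the old \<open>P n\<close> and then corrects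
  it to \<open>X (Suc n)\<close>. The correction is bounded by the change in \<open>P\<close>, which
  is all that the distance estimates use of the operators.\<close>

locale past_extragradient =
  fixes X P :: "nat \<Rightarrow> 'a::real_inner" and \<kappa> :: real
  assumes \<kappa>: "0 \<le> \<kappa>" "\<kappa> < 1 / 2"
    and contract: "\<forall>\<^sub>F n in sequentially. norm (X (Suc n) - P (Suc n)) \<le> \<kappa> * norm (P (Suc n) - P n)"
begin

text \<open>The factor 2 comes from splitting \<open>P (Suc n) - P n\<close> at \<open>X n\<close>
  and bounding the squared norm of a sum by twice the sum of the squares.\<close>

definition \<theta> :: real where "\<theta> = 2 * \<kappa>\<^sup>2"

text \<open>The weight \<open>c\<close> solves \<open>(1 + c) * \<theta> = c\<close>, which lets the gap recursion telescope; \<open>c < 1\<close>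
  amounts to \<open>\<kappa> < 1 / 2\<close>.\<close>

definition c :: real where "c = \<theta> / (1 - \<theta>)"

definition lyapunov :: "'a \<Rightarrow> nat \<Rightarrow> real"
  where "lyapunov u n = (norm (X n - u))\<^sup>2 + c * (norm (X n - P n))\<^sup>2"

lemma \<theta>: "0 \<le> \<theta>" "\<theta> < 1 / 2"
proof -
  have "\<kappa> * \<kappa> \<le> \<kappa> * (1/2)" using \<kappa> by (intro mult_left_mono) auto
  then show "0 \<le> \<theta>" "\<theta> < 1 / 2" using \<kappa> unfolding \<theta>_def power2_eq_square by auto
qed

lemma c: "0 \<le> c" "c < 1" "c * (1 - \<theta>) = \<theta>"
  using \<theta> by (auto simp: c_def divide_less_eq)

lemma lyapunov_nonneg: "0 \<le> lyapunov u n"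
  using c by (simp add: lyapunov_def)

lemma gap_recursion:
  "\<forall>\<^sub>F n in sequentially. (norm (X (Suc n) - P (Suc n)))\<^sup>2
     \<le> \<theta> * ((norm (X n - P (Suc n)))\<^sup>2 + (norm (X n - P n))\<^sup>2)"
  using contract
proof eventually_elim
  case (elim n)
  have "(norm (X (Suc n) - P (Suc n)))\<^sup>2 \<le> (\<kappa> * norm (P (Suc n) - P n))\<^sup>2"
    using elim by (intro power_mono) auto
  also have "\<dots> = \<kappa>\<^sup>2 * (norm (P (Suc n) - P n))\<^sup>2" by (simp add: power_mult_distrib)
  also have "\<dots> \<le> \<kappa>\<^sup>2 * (2 * ((norm (X n - P (Suc n)))\<^sup>2 + (norm (X n - P n))\<^sup>2))"
  proof (rule mult_left_mono)
    have "0 \<le> (norm ((X n - P (Suc n)) + (X n - P n)))\<^sup>2" by simp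
    then show "(norm (P (Suc n) - P n))\<^sup>2 \<le> 2 * ((norm (X n - P (Suc n)))\<^sup>2 + (norm (X n - P n))\<^sup>2)"
      unfolding power2_norm_eq_inner by (simp add: inner_simps inner_commute algebra_simps)
  qed simp
  finally show ?case by (simp add: \<theta>_def algebra_simps)
qed

lemma lyapunov_decrease:
  "\<forall>\<^sub>F n in sequentially. lyapunov u (Suc n) + (1 - c) * (norm (X n - P (Suc n)))\<^sup>2
     + 2 * ((X n - X (Suc n)) \<bullet> (P (Suc n) - u)) \<le> lyapunov u n"
  using gap_recursion
proof eventually_elim
  case (elim n)
  define e e' s where "e = (norm (X n - P n))\<^sup>2" and "e' = (norm (X (Suc n) - P (Suc n)))\<^sup>2"
    and "s = (norm (X n - P (Suc n)))\<^sup>2"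
  \<comment> \<open>Only the new gap \<open>e'\<close> has the wrong sign. With its copy in the
    Lyapunov function it totals \<open>(1 + c) * e'\<close>, at most \<open>c * (s + e)\<close>: the
    part \<open>c * e\<close> is already present at index \<open>n\<close>, and
    \<open>(1 - c) * s\<close> remains as surplus.\<close>
  have id: "(norm (X (Suc n) - u))\<^sup>2
      = (norm (X n - u))\<^sup>2 - 2 * ((X n - X (Suc n)) \<bullet> (P (Suc n) - u)) + e' - s"
    unfolding e'_def s_def power2_norm_eq_inner by (simp add: inner_simps inner_commute)
  have "(1 + c) * e' \<le> (1 + c) * (\<theta> * (s + e))"
    using elim c unfolding e_def e'_def s_def by (intro mult_left_mono) auto
  also have "\<dots> = ((1 + c) * \<theta>) * (s + e)" by simp
  also have "(1 + c) * \<theta> = c" using c(3) by (simp add: algebra_simps)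
  finally have "(1 + c) * e' \<le> c * (s + e)" .
  then show ?case unfolding lyapunov_def id e_def[symmetric] s_def[symmetric] e'_def[symmetric]
    by (simp add: algebra_simps)
qed

lemma fejer_convergence:
  assumes r: "\<And>n. 0 \<le> r n" and eps: "summable eps"
    and mono: "\<And>n. r n - eps n \<le> (X n - X (Suc n)) \<bullet> (P (Suc n) - u)"
  shows "convergent (\<lambda>n. norm (X n - u))" "summable (\<lambda>n. (norm (X n - P (Suc n)))\<^sup>2)" "summable r"
proof -
  define s where "s n = (norm (X n - P (Suc n)))\<^sup>2" for n
  have dec: "\<forall>\<^sub>F n in sequentially. lyapunov u (Suc n) + ((1 - c) * s n + 2 * r n) \<le> lyapunov u n + 2 * eps n"
    using lyapunov_decrease[of u] by eventually_elim (use mono in \<open>smt (verit) s_def\<close>)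
  have nn: "0 \<le> (1 - c) * s n + 2 * r n" for n using c r[of n] by (simp add: s_def)
  have conv: "convergent (lyapunov u)" and sm: "summable (\<lambda>n. (1 - c) * s n + 2 * r n)"
    using almost_decreasing_convergent[OF lyapunov_nonneg nn summable_mult[OF eps] dec] by auto
  have "summable (\<lambda>n. (1 - c) * s n)"
    by (rule summable_comparison_test'[OF sm]) (use c r in \<open>simp add: s_def\<close>)
  then have ss: "summable s" by (rule summable_mult_D) (use c in simp)
  then show "summable (\<lambda>n. (norm (X n - P (Suc n)))\<^sup>2)" by (simp add: s_def[abs_def])
  have "summable (\<lambda>n. 2 * r n)"
    by (rule summable_comparison_test'[OF sm]) (use c r in \<open>simp add: s_def\<close>)
  then show "summable r" by (rule summable_mult_D) simp
  \<comment> \<open>To pass from the Lyapunov function to the distance, the gap must vanish. The gap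
    recursion is itself almost decreasing, with summable error
    \<open>\<theta> * s n\<close>.\<close>
  define e where "e n = (norm (X n - P n))\<^sup>2" for n
  have "\<forall>\<^sub>F n in sequentially. e (Suc n) + (1 - \<theta>) * e n \<le> e n + \<theta> * s n"
    using gap_recursion by eventually_elim (simp add: e_def s_def algebra_simps)
  then have "summable (\<lambda>n. (1 - \<theta>) * e n)"
    using \<theta> by (intro almost_decreasing_convergent(2)[OF _ _ summable_mult[OF ss]]) (auto simp: e_def)
  then have "summable e" by (rule summable_mult_D) (use \<theta> in simp)
  then have "e \<longlonglongrightarrow> 0" by (rule summable_LIMSEQ_zero)
  then have "convergent (\<lambda>n. c * e n)" by (intro convergent_mult convergent_const) (auto simp: convergent_def)
  from convergent_diff[OF conv this] have "convergent (\<lambda>n. (norm (X n - u))\<^sup>2)"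
    by (simp add: lyapunov_def e_def)
  then obtain l where "(\<lambda>n. (norm (X n - u))\<^sup>2) \<longlonglongrightarrow> l" by (auto simp: convergent_def)
  then have "(\<lambda>n. sqrt ((norm (X n - u))\<^sup>2)) \<longlonglongrightarrow> sqrt l" by (rule tendsto_real_sqrt)
  then show "convergent (\<lambda>n. norm (X n - u))" by (auto simp: convergent_def)
qed

text \<open>The descent inequality controls inner products at \<open>P (Suc n)\<close>. Replacing it
  by \<open>X n\<close> costs a product of \<open>lam n\<close> and a gap, summable by Young's
  inequality since both are square-summable.\<close>

lemma ergodic_sum_bounded:
  fixes lam :: "nat \<Rightarrow> real"
  assumes s: "summable (\<lambda>n. (norm (X n - P (Suc n)))\<^sup>2)" and lam: "\<And>n. 0 \<le> lam n" "summable (\<lambda>n. (lam n)\<^sup>2)"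
    and eps: "summable eps"
    and mono: "\<And>n. lam n * (w \<bullet> (P (Suc n) - u)) - eps n \<le> (X n - X (Suc n)) \<bullet> (P (Suc n) - u)"
  shows "\<exists>b. \<forall>\<^sub>F n in sequentially. (\<Sum>k<n. lam k * (w \<bullet> (X k - u))) \<le> b"
proof (rule telescoping_sum_bounded)
  define d where "d n = eps n + ((norm w)\<^sup>2 * (lam n)\<^sup>2 + (norm (X n - P (Suc n)))\<^sup>2) / 2" for n
  show "summable d" unfolding d_def by (intro summable_add summable_divide summable_mult s lam eps)
  show "0 \<le> lyapunov u n / 2" for n using lyapunov_nonneg by simp
  show "\<forall>\<^sub>F n in sequentially. lam n * (w \<bullet> (X n - u)) \<le> lyapunov u n / 2 - lyapunov u (Suc n) / 2 + d n"
    using lyapunov_decrease[of u]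
  proof eventually_elim
    case (elim n)
    have "lam n * (w \<bullet> (X n - P (Suc n))) \<le> ((norm w)\<^sup>2 * (lam n)\<^sup>2 + (norm (X n - P (Suc n)))\<^sup>2) / 2"
    proof -
      have "0 \<le> (norm (lam n *\<^sub>R w - (X n - P (Suc n))))\<^sup>2" by simp
      also have "\<dots> = (lam n)\<^sup>2 * (norm w)\<^sup>2 + (norm (X n - P (Suc n)))\<^sup>2 - 2 * (lam n * (w \<bullet> (X n - P (Suc n))))"
        unfolding power2_norm_eq_inner by (simp add: inner_diff_left inner_diff_right inner_commute power2_eq_square algebra_simps)
      finally show ?thesis by (simp add: mult.commute)
    qed
    moreover have "lam n * (w \<bullet> (X n - u)) = lam n * (w \<bullet> (X n - P (Suc n))) + lam n * (w \<bullet> (P (Suc n) - u))"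
      by (simp add: inner_diff_right algebra_simps)
    moreover have "0 \<le> (1 - c) * (norm (X n - P (Suc n)))\<^sup>2" using c by simp
    ultimately show ?case using elim mono[of n] unfolding d_def by argo
  qed
qed

text \<open>The distances to \<open>u\<close> converge. A positive limit would keep
  \<open>P (Suc n)\<close> away from \<open>u\<close>, so \<open>lam\<close> would be dominated by a
  multiple of the summable \<open>r\<close>, contradicting divergence of its series.\<close>

lemma strong_convergence:
  fixes lam :: "nat \<Rightarrow> real"
  assumes lam: "\<And>n. 0 < lam n" "\<not> summable lam" and \<gamma>: "\<gamma> > 0" and eps: "summable eps"
    and mono: "\<And>n. lam n * (\<gamma> * (norm (P (Suc n) - u))\<^sup>2) - eps n \<le> (X n - X (Suc n)) \<bullet> (P (Suc n) - u)"
  shows "X \<longlonglongrightarrow> u"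
proof -
  define r where "r n = lam n * (\<gamma> * (norm (P (Suc n) - u))\<^sup>2)" for n
  have r: "0 \<le> r n" for n using lam(1)[of n] \<gamma> by (simp add: r_def)
  note fc = fejer_convergence[OF r eps mono[folded r_def]]
  obtain l where l: "(\<lambda>n. norm (X n - u)) \<longlonglongrightarrow> l" using fc(1) by (auto simp: convergent_def)
  have "l \<ge> 0" by (rule LIMSEQ_le_const[OF l]) auto
  have "(\<lambda>n. sqrt ((norm (X n - P (Suc n)))\<^sup>2)) \<longlonglongrightarrow> sqrt 0"
    by (intro tendsto_real_sqrt summable_LIMSEQ_zero fc(2))
  then have "(\<lambda>n. norm (X n - u) - norm (X n - P (Suc n))) \<longlonglongrightarrow> l - 0" by (intro tendsto_diff l) simp
  have "\<not> l > 0"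
  proof
    assume "l > 0"
    then have "\<forall>\<^sub>F n in sequentially. l / 2 < norm (X n - u) - norm (X n - P (Suc n))"
      using \<open>_ \<longlonglongrightarrow> l - 0\<close> by (intro order_tendstoD(1)[where y = "l - 0"]) auto
    then have "\<forall>\<^sub>F n in sequentially. norm (lam n) \<le> (4 / (\<gamma> * l\<^sup>2)) * r n"
    proof eventually_elim
      case (elim n)
      have "norm (X n - u) \<le> norm (X n - P (Suc n)) + norm (P (Suc n) - u)"
        using norm_triangle_ineq[of "X n - P (Suc n)" "P (Suc n) - u"] by simp
      with elim have "l / 2 \<le> norm (P (Suc n) - u)" by simp
      then have "(l / 2)\<^sup>2 \<le> (norm (P (Suc n) - u))\<^sup>2" using \<open>l > 0\<close> by (intro power_mono) auto
      then have "lam n * (\<gamma> * (l / 2)\<^sup>2) \<le> r n"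
        unfolding r_def using lam(1)[of n] \<gamma> by (intro mult_left_mono) auto
      then show ?case using lam(1)[of n] \<gamma> \<open>l > 0\<close> by (simp add: field_simps power2_eq_square)
    qed
    then have "summable lam" by (rule summable_comparison_test_ev) (intro summable_mult fc(3))
    with lam(2) show False ..
  qed
  with \<open>l \<ge> 0\<close> l have "(\<lambda>n. norm (X n - u)) \<longlonglongrightarrow> 0" by simp
  then show ?thesis by (simp add: tendsto_norm_zero_iff LIM_zero_iff)
qed

end

section \<open>The primal-dual inclusion\<close>

lemma directional_derivative_tendsto:
  assumes "GDERIV h w :> g"
  shows "((\<lambda>t. (h (w + t *\<^sub>R d) - h w) / t) \<longlongrightarrow> g \<bullet> d) (at_right 0)"
proof -
  have "((\<lambda>t. w + t *\<^sub>R d) has_derivative (\<lambda>t. t *\<^sub>R d)) (at 0)"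
    by (auto intro!: derivative_eq_intros)
  moreover have "(h has_derivative (\<lambda>k. k \<bullet> g)) (at (w + 0 *\<^sub>R d))"
    using assms by (simp add: gderiv_def)
  ultimately have "((\<lambda>t. h (w + t *\<^sub>R d)) has_derivative (\<lambda>t. (t *\<^sub>R d) \<bullet> g)) (at 0)"
    by (rule has_derivative_compose)
  then have "((\<lambda>t. h (w + t *\<^sub>R d)) has_real_derivative (g \<bullet> d)) (at 0)"
    by (simp add: has_field_derivative_def inner_commute mult_commute_abs)
  then have "((\<lambda>t. (h (w + t *\<^sub>R d) - h w) / t) \<longlongrightarrow> g \<bullet> d) (at 0)"
    by (simp add: has_field_derivative_iff)
  then show ?thesis by (rule tendsto_within_subset[OF _ subset_UNIV])
qed

lemma convex_gradient_inequality:
  fixes h :: "'a::real_inner \<Rightarrow> real"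
  assumes "convex_on UNIV h" "GDERIV h w :> g"
  shows "h w + g \<bullet> (y - w) \<le> h y"
proof -
  have "\<forall>\<^sub>F t in at_right 0. (h (w + t *\<^sub>R (y - w)) - h w) / t \<le> h y - h w"
  proof (rule eventually_at_rightI[of 0 1])
    fix t :: real assume t: "t \<in> {0<..<1}"
    have "h ((1 - t) *\<^sub>R w + t *\<^sub>R y) \<le> (1 - t) * h w + t * h y"
      using t by (intro convex_onD[OF assms(1)]) auto
    moreover have "(1 - t) *\<^sub>R w + t *\<^sub>R y = w + t *\<^sub>R (y - w)" by (simp add: algebra_simps)
    ultimately have "h (w + t *\<^sub>R (y - w)) \<le> (1 - t) * h w + t * h y" by metis
    then show "(h (w + t *\<^sub>R (y - w)) - h w) / t \<le> h y - h w"
      using t by (simp add: pos_divide_le_eq left_diff_distrib right_diff_distrib mult.commute)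
  qed simp
  from tendsto_upperbound[OF directional_derivative_tendsto[OF assms(2)] this]
  show ?thesis by simp
qed

lemma convex_gradient_monotone:
  fixes h :: "'a::real_inner \<Rightarrow> real"
  assumes "convex_on UNIV h" "\<And>w. GDERIV h w :> grad w"
  shows "0 \<le> (grad x - grad y) \<bullet> (x - y)"
  using convex_gradient_inequality[OF assms(1) assms(2)[of x], of y]
    convex_gradient_inequality[OF assms(1) assms(2)[of y], of x]
  by (simp add: inner_simps)

text \<open>Testing the subgradient inequality at points of the segment that tend to
  \<open>x\<close> sharpens it by half the modulus times the squared distance; adding the sharpened
  inequalities at \<open>x\<close> and \<open>y\<close> gives the full modulus.\<close>

lemma strongly_econvex_epi_subgrad_monotone:
  assumes X: "convex X" and g: "\<And>y. y \<in> X \<Longrightarrow> g y \<noteq> -\<infinity>"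
    and strong: "\<forall>x\<in>X. \<forall>y\<in>X. \<forall>t\<in>{0<..<1}.
       g ((1 - t) *\<^sub>R x + t *\<^sub>R y) + ereal (\<gamma> / 2 * t * (1 - t) * (norm (x - y))\<^sup>2)
         \<le> ereal (1 - t) * g x + ereal t * g y"
    and sub: "(x, u) \<in> epi_subgrad (epi_on X g)" "(y, v) \<in> epi_subgrad (epi_on X g)"
  shows "\<gamma> * (norm (x - y))\<^sup>2 \<le> (u - v) \<bullet> (x - y)"
proof -
  have growth: "s + u \<bullet> (y - x) + \<gamma> / 2 * (norm (x - y))\<^sup>2 \<le> r"
    if x: "x \<in> X" "g x = ereal s" "\<And>y. y \<in> X \<Longrightarrow> ereal (s + u \<bullet> (y - x)) \<le> g y"
      and y: "y \<in> X" "g y = ereal r" for x y u s r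
  proof -
    have "0 \<le> r - s - u \<bullet> (y - x) - \<gamma> / 2 * (norm (x - y))\<^sup>2"
    proof (rule nonneg_of_quadratic_perturbation)
      fix t :: real assume t: "0 < t" "t < 1"
      define G where "G = \<gamma> / 2 * (norm (x - y))\<^sup>2"
      have mem: "(1 - t) *\<^sub>R x + t *\<^sub>R y \<in> X" using X x(1) y(1) t by (intro convexD) auto
      have eq: "(1 - t) *\<^sub>R x + t *\<^sub>R y - x = t *\<^sub>R (y - x)" by (simp add: algebra_simps)
      have "ereal (s + t * (u \<bullet> (y - x))) + ereal (\<gamma> / 2 * t * (1 - t) * (norm (x - y))\<^sup>2)
          \<le> g ((1 - t) *\<^sub>R x + t *\<^sub>R y) + ereal (\<gamma> / 2 * t * (1 - t) * (norm (x - y))\<^sup>2)"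
        using x(3)[OF mem] unfolding eq by (intro add_right_mono) simp
      also have "\<dots> \<le> ereal (1 - t) * g x + ereal t * g y" using strong x(1) y(1) t by auto
      also have "\<gamma> / 2 * t * (1 - t) * (norm (x - y))\<^sup>2 = t * (1 - t) * G" by (simp add: G_def)
      finally have "s + t * (u \<bullet> (y - x)) + t * (1 - t) * G \<le> (1 - t) * s + t * r"
        using x(2) y(2) by simp
      then show "0 \<le> t * (r - s - u \<bullet> (y - x) - \<gamma> / 2 * (norm (x - y))\<^sup>2)
          + t\<^sup>2 * (\<gamma> / 2 * (norm (x - y))\<^sup>2)"
        unfolding G_def[symmetric] by (simp add: algebra_simps power2_eq_square)
    qed
    then show ?thesis by simp
  qed
  obtain s where s: "x \<in> X" "g x = ereal s" "\<And>y. y \<in> X \<Longrightarrow> ereal (s + u \<bullet> (y - x)) \<le> g y"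
    using epi_subgrad_epi_onD[OF sub(1) g] by blast
  obtain r where r: "y \<in> X" "g y = ereal r" "\<And>x. x \<in> X \<Longrightarrow> ereal (r + v \<bullet> (x - y)) \<le> g x"
    using epi_subgrad_epi_onD[OF sub(2) g] by blast
  show ?thesis using growth[OF s r(1,2)] growth[OF r s(1,2)]
    by (simp add: inner_simps norm_minus_commute)
qed

lemma norm_vec_le_sum: "norm (v :: 'a::real_inner ^ 'm::finite) \<le> (\<Sum>i\<in>UNIV. norm (v $ i))"
  unfolding norm_vec_def by (rule L2_set_le_sum) auto

lemma bounded_linear_vec_lambda:
  fixes T :: "'m::finite \<Rightarrow> 'a::real_normed_vector \<Rightarrow> 'b::real_inner"
  assumes "\<And>i. bounded_linear (T i)"
  shows "bounded_linear (\<lambda>x. \<chi> i. T i x)"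
proof (rule bounded_linear_intro[where K = "\<Sum>i\<in>UNIV. onorm (T i)"])
  fix x y :: 'a and r :: real
  show "(\<chi> i. T i (x + y)) = (\<chi> i. T i x) + (\<chi> i. T i y)"
    by (simp add: vec_eq_iff linear_add[OF bounded_linear.linear[OF assms]])
  show "(\<chi> i. T i (r *\<^sub>R x)) = r *\<^sub>R (\<chi> i. T i x)"
    by (simp add: vec_eq_iff linear_scale[OF bounded_linear.linear[OF assms]])
  have "norm (\<chi> i. T i x) \<le> (\<Sum>i\<in>UNIV. norm (T i x))"
    using norm_vec_le_sum[of "\<chi> i. T i x"] by simp
  also have "\<dots> \<le> (\<Sum>i\<in>UNIV. onorm (T i) * norm x)" by (intro sum_mono onorm assms)
  finally show "norm (\<chi> i. T i x) \<le> norm x * (\<Sum>i\<in>UNIV. onorm (T i))"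
    by (simp add: sum_distrib_left mult.commute)
qed

lemma adjoint_diff:
  fixes T :: "'a::{real_inner, complete_space} \<Rightarrow> 'b::real_inner"
  assumes "bounded_linear T"
  shows "adjoint T (y - z) = adjoint T y - adjoint T z"
proof -
  have "x \<bullet> adjoint T (y - z) = x \<bullet> (adjoint T y - adjoint T z)" for x
    by (simp add: inner_diff_right adjoint_inner[OF assms])
  then show ?thesis using vector_eq_ldot by blast
qed

text \<open>\<open>E\<close> will be the epigraph of \<open>f\<close> over \<open>C\<close>, so the
  constraint belongs to the subdifferential part and the limit inclusion contains no
  penalty.\<close>

locale primal_dual =
  fixes E :: "('h::{real_inner, complete_space} \<times> real) set"
    and Eg :: "'m::finite \<Rightarrow> ('g::{real_inner, complete_space} \<times> real) set"
    and grad :: "'h \<Rightarrow> 'h" and L :: "'m \<Rightarrow> 'h \<Rightarrow> 'g" and \<nu> :: real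
  assumes E: "proper_epi E" and Eg: "\<And>i. proper_epi (Eg i)"
    and L: "\<And>i. bounded_linear (L i)"
    and grad_mono: "\<And>x y. 0 \<le> (grad x - grad y) \<bullet> (x - y)"
    and grad_lip: "\<And>x y. norm (grad x - grad y) \<le> \<nu> * norm (x - y)" and \<nu>: "0 \<le> \<nu>"
begin

definition skew :: "'h \<times> ('g ^ 'm) \<Rightarrow> 'h \<times> ('g ^ 'm)"
  where "skew p = (\<Sum>i\<in>UNIV. adjoint (L i) (snd p $ i), \<chi> i. - L i (fst p))"

definition D :: "'h \<times> ('g ^ 'm) \<Rightarrow> 'h \<times> ('g ^ 'm)"
  where "D p = (grad (fst p), 0) + skew p"

definition \<Lambda> :: real where "\<Lambda> = sqrt (\<Sum>i\<in>UNIV. (onorm (L i))\<^sup>2)"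

text \<open>The dual components carry the inverse of the subdifferential of \<open>g\<^sub>i\<close>. It is the
  subdifferential of the conjugate, but phrased through \<open>g\<^sub>i\<close> it needs no biconjugation theorem.\<close>

definition maximal_graph :: "(('h \<times> ('g ^ 'm)) \<times> ('h \<times> ('g ^ 'm))) set"
  where "maximal_graph = {(u, m). (fst u, fst m) \<in> epi_subgrad E \<and>
      (\<forall>i. (snd m $ i, snd u $ i) \<in> epi_subgrad (Eg i))}"

definition graph :: "(('h \<times> ('g ^ 'm)) \<times> ('h \<times> ('g ^ 'm))) set"
  where "graph = {(u, m + D u) | u m. (u, m) \<in> maximal_graph}"

definition zeros :: "('h \<times> ('g ^ 'm)) set"
  where "zeros = {u. (u, - D u) \<in> maximal_graph}"

text \<open>These are the Karush--Kuhn--Tucker conditions, with \<open>snd u\<close> as the vector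
  of multipliers.\<close>

lemma mem_zeros_iff:
  "u \<in> zeros \<longleftrightarrow>
    (fst u, - (grad (fst u) + (\<Sum>i\<in>UNIV. adjoint (L i) (snd u $ i)))) \<in> epi_subgrad E \<and>
    (\<forall>i. (L i (fst u), snd u $ i) \<in> epi_subgrad (Eg i))"
  by (simp add: zeros_def maximal_graph_def D_def skew_def)

lemma skew_diff: "skew p - skew q = skew (p - q)"
  by (simp add: skew_def vec_eq_iff adjoint_diff[OF L] sum_subtractf linear_diff[OF bounded_linear.linear[OF L]])

lemma skew_inner: "skew p \<bullet> p = 0"
  by (simp add: skew_def inner_prod_def inner_vec_def inner_sum_left adjoint_inner[OF L]
      inner_commute[of "adjoint _ _"] sum_negf)

lemma \<Lambda>_eq: "\<Lambda> = L2_set (\<lambda>i. onorm (L i)) UNIV"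
  by (simp add: \<Lambda>_def L2_set_def)

lemma \<Lambda>_nonneg: "0 \<le> \<Lambda>"
  by (simp add: \<Lambda>_def sum_nonneg)

text \<open>The coupling exchanges the two components, and each is enlarged by at most
  \<open>\<Lambda>\<close>, by Cauchy--Schwarz over the index in the primal component; the squares
  then add up.\<close>

lemma norm_skew_le: "norm (skew p) \<le> \<Lambda> * norm p"
proof -
  have "norm (\<Sum>i\<in>UNIV. adjoint (L i) (snd p $ i)) \<le> (\<Sum>i\<in>UNIV. \<bar>onorm (L i)\<bar> * \<bar>norm (snd p $ i)\<bar>)"
    using norm_adjoint_le[OF L] onorm_pos_le[OF L] by (intro sum_norm_le) simp
  also have "\<dots> \<le> \<Lambda> * norm (snd p)"
    unfolding \<Lambda>_eq norm_vec_def by (rule L2_set_mult_ineq)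
  finally have 1: "norm (\<Sum>i\<in>UNIV. adjoint (L i) (snd p $ i)) \<le> \<Lambda> * norm (snd p)" .
  have "norm (\<chi> i. - L i (fst p)) = L2_set (\<lambda>i. norm (L i (fst p))) UNIV"
    by (simp add: norm_vec_def)
  also have "\<dots> \<le> L2_set (\<lambda>i. onorm (L i) * norm (fst p)) UNIV"
    by (intro L2_set_mono onorm L) auto
  also have "\<dots> = \<Lambda> * norm (fst p)" unfolding \<Lambda>_eq by (simp add: L2_set_left_distrib)
  finally have 2: "norm (\<chi> i. - L i (fst p)) \<le> \<Lambda> * norm (fst p)" .
  have "(norm (skew p))\<^sup>2 \<le> (\<Lambda> * norm (snd p))\<^sup>2 + (\<Lambda> * norm (fst p))\<^sup>2"
    unfolding skew_def norm_prod_def using 1 2 by (simp add: add_mono power_mono)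
  also have "\<dots> = (\<Lambda> * norm p)\<^sup>2"
    by (simp add: norm_prod_def power_mult_distrib algebra_simps)
  finally show ?thesis by (rule power2_le_imp_le) (simp add: \<Lambda>_nonneg)
qed

lemma norm_fst_le_norm: "norm (fst p) \<le> norm p"
  by (metis norm_fst_le prod.collapse)

lemma D_monotone: "0 \<le> (D p - D q) \<bullet> (p - q)"
proof -
  have "D p - D q = (grad (fst p) - grad (fst q), 0) + skew (p - q)"
    by (simp add: D_def flip: skew_diff)
  then have "(D p - D q) \<bullet> (p - q) = (grad (fst p) - grad (fst q)) \<bullet> (fst p - fst q)"
    by (simp add: inner_add_left skew_inner) (simp add: inner_prod_def)
  then show ?thesis using grad_mono by simp
qed

lemma D_lipschitz: "norm (D p - D q) \<le> (\<nu> + \<Lambda>) * norm (p - q)"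
proof -
  have "D p - D q = (grad (fst p) - grad (fst q), 0) + skew (p - q)"
    by (simp add: D_def flip: skew_diff)
  then have "norm (D p - D q) \<le> norm (grad (fst p) - grad (fst q), 0 :: 'g ^ 'm) + norm (skew (p - q))"
    using norm_triangle_ineq by metis
  also have "\<dots> \<le> \<nu> * norm (fst (p - q)) + \<Lambda> * norm (p - q)"
    using grad_lip norm_skew_le by (intro add_mono) (auto simp: norm_Pair)
  also have "\<dots> \<le> \<nu> * norm (p - q) + \<Lambda> * norm (p - q)"
    using \<nu> norm_fst_le_norm by (intro add_right_mono mult_left_mono)
  finally show ?thesis by (simp add: algebra_simps)
qed

lemma zeros_graph:
  assumes "u \<in> zeros"
  shows "(u, 0) \<in> graph"
proof -
  have "(u, - D u + D u) \<in> graph" using assms unfolding zeros_def graph_def by blast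
  then show ?thesis by simp
qed

text \<open>The resolvent of the maximally monotone part, evaluated at \<open>z - t D z\<close>, reproduces \<open>z\<close>.\<close>

lemma graph_maximal:
  assumes z: "\<And>u w. (u, w) \<in> graph \<Longrightarrow> w \<bullet> (z - u) \<le> 0"
  shows "z \<in> zeros"
proof -
  \<comment> \<open>\<open>1 / t\<close> exceeds the Lipschitz constant of \<open>D\<close> by 1, so
    that the final estimate leaves \<open>(norm (z - u))\<^sup>2 \<le> 0\<close>.\<close>
  define t where "t = 1 / (\<nu> + \<Lambda> + 1)"
  have t: "t > 0" "1 / t = \<nu> + \<Lambda> + 1" using \<nu> \<Lambda>_nonneg by (auto simp: t_def)
  obtain x where x: "(x, (fst (z - t *\<^sub>R D z) - x) /\<^sub>R t) \<in> epi_subgrad E"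
    using prox_point_exists[OF E t(1)] by blast
  \<comment> \<open>The dual resolvent is obtained by Moreau's decomposition from the proximal point
    of the primal function with the reciprocal parameter.\<close>
  have "\<exists>b. (b, (snd (z - t *\<^sub>R D z) $ i /\<^sub>R t - b) /\<^sub>R (1 / t)) \<in> epi_subgrad (Eg i)" for i
    using prox_point_exists[OF Eg[of i], of "1 / t" "snd (z - t *\<^sub>R D z) $ i /\<^sub>R t"] t(1) by auto
  then obtain b where b: "\<And>i. (b i, (snd (z - t *\<^sub>R D z) $ i /\<^sub>R t - b i) /\<^sub>R (1 / t)) \<in> epi_subgrad (Eg i)"
    by metis
  define u :: "'h \<times> ('g ^ 'm)" where "u = (x, \<chi> i. snd (z - t *\<^sub>R D z) $ i - t *\<^sub>R b i)"
  define m :: "'h \<times> ('g ^ 'm)" where "m = ((fst (z - t *\<^sub>R D z) - x) /\<^sub>R t, \<chi> i. b i)"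
  have um: "(u, m) \<in> maximal_graph"
    using x b t(1) by (simp add: maximal_graph_def u_def m_def scaleR_diff_right)
  have m_eq: "m = (1 / t) *\<^sub>R (z - u) - D z"
    using t(1) by (auto simp: m_def u_def prod_eq_iff vec_eq_iff scaleR_diff_right divide_inverse)
  have "(u, m + D u) \<in> graph" using um unfolding graph_def by blast
  then have "(m + D u) \<bullet> (z - u) \<le> 0" by (rule z)
  then have "(1 / t) * (norm (z - u))\<^sup>2 \<le> (D z - D u) \<bullet> (z - u)"
    unfolding m_eq power2_norm_eq_inner by (simp add: inner_diff_left inner_add_left)
  also have "\<dots> \<le> norm (D z - D u) * norm (z - u)" by (rule norm_cauchy_schwarz)
  also have "\<dots> \<le> (\<nu> + \<Lambda>) * norm (z - u) * norm (z - u)" by (intro mult_right_mono D_lipschitz) simp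
  finally have "(norm (z - u))\<^sup>2 \<le> 0" unfolding t(2) by (simp add: algebra_simps power2_eq_square)
  then have "z = u" by simp
  then show ?thesis using um m_eq unfolding zeros_def by simp
qed

end

section \<open>The penalty scheme\<close>

text \<open>Index \<open>n\<close> of \<open>y\<close> and \<open>q\<close> stands for index \<open>n - 1\<close> of the paper.\<close>

locale penalty_scheme = primal_dual E Eg grad L \<nu>
  for E :: "('h::{real_inner, complete_space} \<times> real) set"
    and Eg :: "'m::finite \<Rightarrow> ('g::{real_inner, complete_space} \<times> real) set"
    and grad :: "'h \<Rightarrow> 'h" and L :: "'m \<Rightarrow> 'h \<Rightarrow> 'g" and \<nu> :: real +
  fixes Ef :: "('h \<times> real) set" and C :: "'h set"
    and \<Psi> :: "'h \<Rightarrow> real" and grad_\<Psi> :: "'h \<Rightarrow> 'h" and \<mu> \<kappa> :: real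
    and lam bet :: "nat \<Rightarrow> real"
    and x y :: "nat \<Rightarrow> 'h" and v q :: "'m \<Rightarrow> nat \<Rightarrow> 'g"
  assumes decomp: "\<And>w a. (w, a) \<in> epi_subgrad E \<Longrightarrow>
        \<exists>a' p. a = a' + p \<and> (w, a') \<in> epi_subgrad Ef \<and> p \<in> normal_cone C w"
    and \<Psi>_ineq: "\<And>w w'. \<Psi> w + grad_\<Psi> w \<bullet> (w' - w) \<le> \<Psi> w'"
    and \<Psi>_C: "\<And>w. w \<in> C \<Longrightarrow> \<Psi> w = 0"
    and grad_\<Psi>_lip: "\<And>w w'. norm (grad_\<Psi> w - grad_\<Psi> w') \<le> inverse \<mu> * norm (w - w')"
    and \<mu>: "\<mu> > 0"
    and lam: "\<And>n. lam n > 0" "\<not> summable lam" "summable (\<lambda>n. (lam n)\<^sup>2)"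
    and bet: "\<And>n. bet n > 0"
    and penalty: "\<And>w p. p \<in> normal_cone C w \<Longrightarrow>
        \<exists>eps. summable eps \<and> (\<forall>n w'. lam n * (p \<bullet> (w' - w)) - lam n * bet n * \<Psi> w' \<le> eps n)"
    and \<kappa>': "0 \<le> \<kappa>" "\<kappa> < 1 / 2"
        "\<forall>\<^sub>F n in sequentially. lam n * bet n / \<mu> + lam n * (\<nu> + \<Lambda>) \<le> \<kappa>"
    and y_incl: "\<And>n. (y (Suc n),
        (x n - lam n *\<^sub>R (grad (y n) + (\<Sum>i\<in>UNIV. adjoint (L i) (q i n)))
          - (lam n * bet n) *\<^sub>R grad_\<Psi> (y n) - y (Suc n)) /\<^sub>R lam n) \<in> epi_subgrad Ef"
    and q_incl: "\<And>i n. ((v i n + lam n *\<^sub>R L i (y n) - q i (Suc n)) /\<^sub>R lam n, q i (Suc n))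
        \<in> epi_subgrad (Eg i)"
    and x_step: "\<And>n. x (Suc n) = (lam n * bet n) *\<^sub>R (grad_\<Psi> (y n) - grad_\<Psi> (y (Suc n)))
        + lam n *\<^sub>R (grad (y n) - grad (y (Suc n)))
        + lam n *\<^sub>R (\<Sum>i\<in>UNIV. adjoint (L i) (q i n - q i (Suc n))) + y (Suc n)"
    and v_step: "\<And>i n. v i (Suc n) = lam n *\<^sub>R L i (y (Suc n) - y n) + q i (Suc n)"
begin

definition X :: "nat \<Rightarrow> 'h \<times> ('g ^ 'm)" where "X n = (x n, \<chi> i. v i n)"

definition P :: "nat \<Rightarrow> 'h \<times> ('g ^ 'm)" where "P n = (y n, \<chi> i. q i n)"

text \<open>The element of the subdifferential part at \<open>P (Suc n)\<close> selected by the
  proximal steps. Its first component is a subgradient for \<open>Ef\<close>, that is, without a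
  normal vector of \<open>C\<close>.\<close>

definition A :: "nat \<Rightarrow> 'h \<times> ('g ^ 'm)" where
  "A n = ((x n - lam n *\<^sub>R (grad (y n) + (\<Sum>i\<in>UNIV. adjoint (L i) (q i n)))
          - (lam n * bet n) *\<^sub>R grad_\<Psi> (y n) - y (Suc n)) /\<^sub>R lam n,
        \<chi> i. (v i n + lam n *\<^sub>R L i (y n) - q i (Suc n)) /\<^sub>R lam n)"

lemma gap: "X (Suc n) - P (Suc n)
    = lam n *\<^sub>R (D (P n) - D (P (Suc n))) + (lam n * bet n) *\<^sub>R (grad_\<Psi> (y n) - grad_\<Psi> (y (Suc n)), 0)"
proof -
  have eq: "D (P n) - D (P (Suc n)) = (grad (y n) - grad (y (Suc n)), 0) + skew (P n - P (Suc n))"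
    unfolding skew_diff[symmetric] D_def by (simp add: P_def prod_eq_iff)
  show ?thesis unfolding eq
    by (simp add: X_def P_def x_step v_step skew_def prod_eq_iff vec_eq_iff algebra_simps
        linear_diff[OF bounded_linear.linear[OF L]])
qed

text \<open>The correction cancels the forward terms at the past point hidden in \<open>A n\<close>,
  so every operator is effectively evaluated at \<open>P (Suc n)\<close>, where monotonicity can be
  applied.\<close>

lemma step: "X n - X (Suc n) = lam n *\<^sub>R (A n + D (P (Suc n))) + (lam n * bet n) *\<^sub>R (grad_\<Psi> (y (Suc n)), 0)"
proof -
  have "lam n *\<^sub>R A n = X n - P (Suc n) - lam n *\<^sub>R D (P n) - (lam n * bet n) *\<^sub>R (grad_\<Psi> (y n), 0)"
    using lam(1)[of n] by (simp add: A_def X_def P_def D_def skew_def prod_eq_iff vec_eq_iff algebra_simps)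
  moreover have "X (Suc n) = P (Suc n) + (lam n *\<^sub>R (D (P n) - D (P (Suc n)))
      + (lam n * bet n) *\<^sub>R (grad_\<Psi> (y n) - grad_\<Psi> (y (Suc n)), 0))"
    using gap[of n] by (simp add: algebra_simps)
  ultimately show ?thesis
    by (simp add: prod_eq_iff scaleR_add_right scaleR_diff_right)
qed

sublocale past_extragradient X P \<kappa>
proof
  show "\<forall>\<^sub>F n in sequentially. norm (X (Suc n) - P (Suc n)) \<le> \<kappa> * norm (P (Suc n) - P n)"
    using \<kappa>'(3)
  proof eventually_elim
    case (elim n)
    have pos: "0 \<le> lam n" "0 \<le> lam n * bet n" using lam(1)[of n] bet[of n] by auto
    have "norm (X (Suc n) - P (Suc n)) \<le> lam n * norm (D (P n) - D (P (Suc n)))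
        + lam n * bet n * norm (grad_\<Psi> (y n) - grad_\<Psi> (y (Suc n)))"
      unfolding gap using pos by (intro order_trans[OF norm_triangle_ineq]) (simp add: norm_Pair)
    also have "\<dots> \<le> lam n * ((\<nu> + \<Lambda>) * norm (P n - P (Suc n)))
        + lam n * bet n * (inverse \<mu> * norm (P n - P (Suc n)))"
    proof (intro add_mono mult_left_mono D_lipschitz pos)
      have "norm (grad_\<Psi> (y n) - grad_\<Psi> (y (Suc n))) \<le> inverse \<mu> * norm (fst (P n - P (Suc n)))"
        using grad_\<Psi>_lip by (simp add: P_def)
      also have "\<dots> \<le> inverse \<mu> * norm (P n - P (Suc n))"
        using \<mu> by (intro mult_left_mono norm_fst_le_norm) auto
      finally show "norm (grad_\<Psi> (y n) - grad_\<Psi> (y (Suc n))) \<le> inverse \<mu> * norm (P n - P (Suc n))" .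
    qed
    also have "\<dots> = (lam n * bet n / \<mu> + lam n * (\<nu> + \<Lambda>)) * norm (P (Suc n) - P n)"
      by (simp add: algebra_simps divide_inverse norm_minus_commute)
    also have "\<dots> \<le> \<kappa> * norm (P (Suc n) - P n)" using elim by (intro mult_right_mono) auto
    finally show ?case .
  qed
qed (rule \<kappa>')+

text \<open>The normal vector \<open>p\<close> is part of \<open>m\<close> but absent from
  \<open>A n\<close>; the resulting term is covered by the penalty at the price of
  \<open>eps\<close>. The modulus is 0 in the merely monotone case and positive in the strongly
  monotone one.\<close>

lemma descent_inequality:
  assumes u: "m = (a' + p, b)" "p \<in> normal_cone C (fst u)"
    and \<gamma>: "\<And>n. \<gamma> * (norm (P (Suc n) - u))\<^sup>2 \<le> (A n - (a', b)) \<bullet> (P (Suc n) - u)"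
  shows "\<exists>eps. summable eps \<and> (\<forall>n. lam n * (\<gamma> * (norm (P (Suc n) - u))\<^sup>2)
      + lam n * ((m + D u) \<bullet> (P (Suc n) - u)) - eps n \<le> (X n - X (Suc n)) \<bullet> (P (Suc n) - u))"
proof -
  obtain eps where eps: "summable eps"
      "\<And>n w'. lam n * (p \<bullet> (w' - fst u)) - lam n * bet n * \<Psi> w' \<le> eps n"
    using penalty[OF u(2)] by blast
  have "lam n * (\<gamma> * (norm (P (Suc n) - u))\<^sup>2) + lam n * ((m + D u) \<bullet> (P (Suc n) - u)) - eps n
      \<le> (X n - X (Suc n)) \<bullet> (P (Suc n) - u)" for n
  proof -
    let ?d = "P (Suc n) - u" and ?g = "grad_\<Psi> (y (Suc n)) \<bullet> (y (Suc n) - fst u)"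
    have "\<Psi> (fst u) = 0" using u(2) \<Psi>_C by (simp add: normal_cone_def)
    then have "\<Psi> (y (Suc n)) \<le> ?g" using \<Psi>_ineq[of "y (Suc n)" "fst u"] by (simp add: inner_diff_right)
    then have 1: "lam n * bet n * \<Psi> (y (Suc n)) \<le> lam n * bet n * ?g"
      using lam(1)[of n] bet[of n] by (intro mult_left_mono) auto
    have "\<gamma> * (norm ?d)\<^sup>2 + (m + D u) \<bullet> ?d - p \<bullet> (y (Suc n) - fst u) \<le> (A n + D (P (Suc n))) \<bullet> ?d"
    proof -
      have "m \<bullet> ?d = (a', b) \<bullet> ?d + p \<bullet> (y (Suc n) - fst u)"
        by (simp add: u(1) P_def inner_prod_def inner_add_left)
      then show ?thesis using \<gamma>[of n] D_monotone[of "P (Suc n)" u]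
        by (simp add: inner_add_left inner_diff_left)
    qed
    then have "lam n * (\<gamma> * (norm ?d)\<^sup>2 + (m + D u) \<bullet> ?d - p \<bullet> (y (Suc n) - fst u))
        \<le> lam n * ((A n + D (P (Suc n))) \<bullet> ?d)"
      using lam(1)[of n] by (intro mult_left_mono) auto
    moreover have "(X n - X (Suc n)) \<bullet> ?d = lam n * ((A n + D (P (Suc n))) \<bullet> ?d) + lam n * bet n * ?g"
      unfolding step by (simp add: inner_add_left P_def inner_prod_def distrib_left)
    ultimately show ?thesis using 1 eps(2)[of n "y (Suc n)"] by (simp add: algebra_simps)
  qed
  with eps(1) show ?thesis by blast
qed

lemma descent_graph:
  assumes "(u, w) \<in> graph"
  obtains eps where "summable eps"
    "\<And>n. lam n * (w \<bullet> (P (Suc n) - u)) - eps n \<le> (X n - X (Suc n)) \<bullet> (P (Suc n) - u)"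
proof -
  obtain m where m: "w = m + D u" "(u, m) \<in> maximal_graph" using assms unfolding graph_def by blast
  then obtain a' p where a': "fst m = a' + p" "(fst u, a') \<in> epi_subgrad Ef" "p \<in> normal_cone C (fst u)"
    using decomp unfolding maximal_graph_def by blast
  have "0 * (norm (P (Suc n) - u))\<^sup>2 \<le> (A n - (a', snd m)) \<bullet> (P (Suc n) - u)" for n
  proof -
    have "0 \<le> (fst (A n) - a') \<bullet> (y (Suc n) - fst u)"
      using epi_subgrad_monotone[OF y_incl a'(2)] by (simp add: A_def)
    moreover have "0 \<le> (snd (A n) $ i - snd m $ i) \<bullet> (q i (Suc n) - snd u $ i)" for i
      using epi_subgrad_monotone[OF q_incl[of n i], of "snd m $ i" "snd u $ i"] m(2)
      by (simp add: A_def maximal_graph_def inner_commute)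
    ultimately show ?thesis by (simp add: inner_prod_def inner_vec_def P_def sum_nonneg)
  qed
  from descent_inequality[OF _ a'(3) this, of m] a'(1)
  show thesis using that m(1) by (metis add.left_neutral mult_zero_left mult_zero_right prod.collapse)
qed

lemma gap_summable_and_fejer:
  assumes "u \<in> zeros"
  shows "convergent (\<lambda>n. norm (X n - u))" "summable (\<lambda>n. (norm (X n - P (Suc n)))\<^sup>2)"
proof -
  obtain eps where eps: "summable eps"
    "\<And>n. lam n * (0 \<bullet> (P (Suc n) - u)) - eps n \<le> (X n - X (Suc n)) \<bullet> (P (Suc n) - u)"
    using descent_graph[OF zeros_graph[OF assms]] by blast
  have "0 - eps n \<le> (X n - X (Suc n)) \<bullet> (P (Suc n) - u)" for n using eps(2)[of n] by simp
  from fejer_convergence(1,2)[OF order_refl eps(1) this]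
  show "convergent (\<lambda>n. norm (X n - u))" "summable (\<lambda>n. (norm (X n - P (Suc n)))\<^sup>2)" .
qed

theorem ergodic_convergence:
  assumes "zeros \<noteq> {}"
  shows "\<exists>u\<in>zeros. weakly_converges (\<lambda>n. (1 / (\<Sum>k\<le>n. lam k)) *\<^sub>R (\<Sum>k\<le>n. lam k *\<^sub>R X k)) u"
proof (rule ergodic_weak_convergence[OF lam(1,2) refl assms gap_summable_and_fejer(1) _ graph_maximal])
  fix u w assume "(u, w) \<in> graph"
  then obtain eps where "summable eps"
    "\<And>n. lam n * (w \<bullet> (P (Suc n) - u)) - eps n \<le> (X n - X (Suc n)) \<bullet> (P (Suc n) - u)"
    using descent_graph by blast
  then show "\<exists>c. \<forall>\<^sub>F n in sequentially. (\<Sum>k<n. lam k * (w \<bullet> (X k - u))) \<le> c"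
    using assms gap_summable_and_fejer(2) lam by (intro ergodic_sum_bounded) (auto intro: less_imp_le)
qed

text \<open>The sets \<open>G i\<close> are the carriers of the dual spaces: strong convexity of a
  conjugate is only known there, so iterates and multipliers have to lie in them.\<close>

theorem strong_convergence_to_zero:
  fixes G :: "'m \<Rightarrow> 'g set"
  assumes u: "u \<in> zeros" "\<And>i. snd u $ i \<in> G i" and q: "\<And>i n. q i (Suc n) \<in> G i" and "\<gamma> > 0"
    and f_strong: "\<And>w a w' a'. (w, a) \<in> epi_subgrad Ef \<Longrightarrow> (w', a') \<in> epi_subgrad Ef \<Longrightarrow>
      \<gamma> * (norm (w - w'))\<^sup>2 \<le> (a - a') \<bullet> (w - w')"
    and g_strong: "\<And>i b v b' v'. (b, v) \<in> epi_subgrad (Eg i) \<Longrightarrow> (b', v') \<in> epi_subgrad (Eg i) \<Longrightarrow>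
      v \<in> G i \<Longrightarrow> v' \<in> G i \<Longrightarrow> \<gamma> * (norm (v - v'))\<^sup>2 \<le> (b - b') \<bullet> (v - v')"
  shows "X \<longlonglongrightarrow> u"
proof -
  have m: "(fst u, fst (- D u)) \<in> epi_subgrad E" "\<And>i. (snd (- D u) $ i, snd u $ i) \<in> epi_subgrad (Eg i)"
    using u(1) unfolding zeros_def maximal_graph_def by auto
  obtain a' p where a': "fst (- D u) = a' + p" "(fst u, a') \<in> epi_subgrad Ef" "p \<in> normal_cone C (fst u)"
    using decomp[OF m(1)] by blast
  have "\<gamma> * (norm (P (Suc n) - u))\<^sup>2 \<le> (A n - (a', snd (- D u))) \<bullet> (P (Suc n) - u)" for n
  proof -
    have "\<gamma> * (norm (y (Suc n) - fst u))\<^sup>2 \<le> (fst (A n) - a') \<bullet> (y (Suc n) - fst u)"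
      using f_strong[OF y_incl a'(2)] by (simp add: A_def)
    moreover have "\<gamma> * (norm (q i (Suc n) - snd u $ i))\<^sup>2
        \<le> (snd (A n) $ i - snd (- D u) $ i) \<bullet> (q i (Suc n) - snd u $ i)" for i
      using g_strong[OF q_incl m(2) q u(2), of i n] by (simp add: A_def)
    then have "(\<Sum>i\<in>UNIV. \<gamma> * (norm (q i (Suc n) - snd u $ i))\<^sup>2)
        \<le> (\<Sum>i\<in>UNIV. (snd (A n) $ i - snd (- D u) $ i) \<bullet> (q i (Suc n) - snd u $ i))"
      by (rule sum_mono)
    ultimately show ?thesis
      by (simp add: inner_prod_def inner_vec_def P_def power2_norm_eq_inner sum_distrib_left distrib_left)
  qed
  from descent_inequality[OF _ a'(3) this, of "- D u"] a'(1) obtain eps where "summable eps"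
    "\<And>n. lam n * (\<gamma> * (norm (P (Suc n) - u))\<^sup>2) + lam n * ((- D u + D u) \<bullet> (P (Suc n) - u)) - eps n
      \<le> (X n - X (Suc n)) \<bullet> (P (Suc n) - u)"
    by (metis prod.collapse)
  then show ?thesis using strong_convergence[OF lam(1,2) \<open>\<gamma> > 0\<close>, of eps u] by simp
qed

end

section \<open>Optimality conditions\<close>

text \<open>The subdifferential of \<open>f\<close> restricted to \<open>C\<close> is monotone and
  contains the sum of the subdifferential of \<open>f\<close> and the normal cone. Maximality of the
  sum makes the two equal, so every such subgradient splits.\<close>

lemma maximal_subdifferential_sum:
  assumes mm: "maximally_monotone (op_plus (subdifferential f) (normal_cone C))"
    and f: "\<And>x. f x \<noteq> -\<infinity>" and sub: "(w, a) \<in> epi_subgrad (epi_on C f)"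
  shows "\<exists>a' p. a = a' + p \<and> (w, a') \<in> epi_subgrad (epi_on UNIV f) \<and> p \<in> normal_cone C w"
proof -
  define B where "B x = {u. (x, u) \<in> epi_subgrad (epi_on C f)}" for x
  have "monotone_op B"
    using epi_subgrad_monotone by (fastforce simp: monotone_op_def B_def inner_commute)
  moreover have "op_plus (subdifferential f) (normal_cone C) x \<subseteq> B x" for x
  proof
    fix u assume "u \<in> op_plus (subdifferential f) (normal_cone C) x"
    then obtain a p where u: "u = a + p" "a \<in> subdifferential f x" "p \<in> normal_cone C x"
      unfolding op_plus_def by blast
    obtain s where s: "f x = ereal s" using u(2) by (auto simp: subdifferential_def)
    have "ereal (s + u \<bullet> (y - x)) \<le> f y" if "y \<in> C" for y
    proof -
      have "u \<bullet> (y - x) \<le> a \<bullet> (y - x)"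
        using u(1,3) that by (simp add: normal_cone_def inner_add_left inner_commute[of p])
      then have "ereal (s + u \<bullet> (y - x)) \<le> f x + ereal (a \<bullet> (y - x))" using s by simp
      also have "\<dots> \<le> f y" using u(2) by (simp add: subdifferential_def)
      finally show ?thesis .
    qed
    moreover have "x \<in> C" using u(3) by (simp add: normal_cone_def)
    ultimately show "u \<in> B x" unfolding B_def using epi_subgrad_epi_onI[where g = f, OF _ s] by blast
  qed
  ultimately have eq: "B = op_plus (subdifferential f) (normal_cone C)"
    using mm unfolding maximally_monotone_def by blast
  have "a \<in> op_plus (subdifferential f) (normal_cone C) w"
    unfolding eq[symmetric] using sub by (simp add: B_def)
  then obtain a' p where a: "a = a' + p" "a' \<in> subdifferential f w" "p \<in> normal_cone C w"
    unfolding op_plus_def by blast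
  obtain s where s: "f w = ereal s" using a(2) by (auto simp: subdifferential_def)
  have "(w, a') \<in> epi_subgrad (epi_on UNIV f)"
    using a(2) s by (intro epi_subgrad_epi_onI[where s = s]) (auto simp: subdifferential_def)
  with a show ?thesis by blast
qed

text \<open>For \<open>p\<close> normal to \<open>C\<close> at \<open>w\<close>, the support
  function is attained at \<open>w\<close>, and the conjugate of \<open>\<Psi>\<close> is bounded
  below by its value at any test point \<open>w'\<close>. The real values of the series terms serve
  as \<open>eps\<close>.\<close>

lemma penalty_error_summable:
  fixes \<Psi> :: "'h::real_inner \<Rightarrow> real" and lam \<beta> :: "nat \<Rightarrow> real"
  assumes pos: "\<And>n. lam n > 0" "\<And>n. \<beta> n > 0" and \<Psi>: "\<And>w. w \<in> C \<Longrightarrow> \<Psi> w = 0"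
    and sum: "(\<Sum>n. ereal (lam n * \<beta> n) *
             (fenchel_conj UNIV (\<lambda>w. ereal (\<Psi> w)) (p /\<^sub>R \<beta> n) - support_fun C (p /\<^sub>R \<beta> n))) < \<infinity>"
    and p: "p \<in> normal_cone C w"
  shows "\<exists>eps. summable eps \<and> (\<forall>n w'. lam n * (p \<bullet> (w' - w)) - lam n * \<beta> n * \<Psi> w' \<le> eps n)"
proof -
  define A where "A n = fenchel_conj UNIV (\<lambda>w. ereal (\<Psi> w)) (p /\<^sub>R \<beta> n) - support_fun C (p /\<^sub>R \<beta> n)" for n
  define T where "T n = ereal (lam n * \<beta> n) * A n" for n
  have w: "w \<in> C" "\<And>w'. w' \<in> C \<Longrightarrow> (w' - w) \<bullet> p \<le> 0" using p by (auto simp: normal_cone_def)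
  have supp: "support_fun C (p /\<^sub>R \<beta> n) = ereal ((w \<bullet> p) / \<beta> n)" for n
  proof (rule antisym)
    show "support_fun C (p /\<^sub>R \<beta> n) \<le> ereal ((w \<bullet> p) / \<beta> n)"
      unfolding support_fun_def
    proof (rule SUP_least)
      fix w' assume "w' \<in> C"
      then have "w' \<bullet> p \<le> w \<bullet> p" using w(2) by (simp add: inner_diff_left)
      then show "ereal (w' \<bullet> (p /\<^sub>R \<beta> n)) \<le> ereal ((w \<bullet> p) / \<beta> n)"
        using pos(2)[of n] by (simp add: divide_inverse mult.commute)
    qed
    show "ereal ((w \<bullet> p) / \<beta> n) \<le> support_fun C (p /\<^sub>R \<beta> n)"
      unfolding support_fun_def by (rule SUP_upper2[OF w(1)]) (simp add: divide_inverse mult.commute)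
  qed
  have A_ge: "ereal ((p \<bullet> (w' - w)) / \<beta> n - \<Psi> w') \<le> A n" for n w'
  proof -
    have "ereal ((p /\<^sub>R \<beta> n) \<bullet> w') - ereal (\<Psi> w') \<le> fenchel_conj UNIV (\<lambda>w. ereal (\<Psi> w)) (p /\<^sub>R \<beta> n)"
      unfolding fenchel_conj_def by (rule SUP_upper) simp
    then have "ereal ((p /\<^sub>R \<beta> n) \<bullet> w') - ereal (\<Psi> w') - ereal ((w \<bullet> p) / \<beta> n) \<le> A n"
      unfolding A_def supp by (rule ereal_minus_mono) simp
    moreover have "(p /\<^sub>R \<beta> n) \<bullet> w' - \<Psi> w' - (w \<bullet> p) / \<beta> n = (p \<bullet> (w' - w)) / \<beta> n - \<Psi> w'"
      by (simp add: inner_diff_right inner_commute[of w] divide_inverse algebra_simps)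
    ultimately show ?thesis by (simp only: ereal_minus(1))
  qed
  \<comment> \<open>Testing at \<open>w\<close>, where \<open>\<Psi>\<close> vanishes. Nonnegativity
    lets finiteness of the extended sum give genuine summability.\<close>
  have A_nonneg: "0 \<le> A n" for n
    using A_ge[of w n] \<Psi>[OF w(1)] by (simp add: zero_ereal_def)
  have T_nonneg: "0 \<le> T n" for n
    unfolding T_def using A_nonneg pos[of n] by (intro ereal_0_le_mult) (auto simp: less_imp_le)
  have fin: "(\<Sum>n. T n) \<noteq> \<infinity>" using sum unfolding T_def A_def by auto
  have T_fin: "T n \<noteq> \<infinity>" for n using suminf_PInfty[OF T_nonneg fin] .
  have T_real: "T n = ereal (real_of_ereal (T n))" for n
    using T_fin[of n] T_nonneg[of n] by (cases "T n") auto
  have "summable (\<lambda>n. real_of_ereal (T n))" by (rule summable_real_of_ereal[OF T_nonneg fin])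
  moreover have "lam n * (p \<bullet> (w' - w)) - lam n * \<beta> n * \<Psi> w' \<le> real_of_ereal (T n)" for n w'
  proof -
    have "ereal (lam n * \<beta> n) * ereal ((p \<bullet> (w' - w)) / \<beta> n - \<Psi> w') \<le> T n"
      unfolding T_def using A_ge pos[of n] by (intro ereal_mult_left_mono) (auto simp: less_imp_le)
    then have "lam n * \<beta> n * ((p \<bullet> (w' - w)) / \<beta> n - \<Psi> w') \<le> real_of_ereal (T n)"
      by (subst (asm) T_real) simp
    moreover have "lam n * \<beta> n * ((p \<bullet> (w' - w)) / \<beta> n - \<Psi> w')
        = lam n * (p \<bullet> (w' - w)) - lam n * \<beta> n * \<Psi> w'"
      using pos(2)[of n] by (simp add: right_diff_distrib)
    ultimately show ?thesis by simp
  qed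
  ultimately show ?thesis by blast
qed

lemma zero_imp_optimal:
  fixes f :: "'h::{real_inner, complete_space} \<Rightarrow> ereal" and g :: "'m::finite \<Rightarrow> 'g::real_inner \<Rightarrow> ereal"
  assumes f: "\<And>x. f x \<noteq> -\<infinity>" and g: "\<And>i u. u \<in> G i \<Longrightarrow> g i u \<noteq> -\<infinity>"
    and L: "\<And>i. bounded_linear (L i)" "\<And>i. range (L i) \<subseteq> G i"
    and h: "\<And>y. h x + d \<bullet> (y - x) \<le> h y"
    and x: "(x, - (d + (\<Sum>i\<in>UNIV. adjoint (L i) (v i)))) \<in> epi_subgrad (epi_on C f)"
    and v: "\<And>i. (L i x, v i) \<in> epi_subgrad (epi_on (G i) (g i))"
  shows "x \<in> argmin_set (\<lambda>w. f w + (\<Sum>i\<in>UNIV. g i (L i w)) + ereal (h w)) C"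
proof -
  let ?a = "- (d + (\<Sum>i\<in>UNIV. adjoint (L i) (v i)))"
  obtain s where s: "x \<in> C" "f x = ereal s" "\<And>y. y \<in> C \<Longrightarrow> ereal (s + ?a \<bullet> (y - x)) \<le> f y"
    using epi_subgrad_epi_onD[OF x f] by blast
  have "\<exists>r. g i (L i x) = ereal r \<and> (\<forall>u\<in>G i. ereal (r + v i \<bullet> (u - L i x)) \<le> g i u)" for i
  proof -
    obtain r where "g i (L i x) = ereal r" "\<And>u. u \<in> G i \<Longrightarrow> ereal (r + v i \<bullet> (u - L i x)) \<le> g i u"
      by (rule epi_subgrad_epi_onD[OF v[of i] g]) (assumption, rule that)
    then show ?thesis by blast
  qed
  then obtain r where r: "\<And>i. g i (L i x) = ereal (r i)"
    "\<And>i u. u \<in> G i \<Longrightarrow> ereal (r i + v i \<bullet> (u - L i x)) \<le> g i u" by metis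
  have "f x + (\<Sum>i\<in>UNIV. g i (L i x)) + ereal (h x) \<le> f y + (\<Sum>i\<in>UNIV. g i (L i y)) + ereal (h y)"
    if y: "y \<in> C" for y
  proof -
    have "(\<Sum>i\<in>UNIV. v i \<bullet> (L i y - L i x)) = (\<Sum>i\<in>UNIV. adjoint (L i) (v i)) \<bullet> (y - x)"
      by (simp add: inner_sum_left inner_commute[of "adjoint _ _"] inner_commute[of "v _"]
          adjoint_inner[OF L(1)] linear_diff[OF bounded_linear.linear[OF L(1)]])
    \<comment> \<open>The linear terms from \<open>f\<close>, the \<open>g i\<close> and
      \<open>h\<close> cancel, which is the content of the optimality conditions.\<close>
    then have eq: "s + (\<Sum>i\<in>UNIV. r i) + h x = (s + ?a \<bullet> (y - x))
        + (\<Sum>i\<in>UNIV. r i + v i \<bullet> (L i y - L i x)) + (h x + d \<bullet> (y - x))"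
      by (simp add: sum.distrib inner_diff_left inner_add_left)
    have "f x + (\<Sum>i\<in>UNIV. g i (L i x)) + ereal (h x) = ereal (s + ?a \<bullet> (y - x))
        + (\<Sum>i\<in>UNIV. ereal (r i + v i \<bullet> (L i y - L i x))) + ereal (h x + d \<bullet> (y - x))"
      using s(2) r(1) eq by (simp only: sum_ereal plus_ereal.simps)
    also have "\<dots> \<le> f y + (\<Sum>i\<in>UNIV. g i (L i y)) + ereal (h y)"
      using L(2) h by (intro add_mono s(3)[OF y] sum_mono r(2)) auto
    finally show ?thesis .
  qed
  then show ?thesis using s(1) by (auto simp: argmin_set_def is_arg_min_def not_less)
qed

text \<open>Replacing \<open>h\<close> by its linearisation at \<open>x\<close> keeps
  \<open>x\<close> optimal and makes the problem one of linear cost over a product of epigraphs,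
  with the coupling \<open>u i = L i w\<close> as linear constraint.\<close>

lemma optimal_imp_multiplier:
  fixes f :: "'h::{real_inner, complete_space} \<Rightarrow> ereal"
    and g :: "'m::finite \<Rightarrow> 'g::{real_inner, complete_space} \<Rightarrow> ereal"
  assumes f: "\<And>x. f x \<noteq> -\<infinity>" "closed (epi_on C f)" "convex (epi_on C f)"
    and g: "\<And>i u. u \<in> G i \<Longrightarrow> g i u \<noteq> -\<infinity>" "\<And>i. closed (epi_on (G i) (g i))"
      "\<And>i. convex (epi_on (G i) (g i))"
    and G: "\<And>i. subspace (G i)"
    and L: "\<And>i. bounded_linear (L i)" "\<And>i. range (L i) \<subseteq> G i"
    and h: "GDERIV h x :> d"
    and sqri: "0 \<in> sqri {d - (\<chi> i. L i w) | (d :: 'g ^ 'm) w.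
          (\<forall>i. d $ i \<in> dom_on (G i) (g i)) \<and> w \<in> dom_on UNIV f \<inter> C}"
    and x: "x \<in> argmin_set (\<lambda>w. f w + (\<Sum>i\<in>UNIV. g i (L i w)) + ereal (h w)) C"
  obtains v where "\<And>i. v i \<in> G i"
    "(x, - (d + (\<Sum>i\<in>UNIV. adjoint (L i) (v i)))) \<in> epi_subgrad (epi_on C f)"
    "\<And>i. (L i x, v i) \<in> epi_subgrad (epi_on (G i) (g i))"
proof -
  define F where "F w = f w + (\<Sum>i\<in>UNIV. g i (L i w)) + ereal (h w)" for w
  define S where "S = {d - (\<chi> i. L i w) | (d :: 'g ^ 'm) w.
          (\<forall>i. d $ i \<in> dom_on (G i) (g i)) \<and> w \<in> dom_on UNIV f \<inter> C}"
  define K where "K = (\<Union>r\<in>{0<..}. (\<lambda>s. r *\<^sub>R (s - 0)) ` S)"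
  have K: "subspace K" "closed K" and "0 \<in> S"
    using sqri unfolding S_def[symmetric] sqri_def K_def by (auto simp: Let_def)
  have LG: "L i w \<in> G i" for i w using L(2) by blast
  have xC: "x \<in> C" and min: "\<And>w. w \<in> C \<Longrightarrow> F x \<le> F w"
    using x unfolding argmin_set_def is_arg_min_def F_def by (auto simp: not_less)
  obtain w0 where w0: "w0 \<in> C" "f w0 < \<infinity>" "\<And>i. g i (L i w0) < \<infinity>"
  proof -
    from \<open>0 \<in> S\<close> obtain d :: "'g ^ 'm" and w where dw: "0 = d - (\<chi> i. L i w)"
      "\<And>i. d $ i \<in> dom_on (G i) (g i)" "w \<in> dom_on UNIV f \<inter> C" unfolding S_def by blast
    then have "d $ i = L i w" for i by (simp add: vec_eq_iff)
    with dw show thesis using that[of w] by (auto simp: dom_on_def)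
  qed
  \<comment> \<open>A point of finite value makes the optimal value finite, so every summand at
    \<open>x\<close> is a real number.\<close>
  have "F w0 < \<infinity>"
  proof -
    have "(\<Sum>i\<in>UNIV. g i (L i w0)) \<noteq> \<infinity>" using w0(3) by (auto simp: sum_Pinfty)
    then show ?thesis unfolding F_def using w0(2) by auto
  qed
  then have Fx: "F x < \<infinity>" using min[OF w0(1)] by (rule le_less_trans[rotated])
  have "f x \<noteq> \<infinity>" using Fx unfolding F_def by auto
  then obtain s where s: "f x = ereal s" using f(1)[of x] by (cases "f x") auto
  have "(\<Sum>i\<in>UNIV. g i (L i x)) \<noteq> \<infinity>" using Fx s unfolding F_def by auto
  then have "g i (L i x) \<noteq> \<infinity>" for i by (auto simp: sum_Pinfty)
  then have "\<exists>r. g i (L i x) = ereal r" for i using g(1)[OF LG, of i x] by (cases "g i (L i x)") auto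
  then obtain r where r: "\<And>i. g i (L i x) = ereal (r i)" by metis
  define W :: "(('h \<times> real) \<times> (('g \<times> real) ^ 'm)) set"
    where "W = {p. fst p \<in> epi_on C f \<and> (\<forall>i. snd p $ i \<in> epi_on (G i) (g i))}"
  define T :: "('h \<times> real) \<times> (('g \<times> real) ^ 'm) \<Rightarrow> 'g ^ 'm"
    where "T p = (\<chi> i. fst (snd p $ i) - L i (fst (fst p)))" for p
  define c :: "('h \<times> real) \<times> (('g \<times> real) ^ 'm) \<Rightarrow> real"
    where "c p = snd (fst p) + (\<Sum>i\<in>UNIV. snd (snd p $ i)) + d \<bullet> fst (fst p)" for p
  have blf: "bounded_linear (\<lambda>p :: ('h \<times> real) \<times> (('g \<times> real) ^ 'm). fst (snd p $ i))"
    "bounded_linear (\<lambda>p :: ('h \<times> real) \<times> (('g \<times> real) ^ 'm). snd (snd p $ i))"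
    "bounded_linear (\<lambda>p :: ('h \<times> real) \<times> (('g \<times> real) ^ 'm). snd p $ i)"
    "bounded_linear (\<lambda>p :: ('h \<times> real) \<times> (('g \<times> real) ^ 'm). fst (fst p))"
    "bounded_linear (\<lambda>p :: ('h \<times> real) \<times> (('g \<times> real) ^ 'm). snd (fst p))" for i
    by (intro bounded_linear_fst_comp bounded_linear_snd_comp bounded_linear_fst bounded_linear_snd
        bounded_linear_compose[OF bounded_linear_vec_nth])+
  have W_eq: "W = (fst -` epi_on C f) \<inter> (\<Inter>i. (\<lambda>p. snd p $ i) -` epi_on (G i) (g i))"
    unfolding W_def by auto
  have W: "closed W" "convex W"
    unfolding W_eq
    by (intro closed_Int closed_INT ballI closed_vimage f(2) g(2) bounded_linear.continuous_on[OF blf(3)]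
        continuous_intros)
      (intro convex_Int convex_INT convex_linear_vimage f(3) g(3) bounded_linear.linear[OF blf(3)]
        bounded_linear.linear[OF bounded_linear_fst])
  have T: "bounded_linear T"
    unfolding T_def
    by (intro bounded_linear_vec_lambda bounded_linear_sub blf bounded_linear_compose[OF L(1) blf(4)])
  have c: "bounded_linear c"
    unfolding c_def
    by (intro bounded_linear_add bounded_linear_sum blf bounded_linear_compose[OF bounded_linear_inner_right blf(4)])
  have TW: "T ` W = S"
  proof (intro equalityI subsetI)
    fix e assume "e \<in> T ` W"
    then obtain p where p: "p \<in> W" "e = T p" by blast
    have "e = (\<chi> i. fst (snd p $ i)) - (\<chi> i. L i (fst (fst p)))" using p(2) by (simp add: T_def vec_eq_iff)
    moreover have "fst (fst p) \<in> dom_on UNIV f \<inter> C"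
      using p(1) unfolding W_def epi_on_def dom_on_def by (auto simp: case_prod_beta' less_ereal.simps intro: le_less_trans)
    moreover have "(\<chi> i. fst (snd p $ i)) $ i \<in> dom_on (G i) (g i)" for i
    proof -
      have "snd p $ i \<in> epi_on (G i) (g i)" using p(1) by (simp add: W_def)
      then show ?thesis by (auto simp: epi_on_def dom_on_def case_prod_beta')
    qed
    ultimately show "e \<in> S" unfolding S_def by blast
  next
    fix e assume "e \<in> S"
    then obtain d' :: "'g ^ 'm" and w where dw: "e = d' - (\<chi> i. L i w)"
      "\<And>i. d' $ i \<in> dom_on (G i) (g i)" "w \<in> dom_on UNIV f \<inter> C" unfolding S_def by blast
    define p where "p = ((w, real_of_ereal (f w)), \<chi> i. (d' $ i, real_of_ereal (g i (d' $ i))))"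
    have "f w = ereal (real_of_ereal (f w))"
      using dw(3) f(1)[of w] by (cases "f w") (auto simp: dom_on_def)
    moreover have "g i (d' $ i) = ereal (real_of_ereal (g i (d' $ i)))" for i
      using dw(2)[of i] g(1)[of "d' $ i" i] by (cases "g i (d' $ i)") (auto simp: dom_on_def)
    ultimately have "p \<in> W" using dw(2,3) unfolding W_def p_def epi_on_def dom_on_def by auto
    moreover have "e = T p" using dw(1) by (simp add: p_def T_def vec_eq_iff)
    ultimately show "e \<in> T ` W" by blast
  qed
  have K_eq: "K = (\<Union>r\<in>{0<..}. (\<lambda>w. r *\<^sub>R T w) ` W)"
    unfolding K_def TW[symmetric] by (simp add: image_image)
  define m where "m = s + (\<Sum>i\<in>UNIV. r i) + d \<bullet> x"
  \<comment> \<open>Optimality holds for the true \<open>h\<close>. Moving from \<open>x\<close>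
    towards \<open>y\<close> by a fraction \<open>t\<close>, convexity bounds the other summands,
    and the difference quotient of \<open>h\<close> tends to
    \<open>d \<bullet> (y - x)\<close>.\<close>
  have lower: "m \<le> c p" if p: "p \<in> W" "T p = 0" for p
  proof -
    define y \<rho> where "y = fst (fst p)" and "\<rho> = snd (fst p)"
    define R where "R = \<rho> + (\<Sum>i\<in>UNIV. snd (snd p $ i))"
    define R0 where "R0 = s + (\<Sum>i\<in>UNIV. r i)"
    have y: "(y, \<rho>) \<in> epi_on C f" using p(1) by (simp add: W_def y_def \<rho>_def)
    have Ly: "fst (snd p $ i) = L i y" for i using p(2) by (simp add: T_def y_def vec_eq_iff)
    have gy: "(L i y, snd (snd p $ i)) \<in> epi_on (G i) (g i)" for i
      using p(1) Ly[of i, symmetric] by (simp add: W_def)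
    have "\<forall>\<^sub>F t in at_right 0. R0 - R \<le> (h (x + t *\<^sub>R (y - x)) - h x) / t"
    proof (rule eventually_at_rightI[of 0 1])
      fix t :: real assume t: "t \<in> {0<..<1}"
      define z where "z = (1 - t) *\<^sub>R x + t *\<^sub>R y"
      have z_eq: "z = x + t *\<^sub>R (y - x)" by (simp add: z_def algebra_simps)
      have "(1 - t) *\<^sub>R (x, s) + t *\<^sub>R (y, \<rho>) \<in> epi_on C f"
        using y s xC t by (intro convexD[OF f(3)]) (auto simp: epi_on_def)
      then have z: "z \<in> C" "f z \<le> ereal ((1 - t) * s + t * \<rho>)" by (auto simp: epi_on_def z_def)
      have "g i (L i z) \<le> ereal ((1 - t) * r i + t * snd (snd p $ i))" for i
      proof -
        have "(1 - t) *\<^sub>R (L i x, r i) + t *\<^sub>R (L i y, snd (snd p $ i)) \<in> epi_on (G i) (g i)"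
          using gy r t LG by (intro convexD[OF g(3)]) (auto simp: epi_on_def)
        then show ?thesis
          by (simp add: epi_on_def z_def linear_add[OF bounded_linear.linear[OF L(1)]]
              linear_scale[OF bounded_linear.linear[OF L(1)]])
      qed
      then have "(\<Sum>i\<in>UNIV. g i (L i z)) \<le> (\<Sum>i\<in>UNIV. ereal ((1 - t) * r i + t * snd (snd p $ i)))"
        by (intro sum_mono)
      then have "F z \<le> ereal ((1 - t) * s + t * \<rho>)
          + (\<Sum>i\<in>UNIV. ereal ((1 - t) * r i + t * snd (snd p $ i))) + ereal (h z)"
        unfolding F_def by (intro add_mono z(2) order_refl)
      with min[OF z(1)] have "F x \<le> ereal ((1 - t) * s + t * \<rho>)
          + (\<Sum>i\<in>UNIV. ereal ((1 - t) * r i + t * snd (snd p $ i))) + ereal (h z)"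
        by (rule order_trans)
      moreover have "F x = ereal (R0 + h x)" unfolding F_def R0_def s r by simp
      ultimately have "R0 + h x \<le> (1 - t) * s + t * \<rho>
          + (\<Sum>i\<in>UNIV. (1 - t) * r i + t * snd (snd p $ i)) + h z" by simp
      also have "\<dots> = (1 - t) * R0 + t * R + h z"
        by (simp add: R_def R0_def sum.distrib sum_distrib_left distrib_left)
      finally have "t * (R0 - R) \<le> h z - h x" by (simp add: algebra_simps)
      then show "R0 - R \<le> (h (x + t *\<^sub>R (y - x)) - h x) / t"
        using t unfolding z_eq by (simp add: pos_le_divide_eq mult.commute)
    qed simp
    from tendsto_lowerbound[OF directional_derivative_tendsto[OF h] this]
    have "R0 - R \<le> d \<bullet> (y - x)" by simp
    then show ?thesis by (simp add: m_def c_def R_def R0_def y_def \<rho>_def inner_diff_right)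
  qed
  obtain v where v: "v \<in> K" "\<And>p. p \<in> W \<Longrightarrow> m + v \<bullet> T p \<le> c p"
    using lagrange_multiplier_exists[OF W T c K_eq K lower] by blast
  \<comment> \<open>Both subgradient inclusions come from the single inequality for
    \<open>v\<close>, tested at points that differ from the optimal one,
    \<open>((x, s), \<chi> i. (L i x, r i))\<close>, in one component.\<close>
  show thesis
  proof (rule that[of "\<lambda>i. v $ i"])
    show "v $ i \<in> G i" for i
    proof -
      obtain t p where "p \<in> W" "v = t *\<^sub>R T p" using v(1) unfolding K_eq by auto
      moreover have "fst (snd p $ i) \<in> G i" using \<open>p \<in> W\<close> by (auto simp: W_def epi_on_def case_prod_beta')
      ultimately show ?thesis using LG subspace_diff[OF G] subspace_scale[OF G] by (simp add: T_def)
    qed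
    show "(x, - (d + (\<Sum>i\<in>UNIV. adjoint (L i) (v $ i)))) \<in> epi_subgrad (epi_on C f)"
    proof (rule epi_subgrad_epi_onI[where g = f, OF xC s])
      fix y assume y: "y \<in> C"
      show "ereal (s + - (d + (\<Sum>i\<in>UNIV. adjoint (L i) (v $ i))) \<bullet> (y - x)) \<le> f y"
      proof (cases "f y")
        case (real \<rho>)
        define p where "p = ((y, \<rho>), \<chi> i. (L i x, r i))"
        have "p \<in> W" using y real LG r by (simp add: W_def p_def epi_on_def)
        then have "m + v \<bullet> T p \<le> c p" by (rule v(2))
        moreover have "v \<bullet> T p = - ((\<Sum>i\<in>UNIV. adjoint (L i) (v $ i)) \<bullet> (y - x))"
          by (simp add: T_def p_def inner_vec_def inner_sum_left inner_commute[of "adjoint _ _"]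
              adjoint_inner[OF L(1)] inner_commute[of "_ $ _"] inner_diff_left
              linear_diff[OF bounded_linear.linear[OF L(1)]] sum_subtractf)
        ultimately show ?thesis using real
          by (simp add: m_def c_def p_def inner_diff_left inner_diff_right inner_add_left)
      qed (use f(1) in auto)
    qed
    show "(L i x, v $ i) \<in> epi_subgrad (epi_on (G i) (g i))" for i
    proof (rule epi_subgrad_epi_onI[where g = "g i" and x = "L i x" and s = "r i", OF LG r])
      fix u assume u: "u \<in> G i"
      show "ereal (r i + v $ i \<bullet> (u - L i x)) \<le> g i u"
      proof (cases "g i u")
        case (real \<rho>)
        define p :: "('h \<times> real) \<times> (('g \<times> real) ^ 'm)"
          where "p = ((x, s), \<chi> j. if j = i then (u, \<rho>) else (L j x, r j))"
        have "p \<in> W" using u xC s real LG r by (simp add: W_def p_def epi_on_def)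
        then have "m + v \<bullet> T p \<le> c p" by (rule v(2))
        moreover have "v \<bullet> T p = (\<Sum>j\<in>UNIV. if j = i then v $ i \<bullet> (u - L i x) else 0)"
          unfolding inner_vec_def by (intro sum.cong) (auto simp: T_def p_def)
        moreover have "c p = s + (\<Sum>j\<in>UNIV. r j + (if j = i then \<rho> - r i else 0)) + d \<bullet> x"
          unfolding c_def p_def by (auto intro!: sum.cong)
        ultimately show ?thesis using real by (simp add: m_def sum.distrib)
      qed (use g(1)[OF u] in auto)
    qed
  qed
qed

section \<open>Convergence to an optimal solution\<close>

theorem theorem12:
  fixes f :: "'h::{real_inner, complete_space} \<Rightarrow> ereal"
    and h \<Psi> :: "'h \<Rightarrow> real"
    and grad_h grad_\<Psi> :: "'h \<Rightarrow> 'h"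
    and G :: "'m::finite \<Rightarrow> 'g::{real_inner, complete_space} set"
    and g :: "'m \<Rightarrow> 'g \<Rightarrow> ereal"
    and L :: "'m \<Rightarrow> 'h \<Rightarrow> 'g"
    and \<nu> \<mu> :: real
    and C Sol :: "'h set"
    and lam \<beta> :: "nat \<Rightarrow> real"
    and x z :: "nat \<Rightarrow> 'h"
    and y :: "int \<Rightarrow> 'h"
    and v :: "'m \<Rightarrow> nat \<Rightarrow> 'g"
    and q :: "'m \<Rightarrow> int \<Rightarrow> 'g"
  assumes f: "proper_on UNIV f" "econvex_on UNIV f" "lsc_on UNIV f"
    and h: "convex_on UNIV h" "\<And>w. GDERIV h w :> grad_h w"
    and grad_h: "\<nu> > 0" "lipschitz_on \<nu> UNIV grad_h"
    and G: "\<And>i. subspace (G i)" "\<And>i. closed (G i)"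
    and g: "\<And>i. proper_on (G i) (g i)" "\<And>i. econvex_on (G i) (g i)" "\<And>i. lsc_on (G i) (g i)"
    and L: "\<And>i. bounded_linear (L i)" "\<And>i. range (L i) \<subseteq> G i" "\<And>i. \<exists>w. L i w \<noteq> 0"
    and \<Psi>: "convex_on UNIV \<Psi>" "\<And>w. GDERIV \<Psi> w :> grad_\<Psi> w"
    and grad_\<Psi>: "\<mu> > 0" "lipschitz_on (inverse \<mu>) UNIV grad_\<Psi>"
    and C: "C = argmin_set \<Psi> UNIV"
    and min_\<Psi>: "\<exists>w\<in>C. \<Psi> w = 0"
    and Sol: "Sol = argmin_set (\<lambda>w. f w + (\<Sum>i\<in>UNIV. g i (L i w)) + ereal (h w)) C"
    and pos: "\<And>n. lam n > 0" "\<And>n. \<beta> n > 0"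
    and init: "\<And>i. v i 0 \<in> G i" "y (- 1) = x 0" "\<And>i. q i (- 1) = v i 0"
    and y_step: "\<And>n. y (int n) =
          prox UNIV (\<lambda>w. ereal (lam n) * f w)
            (x n - lam n *\<^sub>R (grad_h (y (int n - 1)) + (\<Sum>i\<in>UNIV. adjoint (L i) (q i (int n - 1))))
                 - (lam n * \<beta> n) *\<^sub>R grad_\<Psi> (y (int n - 1)))"
    and q_step: "\<And>i n. q i (int n) =
          prox (G i) (\<lambda>u. ereal (lam n) * fenchel_conj (G i) (g i) u)
            (v i n + lam n *\<^sub>R L i (y (int n - 1)))"
    and x_step: "\<And>n. x (n + 1) =
          (lam n * \<beta> n) *\<^sub>R (grad_\<Psi> (y (int n - 1)) - grad_\<Psi> (y (int n)))
          + lam n *\<^sub>R (grad_h (y (int n - 1)) - grad_h (y (int n)))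
          + lam n *\<^sub>R (\<Sum>i\<in>UNIV. adjoint (L i) (q i (int n - 1) - q i (int n)))
          + y (int n)"
    and v_step: "\<And>i n. v i (n + 1) = lam n *\<^sub>R L i (y (int n) - y (int n - 1)) + q i (int n)"
    and z: "\<And>n. z n = (1 / (\<Sum>k\<le>n. lam k)) *\<^sub>R (\<Sum>k\<le>n. lam k *\<^sub>R x k)"
    and cond_i: "maximally_monotone (op_plus (subdifferential f) (normal_cone C))" "Sol \<noteq> {}"
    and cond_ii: "\<And>p. p \<in> op_ran (normal_cone C) \<Longrightarrow>
          (\<Sum>n. ereal (lam n * \<beta> n) *
             (fenchel_conj UNIV (\<lambda>w. ereal (\<Psi> w)) (p /\<^sub>R \<beta> n) - support_fun C (p /\<^sub>R \<beta> n))) < \<infinity>"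
    and cond_iii: "summable (\<lambda>n. (lam n)\<^sup>2)" "\<not> summable lam"
    and cond_iv: "0 \<in> sqri {d - (\<chi> i. L i w) | (d :: 'g ^ 'm) w.
          (\<forall>i. d $ i \<in> dom_on (G i) (g i)) \<and> w \<in> dom_on UNIV f \<inter> C}"
    and limsup: "limsup (\<lambda>n. ereal (lam n * \<beta> n / \<mu>
          + lam n * (\<nu> + sqrt (\<Sum>i\<in>UNIV. (onorm (L i))\<^sup>2)))) < ereal (1 / 2)"
  shows "(\<exists>w\<in>Sol. weakly_converges z w) \<and>
         (strongly_econvex_on UNIV f \<and> (\<forall>i. strongly_econvex_on (G i) (fenchel_conj (G i) (g i)))
            \<longrightarrow> (\<exists>w. Sol = {w} \<and> x \<longlonglongrightarrow> w))"
proof -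
  obtain w0 where w0: "w0 \<in> C" "\<Psi> w0 = 0" using min_\<Psi> by blast
  have \<Psi>_nonneg: "0 \<le> \<Psi> w" for w
    using w0 unfolding C argmin_set_def is_arg_min_def by (auto simp: not_less)
  have C_eq: "C = {w. \<Psi> w \<le> 0}"
  proof (intro equalityI subsetI)
    fix w assume "w \<in> C"
    then have "\<not> \<Psi> w0 < \<Psi> w" unfolding C argmin_set_def is_arg_min_def by auto
    then show "w \<in> {w. \<Psi> w \<le> 0}" using w0(2) by simp
  next
    fix w assume "w \<in> {w. \<Psi> w \<le> 0}"
    then have "\<Psi> w \<le> \<Psi> w'" for w' using \<Psi>_nonneg[of w'] by simp
    then show "w \<in> C" unfolding C argmin_set_def is_arg_min_def by (auto simp: not_less)
  qed
  have \<Psi>_C: "\<Psi> w = 0" if "w \<in> C" for w using that \<Psi>_nonneg[of w] unfolding C_eq by simp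
  have "continuous_on UNIV \<Psi>"
    using \<Psi>(2) unfolding gderiv_def
    by (meson continuous_at_imp_continuous_on has_derivative_continuous)
  then have C_closed: "closed C" unfolding C_eq by (intro closed_Collect_le continuous_on_const)
  have C_convex: "convex C"
  proof (rule convexI)
    fix a b :: 'h and s t :: real
    assume ab: "a \<in> C" "b \<in> C" and st: "0 \<le> s" "0 \<le> t" "s + t = 1"
    have "\<Psi> (s *\<^sub>R a + t *\<^sub>R b) \<le> s * \<Psi> a + t * \<Psi> b"
      using \<Psi>(1) st unfolding convex_on_def by auto
    then show "s *\<^sub>R a + t *\<^sub>R b \<in> C" by (simp add: C_eq \<Psi>_C[OF ab(1)] \<Psi>_C[OF ab(2)])
  qed

  have f_ninf: "f w \<noteq> -\<infinity>" for w using f(1) by (simp add: proper_on_def)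
  have g_ninf: "g i u \<noteq> -\<infinity>" if "u \<in> G i" for i u using g(1) that by (simp add: proper_on_def)
  have LG: "L i w \<in> G i" for i w using L(2) by blast
  \<comment> \<open>Membership of 0 in the difference set yields a point of the domain of
    \<open>f\<close> inside \<open>C\<close>, so \<open>f\<close> restricted to \<open>C\<close> is
    proper.\<close>
  obtain wf where wf: "wf \<in> C" "f wf < \<infinity>" using cond_iv by (auto simp: sqri_def dom_on_def)
  have f_convex: "econvex_on C f" using f(2) by (simp add: econvex_on_def)
  have f_lsc: "lsc_on C f" by (rule lsc_on_subset[OF f(3)]) simp
  have proper: "proper_epi (epi_on C f)" "proper_epi (epi_on UNIV f)"
    by (rule proper_epi_epi_on[OF C_closed C_convex f_ninf f_convex f_lsc wf],
        rule proper_epi_epi_on[OF closed_UNIV convex_UNIV f_ninf f(2,3) UNIV_I wf(2)])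
  have proper_g: "proper_epi (epi_on (G i) (g i))" for i
  proof -
    obtain u where u: "u \<in> G i" "g i u < \<infinity>" using g(1)[of i] by (auto simp: proper_on_def dom_on_def)
    show ?thesis
      by (rule proper_epi_epi_on[OF G(2) subspace_imp_convex[OF G(1)] g_ninf g(2,3) u])
  qed

  define y' where "y' n = y (int n - 1)" for n
  define q' where "q' i n = q i (int n - 1)" for i n
  have y': "y' (Suc n) = y (int n)" and q': "q' i (Suc n) = q i (int n)" for i n
    by (simp_all add: y'_def q'_def)

  \<comment> \<open>The proximal point of the conjugate is taken over the carrier
    \<open>G i\<close>, so \<open>v i n\<close> must already lie there; the induction for
    \<open>vG\<close> supplies this at every index.\<close>
  have q_sub: "q' i (Suc n) \<in> G i \<and>
      ((v i n + lam n *\<^sub>R L i (y' n) - q' i (Suc n)) /\<^sub>R lam n, q' i (Suc n)) \<in> epi_subgrad (epi_on (G i) (g i))"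
    if vG: "v i n \<in> G i" for i n
  proof -
    define w where "w = v i n + lam n *\<^sub>R L i (y' n)"
    obtain b where b: "(b, (w /\<^sub>R lam n - b) /\<^sub>R (1 / lam n)) \<in> epi_subgrad (epi_on (G i) (g i))"
      using prox_point_exists[OF proper_g, of "1 / lam n" "w /\<^sub>R lam n"] pos(1)[of n] by auto
    define u where "u = w - lam n *\<^sub>R b"
    have u: "(w /\<^sub>R lam n - b) /\<^sub>R (1 / lam n) = u"
      using pos(1)[of n] by (simp add: u_def scaleR_diff_right)
    have "b \<in> G i" using b by (auto simp: epi_subgrad_def epi_on_def)
    then have uG: "u \<in> G i" unfolding u_def w_def
      using vG LG by (intro subspace_diff subspace_add subspace_scale G(1))
    have "q' i (Suc n) = u"
      unfolding q' q_step y'_def[symmetric] w_def[symmetric]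
      by (rule prox_fenchel_conj[OF b[unfolded u] g_ninf pos(1) uG]) (simp_all add: u_def)
    moreover have "(w - u) /\<^sub>R lam n = b" using pos(1)[of n] by (simp add: u_def)
    ultimately show ?thesis using uG b[unfolded u] by (simp add: w_def)
  qed
  have vG: "v i n \<in> G i" for i n
  proof (induction n)
    case (Suc n)
    have "q i (int n) \<in> G i" using q_sub[OF Suc] by (simp add: q')
    then show ?case using v_step[of i n] LG by (simp add: subspace_add subspace_scale G(1))
  qed (rule init)

  interpret pd: primal_dual "epi_on C f" "\<lambda>i. epi_on (G i) (g i)" grad_h L \<nu>
  proof (rule primal_dual.intro)
    show "0 \<le> (grad_h a - grad_h b) \<bullet> (a - b)" for a b by (rule convex_gradient_monotone[OF h])
    show "norm (grad_h a - grad_h b) \<le> \<nu> * norm (a - b)" for a b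
      using lipschitz_onD[OF grad_h(2)] by (simp add: dist_norm)
    show "0 \<le> \<nu>" using grad_h(1) by simp
  qed (rule proper proper_g L)+
  define rate where "rate n = lam n * \<beta> n / \<mu> + lam n * (\<nu> + pd.\<Lambda>)" for n
  have "limsup (\<lambda>n. ereal (rate n)) < ereal (1 / 2)" using limsup by (simp add: rate_def pd.\<Lambda>_def)
  then obtain \<kappa>0 where \<kappa>0: "limsup (\<lambda>n. ereal (rate n)) < ereal \<kappa>0" "\<kappa>0 < 1 / 2"
    using ereal_dense2 by fastforce
  \<comment> \<open>\<open>\<kappa>0\<close> lies between the limit superior and 1/2; the maximum
    with 0 supplies the required sign and stays below 1/2.\<close>
  define \<kappa> where "\<kappa> = max 0 \<kappa>0"
  have \<kappa>: "\<forall>\<^sub>F n in sequentially. rate n \<le> \<kappa>"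
    using Limsup_lessD[OF \<kappa>0(1)] by eventually_elim (auto simp: \<kappa>_def)

  \<comment> \<open>Two epigraphs of the same function occur: over \<open>C\<close> for the limit
    inclusion, over the whole space for the proximal step.\<close>
  interpret ps: penalty_scheme "epi_on C f" "\<lambda>i. epi_on (G i) (g i)" grad_h L \<nu> "epi_on UNIV f"
    C \<Psi> grad_\<Psi> \<mu> \<kappa> lam \<beta> x y' v q'
  proof (intro penalty_scheme.intro penalty_scheme_axioms.intro pd.primal_dual_axioms)
    show "\<exists>a' p. a = a' + p \<and> (w, a') \<in> epi_subgrad (epi_on UNIV f) \<and> p \<in> normal_cone C w"
      if "(w, a) \<in> epi_subgrad (epi_on C f)" for w a
      by (rule maximal_subdifferential_sum[OF cond_i(1) f_ninf that])
    show "\<Psi> w + grad_\<Psi> w \<bullet> (w' - w) \<le> \<Psi> w'" for w w'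
      by (rule convex_gradient_inequality[OF \<Psi>])
    show "norm (grad_\<Psi> a - grad_\<Psi> b) \<le> inverse \<mu> * norm (a - b)" for a b
      using lipschitz_onD[OF grad_\<Psi>(2)] by (simp add: dist_norm)
    show "\<exists>eps. summable eps \<and> (\<forall>n w'. lam n * (p \<bullet> (w' - w)) - lam n * \<beta> n * \<Psi> w' \<le> eps n)"
      if "p \<in> normal_cone C w" for w p
      by (rule penalty_error_summable[OF pos \<Psi>_C cond_ii that]) (use that in \<open>auto simp: op_ran_def\<close>)
    show "0 \<le> \<kappa>" "\<kappa> < 1 / 2" using \<kappa>0 by (auto simp: \<kappa>_def)
    show "\<forall>\<^sub>F n in sequentially. lam n * \<beta> n / \<mu> + lam n * (\<nu> + pd.\<Lambda>) \<le> \<kappa>"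
      using \<kappa> by (simp add: rate_def)
    show "(y' (Suc n), (x n - lam n *\<^sub>R (grad_h (y' n) + (\<Sum>i\<in>UNIV. adjoint (L i) (q' i n)))
          - (lam n * \<beta> n) *\<^sub>R grad_\<Psi> (y' n) - y' (Suc n)) /\<^sub>R lam n) \<in> epi_subgrad (epi_on UNIV f)" for n
    proof -
      define w where "w = x n - lam n *\<^sub>R (grad_h (y' n) + (\<Sum>i\<in>UNIV. adjoint (L i) (q' i n)))
          - (lam n * \<beta> n) *\<^sub>R grad_\<Psi> (y' n)"
      obtain p where p: "(p, (w - p) /\<^sub>R lam n) \<in> epi_subgrad (epi_on UNIV f)"
        using prox_point_exists[OF proper(2) pos(1)] by blast
      have "y' (Suc n) = p"
        unfolding y' y_step q'_def[symmetric] y'_def[symmetric] w_def[symmetric]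
        by (rule prox_epi_subgrad[OF p f_ninf pos(1)])
      with p show ?thesis by (simp add: w_def)
    qed
    show "((v i n + lam n *\<^sub>R L i (y' n) - q' i (Suc n)) /\<^sub>R lam n, q' i (Suc n))
        \<in> epi_subgrad (epi_on (G i) (g i))" for i n
      using q_sub[OF vG] by blast
    show "x (Suc n) = (lam n * \<beta> n) *\<^sub>R (grad_\<Psi> (y' n) - grad_\<Psi> (y' (Suc n)))
        + lam n *\<^sub>R (grad_h (y' n) - grad_h (y' (Suc n)))
        + lam n *\<^sub>R (\<Sum>i\<in>UNIV. adjoint (L i) (q' i n - q' i (Suc n))) + y' (Suc n)" for n
      using x_step[of n] unfolding y' q' by (simp add: y'_def q'_def)
    show "v i (Suc n) = lam n *\<^sub>R L i (y' (Suc n) - y' n) + q' i (Suc n)" for i n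
      using v_step[of i n] unfolding y' q' by (simp add: y'_def)
  qed (rule \<Psi>_C grad_\<Psi> pos cond_iii | assumption)+

  have zero_opt: "fst u \<in> Sol" if "u \<in> pd.zeros" for u
    unfolding Sol
  proof (rule zero_imp_optimal[where v = "\<lambda>i. snd u $ i" and G = G and d = "grad_h (fst u)", OF f_ninf g_ninf L(1,2)])
    show "h (fst u) + grad_h (fst u) \<bullet> (w - fst u) \<le> h w" for w
      by (rule convex_gradient_inequality[OF h])
  qed (use that in \<open>auto simp: pd.mem_zeros_iff\<close>)
  have opt_zero: "\<exists>u\<in>pd.zeros. fst u = w \<and> (\<forall>i. snd u $ i \<in> G i)" if w: "w \<in> Sol" for w
  proof -
    obtain m where m: "\<And>i. m i \<in> G i"
      "(w, - (grad_h w + (\<Sum>i\<in>UNIV. adjoint (L i) (m i)))) \<in> epi_subgrad (epi_on C f)"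
      "\<And>i. (L i w, m i) \<in> epi_subgrad (epi_on (G i) (g i))"
    proof (rule optimal_imp_multiplier[OF f_ninf _ _ g_ninf _ _ G(1) L(1,2) h(2) cond_iv w[unfolded Sol]])
      show "closed (epi_on C f)" "convex (epi_on C f)" using proper(1) by (auto simp: proper_epi_def)
      show "closed (epi_on (G i) (g i))" "convex (epi_on (G i) (g i))" for i
        using proper_g[of i] by (auto simp: proper_epi_def)
    qed (assumption, rule that)
    then have "(w, \<chi> i. m i) \<in> pd.zeros" by (simp add: pd.mem_zeros_iff)
    then show ?thesis using m(1) by force
  qed

  show ?thesis
  proof (intro conjI impI)
    have "pd.zeros \<noteq> {}" using opt_zero cond_i(2) by blast
    from ps.ergodic_convergence[OF this] obtain u where u: "u \<in> pd.zeros"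
      "weakly_converges (\<lambda>n. (1 / (\<Sum>k\<le>n. lam k)) *\<^sub>R (\<Sum>k\<le>n. lam k *\<^sub>R ps.X k)) u" by blast
    have "(\<lambda>n. z n \<bullet> e) \<longlonglongrightarrow> fst u \<bullet> e" for e
    proof -
      \<comment> \<open>Test vectors \<open>(e, 0)\<close> extract weak convergence of the primal
        component from that of the pair.\<close>
      have "(\<lambda>n. ((1 / (\<Sum>k\<le>n. lam k)) *\<^sub>R (\<Sum>k\<le>n. lam k *\<^sub>R ps.X k)) \<bullet> (e, 0)) \<longlonglongrightarrow> u \<bullet> (e, 0)"
        using u(2) unfolding weakly_converges_def by blast
      then show ?thesis by (simp add: inner_prod_def z fst_sum ps.X_def)
    qed
    then show "\<exists>w\<in>Sol. weakly_converges z w" using zero_opt[OF u(1)] unfolding weakly_converges_def by blast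
  next
    assume strong: "strongly_econvex_on UNIV f \<and> (\<forall>i. strongly_econvex_on (G i) (fenchel_conj (G i) (g i)))"
    obtain \<gamma>f where \<gamma>f: "\<gamma>f > 0" "\<forall>x\<in>UNIV. \<forall>y\<in>UNIV. \<forall>t\<in>{0<..<1}.
       f ((1 - t) *\<^sub>R x + t *\<^sub>R y) + ereal (\<gamma>f / 2 * t * (1 - t) * (norm (x - y))\<^sup>2)
         \<le> ereal (1 - t) * f x + ereal t * f y"
      using strong unfolding strongly_econvex_on_def by blast
    obtain \<gamma>g where \<gamma>g: "\<And>i. \<gamma>g i > 0" "\<And>i. \<forall>x\<in>G i. \<forall>y\<in>G i. \<forall>t\<in>{0<..<1}.
       fenchel_conj (G i) (g i) ((1 - t) *\<^sub>R x + t *\<^sub>R y) + ereal (\<gamma>g i / 2 * t * (1 - t) * (norm (x - y))\<^sup>2)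
         \<le> ereal (1 - t) * fenchel_conj (G i) (g i) x + ereal t * fenchel_conj (G i) (g i) y"
      using strong unfolding strongly_econvex_on_def by metis
    define \<gamma> where "\<gamma> = Min (insert \<gamma>f (range \<gamma>g))"
    have \<gamma>: "\<gamma> > 0" using \<gamma>f(1) \<gamma>g(1) by (simp add: \<gamma>_def)
    have \<gamma>_le: "\<gamma> \<le> \<gamma>f" "\<gamma> \<le> \<gamma>g i" for i unfolding \<gamma>_def by (rule Min_le; simp)+
    have f_strong: "\<gamma> * (norm (w - w'))\<^sup>2 \<le> (a - a') \<bullet> (w - w')"
      if "(w, a) \<in> epi_subgrad (epi_on UNIV f)" "(w', a') \<in> epi_subgrad (epi_on UNIV f)" for w a w' a'
    proof -
      have "\<gamma> * (norm (w - w'))\<^sup>2 \<le> \<gamma>f * (norm (w - w'))\<^sup>2" using \<gamma>_le(1) by (intro mult_right_mono) auto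
      also have "\<dots> \<le> (a - a') \<bullet> (w - w')"
        by (rule strongly_econvex_epi_subgrad_monotone[OF convex_UNIV f_ninf \<gamma>f(2) that])
      finally show ?thesis .
    qed
    \<comment> \<open>Strong convexity is assumed of the conjugates, so the subgradient pairs of
      \<open>g i\<close> are turned around before the monotonicity estimate is applied.\<close>
    have conj_sub: "(a, w) \<in> epi_subgrad (epi_on (G i) (fenchel_conj (G i) (g i))) \<and>
        (\<forall>u. fenchel_conj (G i) (g i) u \<noteq> -\<infinity>)"
      if sub: "(w, a) \<in> epi_subgrad (epi_on (G i) (g i))" and aG: "a \<in> G i" for i w a
    proof -
      obtain s where s: "fenchel_conj (G i) (g i) a = ereal s"
        "\<And>u. ereal (s + w \<bullet> (u - a)) \<le> fenchel_conj (G i) (g i) u"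
        by (rule epi_subgrad_fenchel_conj[OF sub g_ninf]) (assumption, rule that)
      have "(a, w) \<in> epi_subgrad (epi_on (G i) (fenchel_conj (G i) (g i)))"
        by (rule epi_subgrad_epi_onI[where g = "fenchel_conj (G i) (g i)", OF aG s(1) s(2)])
      moreover have "fenchel_conj (G i) (g i) u \<noteq> -\<infinity>" for u using s(2)[of u] by auto
      ultimately show ?thesis by blast
    qed
    have g_strong: "\<gamma> * (norm (a - a'))\<^sup>2 \<le> (b - b') \<bullet> (a - a')"
      if "(b, a) \<in> epi_subgrad (epi_on (G i) (g i))" "(b', a') \<in> epi_subgrad (epi_on (G i) (g i))"
        "a \<in> G i" "a' \<in> G i" for i b a b' a'
    proof -
      have "\<gamma> * (norm (a - a'))\<^sup>2 \<le> \<gamma>g i * (norm (a - a'))\<^sup>2" using \<gamma>_le(2) by (intro mult_right_mono) auto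
      also have "\<dots> \<le> (b - b') \<bullet> (a - a')"
        using conj_sub[OF that(1,3)] conj_sub[OF that(2,4)]
        by (intro strongly_econvex_epi_subgrad_monotone[OF subspace_imp_convex[OF G(1)] _ \<gamma>g(2)]) auto
      finally show ?thesis .
    qed
    \<comment> \<open>Any optimal solution extends to a zero and hence is the limit of the same
      sequence; uniqueness of the solution is then uniqueness of limits.\<close>
    have lim: "x \<longlonglongrightarrow> w" if w: "w \<in> Sol" for w
    proof -
      obtain u where u: "u \<in> pd.zeros" "fst u = w" "\<And>i. snd u $ i \<in> G i" using opt_zero[OF w] by blast
      have "ps.X \<longlonglongrightarrow> u"
      proof (rule ps.strong_convergence_to_zero[OF u(1,3) _ \<gamma> f_strong g_strong])
        show "q' i (Suc n) \<in> G i" for i n using q_sub[OF vG] by blast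
      qed
      from tendsto_fst[OF this] show ?thesis by (simp add: ps.X_def u(2))
    qed
    obtain w where w: "w \<in> Sol" using cond_i(2) by blast
    have "w' = w" if "w' \<in> Sol" for w' using LIMSEQ_unique[OF lim[OF that] lim[OF w]] .
    then show "\<exists>w. Sol = {w} \<and> x \<longlonglongrightarrow> w" using w lim[OF w] by blast
  qed
qed

end
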